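(* Let $\alpha\in\mathbb R$ be such that, for some $\delta>0$, the inequality $$|\alpha-p/q|<\exp(-q^{1+\delta})$$ has infinitely many solutions in relatively prime integers $p,q$ with $q\ge1$. Take $0<\sigma<\min\{\delta/3,1\}$. Then for every $\rho>0$ there exists a sequence $\alpha_n=p_n/q_n$, $n\ge1$ (a subsequence of the solutions $p/q$, with $p,q$ relatively prime and $q\ge1$, of the inequality $|\alpha-p/q|<\exp(-q^{1+\delta})$), such that the diffeomorphisms of $\mathbb T^2=\mathbb R^2/\mathbb Z^2$ defined by $$\phi_n(\theta,r)=(\theta,\ r+q_n^2\cos(2\pi q_n\theta)),\qquad g_n(\theta,r)=(\theta+[nq_n^{\sigma}]\,r,\ r),$$ $$h_n=g_n\circ\phi_n,\qquad H_n=h_1\circ\dots\circ h_n,\qquad f_n=H_n\circ R_{\alpha_{n+1}}\circ H_n^{-1}$$ converge in the sense of the $d_\rho(\cdot,\cdot)$-metric, and the limit $f=\lim_{n\to\infty}f_n$ is weak mixing (with respect to Lebesgue measure on $\mathbb T^2$).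
   Context: $[\,\cdot\,]$ is the integer part, and $R_t(\theta,r)=(\theta+t,r)$. For $\rho>0$ let $A^\rho=\{(\theta,r)\in\mathbb C^2:|\mathrm{Im}\,\theta|<\rho,\ |\mathrm{Im}\,r|<\rho\}$; $C^\omega_\rho(\mathbb T^2)$ is the set of real-analytic $\mathbb Z^2$-periodic functions on $\mathbb R^2$ that extend holomorphically to $A^\rho$ with $\|f\|_\rho:=\sup_{A^\rho}|f|<\infty$. $\mathrm{Diff}^\omega_\rho$ is the space of diffeomorphisms of $\mathbb T^2$, homotopic to the identity, with a lift $F(\theta,r)=(\theta+f_1(\theta,r),r+f_2(\theta,r))$ where $f_1,f_2\in C^\omega_\rho(\mathbb T^2)$. For $F,G\in\mathrm{Diff}^\omega_\rho$ (with corresponding $f_i,g_i$), $d_\rho(F,G)=\max_{i=1,2}\inf_{p\in\mathbb Z}\|f_i-g_i+p\|_\rho$. A measure-preserving map $T$ is weak mixing if there is no nonconstant measurable complex function $h$ with $h\circ T=\lambda h$ a.e. for some constant $\lambda\in\mathbb C$. *)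

theory Defs
  imports "HOL-Analysis.Analysis"
begin

section \<open>The torus and its Lebesgue measure\<close>

definition lattice_rel :: "real \<times> real \<Rightarrow> real \<times> real \<Rightarrow> bool" where
  "lattice_rel x y \<longleftrightarrow> fst x - fst y \<in> \<int> \<and> snd x - snd y \<in> \<int>"

quotient_type torus = "real \<times> real" / lattice_rel
  morphisms torus_rep torus_proj
proof (rule equivpI)
  show "reflp lattice_rel"
    by (simp add: reflp_def lattice_rel_def)
  show "symp lattice_rel"
    unfolding symp_def lattice_rel_def by (metis Ints_minus minus_diff_eq)
  show "transp lattice_rel"
  proof (rule transpI)
    fix x y z
    assume "lattice_rel x y" "lattice_rel y z"
    then have "(fst x - fst y) + (fst y - fst z) \<in> \<int>" "(snd x - snd y) + (snd y - snd z) \<in> \<int>"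
      unfolding lattice_rel_def by (blast intro: Ints_add)+
    then show "lattice_rel x z"
      by (simp add: lattice_rel_def)
  qed
qed

text \<open>
  A set is measurable if its full preimage in the plane is Lebesgue measurable; its measure is
  the area of the part of this preimage in a fundamental square.
\<close>

definition torus_measure :: "torus measure" where
  "torus_measure =
     distr (lebesgue_on ({0..<1} \<times> {0..<1}))
       (sigma UNIV {B. torus_proj -` B \<in> sets lebesgue}) torus_proj"

section \<open>Weak mixing\<close>

definition measure_preserving :: "'a measure \<Rightarrow> ('a \<Rightarrow> 'a) \<Rightarrow> bool" where
  "measure_preserving M T \<longleftrightarrow> T \<in> measurable M M \<and> distr M M T = M"

text \<open>As usual, constancy is understood modulo null sets.\<close>

definition weak_mixing :: "'a measure \<Rightarrow> ('a \<Rightarrow> 'a) \<Rightarrow> bool" where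
  "weak_mixing M T \<longleftrightarrow>
     measure_preserving M T \<and>
     \<not> (\<exists>(h :: 'a \<Rightarrow> complex) \<in> borel_measurable M.
          (\<exists>l. AE x in M. h (T x) = l * h x) \<and>
          \<not> (\<exists>c. AE x in M. h x = c))"

section \<open>Analytic periodic functions\<close>

definition strip :: "real \<Rightarrow> (complex \<times> complex) set" where
  "strip \<rho> = {(\<theta>, r). \<bar>Im \<theta>\<bar> < \<rho> \<and> \<bar>Im r\<bar> < \<rho>}"

definition holomorphic2_on :: "(complex \<times> complex \<Rightarrow> complex) \<Rightarrow> (complex \<times> complex) set \<Rightarrow> bool" where
  "holomorphic2_on F S \<longleftrightarrow>
     (\<forall>z\<in>S. \<exists>a b. (F has_derivative (\<lambda>(u, v). a * u + b * v)) (at z within S))"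

definition bounded_extension ::
    "real \<Rightarrow> (real \<times> real \<Rightarrow> real) \<Rightarrow> (complex \<times> complex \<Rightarrow> complex) \<Rightarrow> bool" where
  "bounded_extension \<rho> f F \<longleftrightarrow>
     holomorphic2_on F (strip \<rho>) \<and> bounded (F ` strip \<rho>) \<and>
     (\<forall>\<theta> r. F (of_real \<theta>, of_real r) = of_real (f (\<theta>, r)))"

definition periodic2 :: "(real \<times> real \<Rightarrow> real) \<Rightarrow> bool" where
  "periodic2 f \<longleftrightarrow> (\<forall>\<theta> r. \<forall>m n :: int. f (\<theta> + of_int m, r + of_int n) = f (\<theta>, r))"

text \<open>
  Real-analyticity on the plane is implied by the existence of the holomorphic extension.
\<close>

definition C_omega :: "real \<Rightarrow> (real \<times> real \<Rightarrow> real) set" where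
  "C_omega \<rho> = {f. periodic2 f \<and> (\<exists>F. bounded_extension \<rho> f F)}"

text \<open>
  By the identity theorem the values of the extension on the strip do not depend on the choice.
\<close>

definition strip_norm :: "real \<Rightarrow> (real \<times> real \<Rightarrow> real) \<Rightarrow> real" where
  "strip_norm \<rho> f = (SUP z\<in>strip \<rho>. norm ((SOME F. bounded_extension \<rho> f F) z))"

section \<open>Analytic diffeomorphisms of the torus\<close>

definition is_lift :: "(real \<times> real \<Rightarrow> real \<times> real) \<Rightarrow> (torus \<Rightarrow> torus) \<Rightarrow> bool" where
  "is_lift F T \<longleftrightarrow> (\<forall>x. T (torus_proj x) = torus_proj (F x))"

primrec Ck :: "nat \<Rightarrow> (real \<times> real \<Rightarrow> real \<times> real) \<Rightarrow> bool" where
  "Ck 0 F \<longleftrightarrow> continuous_on UNIV F"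
| "Ck (Suc k) F \<longleftrightarrow>
     (\<exists>a b. (\<forall>x. (F has_derivative (\<lambda>(u, v). u *\<^sub>R a x + v *\<^sub>R b x)) (at x)) \<and> Ck k a \<and> Ck k b)"

definition smooth :: "(real \<times> real \<Rightarrow> real \<times> real) \<Rightarrow> bool" where
  "smooth F \<longleftrightarrow> (\<forall>k. Ck k F)"

text \<open>
  The projection is a smooth covering and the plane is simply connected, so a self-map of the
  torus is smooth iff it has a smooth lift to the plane.
\<close>

definition torus_diffeo :: "(torus \<Rightarrow> torus) \<Rightarrow> bool" where
  "torus_diffeo T \<longleftrightarrow>
     bij T \<and> (\<exists>F. smooth F \<and> is_lift F T) \<and> (\<exists>G. smooth G \<and> is_lift G (inv T))"

definition displacement ::
    "real \<Rightarrow> (torus \<Rightarrow> torus) \<Rightarrow> (real \<times> real \<Rightarrow> real) \<times> (real \<times> real \<Rightarrow> real) \<Rightarrow> bool" where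
  "displacement \<rho> T f \<longleftrightarrow>
     fst f \<in> C_omega \<rho> \<and> snd f \<in> C_omega \<rho> \<and>
     is_lift (\<lambda>(\<theta>, r). (\<theta> + fst f (\<theta>, r), r + snd f (\<theta>, r))) T"

text \<open>
  A lift with periodic displacement makes the map homotopic to the identity: multiply the
  displacement by a parameter running from 0 to 1.
\<close>

definition Diff_omega :: "real \<Rightarrow> (torus \<Rightarrow> torus) set" where
  "Diff_omega \<rho> = {T. torus_diffeo T \<and> (\<exists>f. displacement \<rho> T f)}"

text \<open>
  Displacements of the same map differ by a pair of integer constants, so the infima over the
  integers make the distance independent of the chosen ones.
\<close>

definition d_rho :: "real \<Rightarrow> (torus \<Rightarrow> torus) \<Rightarrow> (torus \<Rightarrow> torus) \<Rightarrow> real" where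
  "d_rho \<rho> S T =
     (let f = (SOME f. displacement \<rho> S f); g = (SOME g. displacement \<rho> T g) in
      max (INF p :: int. strip_norm \<rho> (\<lambda>x. fst f x - fst g x + of_int p))
          (INF p :: int. strip_norm \<rho> (\<lambda>x. snd f x - snd g x + of_int p)))"

section \<open>The construction\<close>

lift_definition torus_rotation :: "real \<Rightarrow> torus \<Rightarrow> torus" is
  "\<lambda>t (\<theta>, r). (\<theta> + t, r)"
  by (auto simp: lattice_rel_def)

lift_definition torus_phi :: "int \<Rightarrow> torus \<Rightarrow> torus" is
  "\<lambda>q (\<theta>, r). (\<theta>, r + (of_int q)\<^sup>2 * cos (2 * pi * of_int q * \<theta>))"
proof -
  fix q :: int and x y :: "real \<times> real"
  assume xy: "lattice_rel x y"
  obtain a b c d where [simp]: "x = (a, b)" "y = (c, d)" by (cases x, cases y)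
  from xy obtain m where m: "a - c = of_int m" by (auto simp: lattice_rel_def elim: Ints_cases)
  have "a = c + of_int m"
    using m by linarith
  then have eq: "2 * pi * of_int q * a = 2 * pi * of_int q * c + 2 * pi * of_int (q * m)"
    by (simp only: distrib_left of_int_mult mult.assoc)
  have "cos (2 * pi * of_int q * a) = cos (2 * pi * of_int q * c)"
    unfolding eq by (simp only: cos_add sin_int_2pin cos_int_2pin mult_1_right mult_zero_right diff_0_right)
  then show "lattice_rel (case x of (\<theta>, r) \<Rightarrow> (\<theta>, r + (of_int q)\<^sup>2 * cos (2 * pi * of_int q * \<theta>)))
                         (case y of (\<theta>, r) \<Rightarrow> (\<theta>, r + (of_int q)\<^sup>2 * cos (2 * pi * of_int q * \<theta>)))"
    using xy by (simp add: lattice_rel_def)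
qed

lift_definition torus_shear :: "int \<Rightarrow> torus \<Rightarrow> torus" is
  "\<lambda>k (\<theta>, r). (\<theta> + of_int k * r, r)"
proof -
  fix k :: int and x y :: "real \<times> real"
  assume xy: "lattice_rel x y"
  have "(fst x - fst y) + of_int k * (snd x - snd y) \<in> \<int>"
    using xy by (intro Ints_add Ints_mult) (auto simp: lattice_rel_def)
  then show "lattice_rel (case x of (\<theta>, r) \<Rightarrow> (\<theta> + of_int k * r, r))
                         (case y of (\<theta>, r) \<Rightarrow> (\<theta> + of_int k * r, r))"
    using xy by (simp add: lattice_rel_def split_beta algebra_simps)
qed

definition h_map :: "real \<Rightarrow> (nat \<Rightarrow> int) \<Rightarrow> nat \<Rightarrow> torus \<Rightarrow> torus" where
  "h_map \<sigma> q n = torus_shear \<lfloor>of_nat n * of_int (q n) powr \<sigma>\<rfloor> \<circ> torus_phi (q n)"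

primrec H_map :: "real \<Rightarrow> (nat \<Rightarrow> int) \<Rightarrow> nat \<Rightarrow> torus \<Rightarrow> torus" where
  "H_map \<sigma> q 0 = id"
| "H_map \<sigma> q (Suc n) = H_map \<sigma> q n \<circ> h_map \<sigma> q (Suc n)"

definition f_map :: "real \<Rightarrow> (nat \<Rightarrow> int) \<Rightarrow> (nat \<Rightarrow> int) \<Rightarrow> nat \<Rightarrow> torus \<Rightarrow> torus" where
  "f_map \<sigma> p q n =
     H_map \<sigma> q n \<circ> torus_rotation (of_int (p (Suc n)) / of_int (q (Suc n))) \<circ> inv (H_map \<sigma> q n)"

definition liouville_solution :: "real \<Rightarrow> real \<Rightarrow> int \<Rightarrow> int \<Rightarrow> bool" where
  "liouville_solution \<alpha> \<delta> p q \<longleftrightarrow>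
     coprime p q \<and> q \<ge> 1 \<and> \<bar>\<alpha> - of_int p / of_int q\<bar> < exp (- (of_int q powr (1 + \<delta>)))"

end

(*
  Let H_n, f_n be as in the statement. Since h_n commutes with the rotation by p_n/q_n,
  f_{n-1} = H_{n-1} R_{p_n/q_n} H_{n-1}^{-1} and f_n = H_{n-1} Phi H_{n-1}^{-1} with
  Phi = h_n R_{alpha_{n+1}} h_n^{-1}. Here Phi differs from the rotation by p_n/q_n by terms of size
  exp(-q_n^{1+delta}) exp(C n q_n^{1+sigma}) on a complex strip depending only on q_1, ..., q_{n-1},
  so each f_n is as close to f_{n-1} as desired once q_n is large; the same holds for iterates and
  inverses.

  For weak mixing pick m with q_n m alpha_{n+1} away from the integers. On characters,
  h_n R_{m alpha_{n+1}} h_n^{-1} produces a phase of amplitude about q_n^2, whose mean is a Bessel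
  function of a large argument: by density of the trigonometric polynomials, correlations of any two
  continuous functions along f_n^m tend to the product of the means. As f^m is close to f_n^m,
  correlations along a sequence of iterates of f decay, which excludes nonconstant eigenfunctions.
*)
theory Submission
  imports Defs "HOL-Complex_Analysis.Complex_Analysis" "HOL-Probability.Probability_Measure"
    "HOL-Real_Asymp.Real_Asymp" "HOL-Number_Theory.Cong"
begin

section \<open>Holomorphic functions of two variables\<close>

text \<open>The order of choices shapes the proof: \<open>q_n\<close> is fixed before
  \<open>p_{n+1} / q_{n+1}\<close> is known. Both demands on \<open>q_n\<close> are therefore
  uniform in what comes later: closeness is asked for every rotation number within
  \<open>2 * exp (- q_n^(1 + \<delta>))\<close> of \<open>p_n / q_n\<close>, decay of correlations
  for every time \<open>t\<close> with \<open>\<bar>sin (pi * q_n * t)\<bar> \<ge> 1/2\<close>.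
  Closeness is asked for all iterates \<open>m\<close> with \<open>\<bar>m\<bar> \<le> q_n\<close>:
  the mixing time of \<open>f_n\<close> is found modulo \<open>q_{n+1}\<close>, hence lies below
  \<open>q_{n+1}\<close>, and from then on all changes are summably small along that many iterates.
  The case \<open>m = - 1\<close> makes the inverses converge, so that the limit is a
  diffeomorphism. Continuous functions are tested instead of characters because the fixed map
  \<open>H_{n-1}\<close> turns characters into other functions. With
  \<open>k = [n q_n^\<sigma>]\<close>, the phase produced from the character with indices
  \<open>a, b\<close> has frequency \<open>a * k + b\<close>; \<open>\<sigma> > 0\<close> makes
  \<open>k\<close> large, so that it is nonzero, while \<open>\<sigma> < \<delta>\<close> keeps the
  distortion by \<open>h_n\<close> below the Liouville error.\<close>

definition sep_holomorphic :: "complex set \<Rightarrow> complex set \<Rightarrow> (complex \<times> complex \<Rightarrow> complex) \<Rightarrow> bool" where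
  "sep_holomorphic A B F \<longleftrightarrow> continuous_on (A \<times> B) F \<and>
     (\<forall>w\<in>B. (\<lambda>z. F (z, w)) holomorphic_on A) \<and> (\<forall>z\<in>A. (\<lambda>w. F (z, w)) holomorphic_on B)"

definition partial1 :: "(complex \<times> complex \<Rightarrow> complex) \<Rightarrow> complex \<times> complex \<Rightarrow> complex" where
  "partial1 F p = deriv (\<lambda>z. F (z, snd p)) (fst p)"

definition partial2 :: "(complex \<times> complex \<Rightarrow> complex) \<Rightarrow> complex \<times> complex \<Rightarrow> complex" where
  "partial2 F p = deriv (\<lambda>w. F (fst p, w)) (snd p)"

lemma sep_holomorphic_swap: "sep_holomorphic A B F \<Longrightarrow> sep_holomorphic B A (\<lambda>p. F (prod.swap p))"
  unfolding sep_holomorphic_def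
  by (auto intro!: continuous_on_compose2[of "A \<times> B" F] continuous_on_swap)

lemma partial2_swap: "partial2 F p = partial1 (\<lambda>p. F (prod.swap p)) (prod.swap p)"
  by (simp add: partial1_def partial2_def)

text \<open>The factor 2 leaves room to move: a ball of radius \<open>R\<close> whose centre is
  shifted by less than \<open>R\<close> stays inside \<open>A\<close>, respectively
  \<open>B\<close>.\<close>

lemma open_times_cball:
  fixes p :: "complex \<times> complex"
  assumes "open A" "open B" "p \<in> A \<times> B"
  obtains R where "R > 0" "cball (fst p) (2 * R) \<subseteq> A" "cball (snd p) (2 * R) \<subseteq> B"
proof -
  obtain a where a: "a > 0" "cball (fst p) a \<subseteq> A"
    using assms open_contains_cball by (metis mem_Times_iff)
  obtain b where b: "b > 0" "cball (snd p) b \<subseteq> B"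
    using assms open_contains_cball by (metis mem_Times_iff)
  show thesis
  proof (rule that[of "min a b / 2"])
    show "cball (fst p) (2 * (min a b / 2)) \<subseteq> A"
      using a subset_cball[of "min a b" a "fst p"] by (auto simp del: mem_cball)
    show "cball (snd p) (2 * (min a b / 2)) \<subseteq> B"
      using b subset_cball[of "min a b" b "snd p"] by (auto simp del: mem_cball)
  qed (use a b in auto)
qed

text \<open>A derivative at a moving point is turned into the derivative of a moving function at the
  fixed point \<open>fst p\<close>: the translates \<open>f q\<close> are holomorphic near
  \<open>fst p\<close> and converge uniformly as \<open>q\<close> tends to \<open>p\<close>, and
  uniform convergence of holomorphic functions carries over to derivatives.\<close>

lemma continuous_on_partial1:
  assumes "open A" "open B" and F: "sep_holomorphic A B F"
  shows "continuous_on (A \<times> B) (partial1 F)"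
proof -
  have "(partial1 F \<longlongrightarrow> partial1 F p) (at p)" if p: "p \<in> A \<times> B" for p
  proof -
    obtain R where R: "R > 0" "cball (fst p) (2 * R) \<subseteq> A" "cball (snd p) (2 * R) \<subseteq> B"
      using open_times_cball[OF assms(1,2) p] .
    define f where "f = (\<lambda>q \<zeta>. F (\<zeta> + (fst q - fst p), snd q))"
    have near: "\<forall>\<^sub>F q in at p. dist q p < d" if "d > 0" for d
      using that by (auto simp: eventually_at intro!: exI[of _ d])
    have shift: "\<zeta> + (fst q - fst p) \<in> cball (fst p) (2 * R)" "snd q \<in> cball (snd p) (2 * R)"
      if "dist q p < R" "\<zeta> \<in> ball (fst p) R" for q \<zeta>
    proof -
      have "dist (fst q) (fst p) < R" "dist (snd q) (snd p) < R"
        using that dist_fst_le[of q p] dist_snd_le[of q p] by auto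
      then show "\<zeta> + (fst q - fst p) \<in> cball (fst p) (2 * R)" "snd q \<in> cball (snd p) (2 * R)"
        using that R(1) norm_triangle_ineq[of "\<zeta> - fst p" "fst q - fst p"]
        by (auto simp: dist_norm norm_minus_commute algebra_simps)
    qed
    have "compact (cball (fst p) (2 * R) \<times> cball (snd p) (2 * R))"
      by (intro compact_Times compact_cball)
    moreover have "continuous_on (cball (fst p) (2 * R) \<times> cball (snd p) (2 * R)) F"
      using F R by (auto simp: sep_holomorphic_def intro: continuous_on_subset)
    ultimately have uc: "uniformly_continuous_on (cball (fst p) (2 * R) \<times> cball (snd p) (2 * R)) F"
      by (simp add: compact_uniformly_continuous)
    have "uniform_limit (ball (fst p) R) f (\<lambda>\<zeta>. F (\<zeta>, snd p)) (at p)"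
    proof (rule uniform_limitI)
      fix e :: real assume "e > 0"
      then obtain d where d: "d > 0" "\<And>x y. x \<in> cball (fst p) (2 * R) \<times> cball (snd p) (2 * R) \<Longrightarrow>
          y \<in> cball (fst p) (2 * R) \<times> cball (snd p) (2 * R) \<Longrightarrow> dist y x < d \<Longrightarrow> dist (F y) (F x) < e"
        using uc unfolding uniformly_continuous_on_def by metis
      show "\<forall>\<^sub>F q in at p. \<forall>\<zeta>\<in>ball (fst p) R. dist (f q \<zeta>) (F (\<zeta>, snd p)) < e"
        using near[of "min d R"]
      proof (rule eventually_mono)
        fix q assume q: "dist q p < min d R"
        show "\<forall>\<zeta>\<in>ball (fst p) R. dist (f q \<zeta>) (F (\<zeta>, snd p)) < e"
        proof
          fix \<zeta> assume z: "\<zeta> \<in> ball (fst p) R"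
          have "dist (\<zeta> + (fst q - fst p), snd q) (\<zeta>, snd p) = dist q p"
            by (simp add: dist_Pair_Pair dist_prod_def dist_norm)
          then show "dist (f q \<zeta>) (F (\<zeta>, snd p)) < e"
            unfolding f_def using shift[of q \<zeta>] q z R(1) by (intro d(2)) auto
        qed
      qed (use d R in auto)
    qed
    moreover have "\<forall>\<^sub>F q in at p. f q holomorphic_on ball (fst p) R"
      using near[OF R(1)]
    proof (rule eventually_mono)
      fix q assume q: "dist q p < R"
      have "(\<lambda>z. F (z, snd q)) holomorphic_on A"
        using F shift(2)[OF q, of "fst p"] R by (auto simp: sep_holomorphic_def)
      then have "((\<lambda>z. F (z, snd q)) \<circ> (\<lambda>\<zeta>. \<zeta> + (fst q - fst p))) holomorphic_on ball (fst p) R"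
        using shift(1)[OF q] R
        by (intro holomorphic_on_compose_gen[of _ _ _ A] holomorphic_intros) auto
      then show "f q holomorphic_on ball (fst p) R"
        by (simp add: f_def o_def)
    qed
    ultimately have "((\<lambda>q. deriv (f q) (fst p)) \<longlongrightarrow> deriv (\<lambda>\<zeta>. F (\<zeta>, snd p)) (fst p)) (at p)"
      using R(1) by (intro deriv_complex_uniform_limit) auto
    moreover have "deriv (f q) (fst p) = partial1 F q" for q
      unfolding f_def partial1_def deriv_def
      using DERIV_shift[of "\<lambda>z. F (z, snd q)" _ "fst p" "fst q - fst p"] by simp
    ultimately show ?thesis
      by (simp add: partial1_def[of F p])
  qed
  then show ?thesis
    by (auto simp: continuous_on_def intro: tendsto_within_subset)
qed

lemma has_field_derivative_partial1:
  assumes "open A" "sep_holomorphic A B F" "z \<in> A" "w \<in> B"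
  shows "((\<lambda>\<zeta>. F (\<zeta>, w)) has_field_derivative partial1 F (z, w)) (at z)"
  using assms by (auto simp: partial1_def sep_holomorphic_def intro: holomorphic_derivI)

text \<open>The difference quotients in the first variable are holomorphic in \<open>w\<close>. By
  uniform continuity of \<open>partial1 F\<close> on a compact product of discs they converge
  uniformly in \<open>w\<close>, so their limit is holomorphic in \<open>w\<close>, too.\<close>

lemma sep_holomorphic_partial1:
  assumes A: "open A" and B: "open B" and F: "sep_holomorphic A B F"
  shows "sep_holomorphic A B (partial1 F)"
  unfolding sep_holomorphic_def
proof (intro conjI ballI)
  show cont: "continuous_on (A \<times> B) (partial1 F)"
    using assms by (rule continuous_on_partial1)
  show "(\<lambda>z. partial1 F (z, w)) holomorphic_on A" if "w \<in> B" for w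
    using holomorphic_deriv[of "\<lambda>z. F (z, w)" A] F that A by (auto simp: sep_holomorphic_def partial1_def)
  show "(\<lambda>w. partial1 F (z, w)) holomorphic_on B" if z: "z \<in> A" for z
  proof -
    have "(\<lambda>w. partial1 F (z, w)) field_differentiable (at w0)" if w0: "w0 \<in> B" for w0
    proof -
      obtain R where R: "R > 0" "cball z (2 * R) \<subseteq> A" "cball w0 (2 * R) \<subseteq> B"
        using open_times_cball[OF A B, of "(z, w0)"] z w0 by auto
      have R': "cball z R \<subseteq> A" "cball w0 R \<subseteq> B"
        using R subset_cball[of R "2 * R"] by auto
      define f where "f = (\<lambda>h w. (F (z + h, w) - F (z, w)) / h)"
      have "compact (cball z R \<times> cball w0 R)"
        by (intro compact_Times compact_cball)
      moreover have "continuous_on (cball z R \<times> cball w0 R) (partial1 F)"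
        using cont R' by (auto intro: continuous_on_subset)
      ultimately have uc: "uniformly_continuous_on (cball z R \<times> cball w0 R) (partial1 F)"
        by (simp add: compact_uniformly_continuous)
      have near: "\<forall>\<^sub>F h in at 0. norm h < d \<and> h \<noteq> 0" if "d > 0" for d and h :: complex
        using that by (auto simp: eventually_at intro!: exI[of _ d])
      have *: "\<forall>\<^sub>F h in at 0. continuous_on (cball w0 R) (f h) \<and> f h holomorphic_on ball w0 R"
        using near[OF R(1)]
      proof (rule eventually_mono)
        fix h :: complex assume h: "norm h < R \<and> h \<noteq> 0"
        have "z + h \<in> A"
          using h R' by (auto simp: subset_iff dist_norm)
        then have "f h holomorphic_on cball w0 R"
          unfolding f_def using F z h R'
          by (intro holomorphic_intros) (auto simp: sep_holomorphic_def intro: holomorphic_on_subset)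
        then show "continuous_on (cball w0 R) (f h) \<and> f h holomorphic_on ball w0 R"
          using holomorphic_on_imp_continuous_on holomorphic_on_subset ball_subset_cball by blast
      qed
      have "uniform_limit (cball w0 R) f (\<lambda>w. partial1 F (z, w)) (at 0)"
      proof (rule uniform_limitI)
        fix e :: real assume "e > 0"
        then obtain d where d: "d > 0" "\<And>x y. x \<in> cball z R \<times> cball w0 R \<Longrightarrow>
            y \<in> cball z R \<times> cball w0 R \<Longrightarrow> dist y x < d \<Longrightarrow> dist (partial1 F y) (partial1 F x) < e / 2"
          using uc unfolding uniformly_continuous_on_def by (metis half_gt_zero)
        show "\<forall>\<^sub>F h in at 0. \<forall>w\<in>cball w0 R. dist (f h w) (partial1 F (z, w)) < e"
          using near[of "min d R"]
        proof (rule eventually_mono)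
          fix h :: complex assume h: "norm h < min d R \<and> h \<noteq> 0"
          show "\<forall>w\<in>cball w0 R. dist (f h w) (partial1 F (z, w)) < e"
          proof
            fix w assume w: "w \<in> cball w0 R"
            \<comment> \<open>Removing the linear part leaves a function whose derivative is the
              variation of \<open>partial1 F\<close>, at most \<open>e / 2\<close>; the mean value
              bound then controls the error of the difference quotient.\<close>
            define g where "g = (\<lambda>\<zeta>. F (\<zeta>, w) - \<zeta> * partial1 F (z, w))"
            have "norm (g (z + h) - g z) \<le> (e / 2) * norm (z + h - z)"
            proof (rule field_differentiable_bound[where S = "cball z (norm h)"])
              fix \<zeta> assume \<zeta>: "\<zeta> \<in> cball z (norm h)"
              then have \<zeta>': "\<zeta> \<in> cball z R"
                using h by auto
              then have "\<zeta> \<in> A" "w \<in> B"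
                using R' w by auto
              then have "(g has_field_derivative partial1 F (\<zeta>, w) - partial1 F (z, w)) (at \<zeta>)"
                unfolding g_def
                by (auto intro!: derivative_eq_intros has_field_derivative_partial1[OF A F])
              then show "(g has_field_derivative partial1 F (\<zeta>, w) - partial1 F (z, w))
                  (at \<zeta> within cball z (norm h))"
                by (rule has_field_derivative_at_within)
              have "dist (partial1 F (\<zeta>, w)) (partial1 F (z, w)) < e / 2"
                using \<zeta> \<zeta>' w h R(1) by (intro d) (auto simp: dist_Pair_Pair dist_commute)
              then show "norm (partial1 F (\<zeta>, w) - partial1 F (z, w)) \<le> e / 2"
                by (simp add: dist_norm)
            qed (auto simp: dist_norm)
            then have "norm (g (z + h) - g z) / norm h \<le> e / 2"
              using h by (simp add: field_simps)
            moreover have "(g (z + h) - g z) / h = f h w - partial1 F (z, w)"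
              using h by (simp add: g_def f_def field_simps)
            ultimately show "dist (f h w) (partial1 F (z, w)) < e"
              using \<open>e > 0\<close> by (simp add: dist_norm flip: norm_divide)
          qed
        qed (use d R in auto)
      qed
      from holomorphic_uniform_limit[OF * this]
      have "(\<lambda>w. partial1 F (z, w)) holomorphic_on ball w0 R"
        by auto
      then show ?thesis
        using R(1) by (auto simp: holomorphic_on_open field_differentiable_def)
    qed
    then show ?thesis
      by (simp add: holomorphic_on_def field_differentiable_at_within)
  qed
qed

lemma sep_holomorphic_partial2:
  assumes A: "open A" and B: "open B" and F: "sep_holomorphic A B F"
  shows "sep_holomorphic A B (partial2 F)"
proof -
  have "sep_holomorphic A B (\<lambda>p. partial1 (\<lambda>p. F (prod.swap p)) (prod.swap p))"
    by (intro sep_holomorphic_swap sep_holomorphic_partial1 assms)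
  then show ?thesis
    by (simp add: partial2_swap[abs_def])
qed

text \<open>Joint continuity of the second partial derivative upgrades the two derivatives in one
  variable to a total complex-linear derivative.\<close>

lemma has_derivative_sep_holomorphic:
  assumes A: "open A" and B: "open B" and F: "sep_holomorphic A B F" and p: "p \<in> A \<times> B"
  shows "(F has_derivative (\<lambda>(u, v). partial1 F p * u + partial2 F p * v)) (at p)"
proof -
  obtain z w where [simp]: "p = (z, w)" by (cases p)
  obtain R where R: "R > 0" "cball z (2 * R) \<subseteq> A" "cball w (2 * R) \<subseteq> B"
    using open_times_cball[OF A B p] by auto
  have "ball x R \<subseteq> cball x (2 * R)" for x :: complex
    using R(1) by (auto simp: dist_norm)
  then have R': "ball z R \<subseteq> A" "ball w R \<subseteq> B"
    using R(2,3) by (meson order_trans)+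
  have F': "sep_holomorphic B A (\<lambda>p. F (prod.swap p))"
    using F by (rule sep_holomorphic_swap)
  have "((\<lambda>(x, y). F (x, y)) has_derivative
      (\<lambda>(tx, ty). partial1 F (z, w) * tx + blinfun_apply (blinfun_mult_right (partial2 F (z, w))) ty))
      (at (z, w) within ball z R \<times> ball w R)"
  proof (rule has_derivative_partialsI)
    show "((\<lambda>x. F (x, w)) has_derivative (*) (partial1 F (z, w))) (at z within ball z R)"
      using has_field_derivative_partial1[OF A F, of z w] p
      by (auto simp: has_field_derivative_def intro: has_derivative_at_withinI)
    show "((\<lambda>y. F (x, y)) has_derivative blinfun_apply (blinfun_mult_right (partial2 F (x, y))))
        (at y within ball w R)" if "x \<in> ball z R" "y \<in> ball w R" for x y
    proof -
      have "x \<in> A" "y \<in> B"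
        using that R' by auto
      then have "((\<lambda>y. F (x, y)) has_field_derivative partial2 F (x, y)) (at y)"
        using has_field_derivative_partial1[OF B F', of y x] by (simp add: partial2_swap)
      then show ?thesis
        by (simp add: has_field_derivative_def has_derivative_at_withinI)
    qed
    have "continuous_on (A \<times> B) (partial2 F)"
      using sep_holomorphic_partial2[OF A B F] by (simp add: sep_holomorphic_def)
    then have "continuous (at (z, w) within A \<times> B) (partial2 F)"
      using p by (simp add: continuous_on_eq_continuous_within)
    then have "continuous (at (z, w) within ball z R \<times> ball w R) (partial2 F)"
      by (rule continuous_within_subset) (use R' in blast)
    then show "continuous (at (z, w) within ball z R \<times> ball w R)
        (\<lambda>(x, y). blinfun_mult_right (partial2 F (x, y)))"
      by (simp add: split_def bounded_linear.continuous[OF bounded_linear_blinfun_mult_right])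
  qed (use R in auto)
  moreover have "at (z, w) within ball z R \<times> ball w R = at (z, w)"
    using R by (intro at_within_open) (auto intro: open_Times)
  ultimately show ?thesis
    by (simp add: split_def)
qed

text \<open>The theorem of Weierstrass is applied in each variable separately. It keeps the limit of
  the \<open>f_n\<close> analytic on the whole strip.\<close>

lemma sep_holomorphic_uniform_limit:
  assumes "open A" "open B" and F: "\<And>n. sep_holomorphic A B (F n)"
    and lim: "uniform_limit (A \<times> B) F G sequentially"
  shows "sep_holomorphic A B G"
  unfolding sep_holomorphic_def
proof (intro conjI ballI)
  show "continuous_on (A \<times> B) G"
    using F lim by (intro uniform_limit_theorem[OF _ lim]) (auto simp: sep_holomorphic_def)
  have *: "(g :: complex \<Rightarrow> complex) holomorphic_on S"
    if "open S" "\<And>n. f n holomorphic_on S" "uniform_limit S f g sequentially" for f g S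
  proof (rule holomorphic_uniform_sequence[OF that(1)])
    show "f n holomorphic_on S" for n by fact
    show "\<exists>d>0. cball x d \<subseteq> S \<and> uniform_limit (cball x d) f g sequentially" if "x \<in> S" for x
    proof -
      obtain d where "d > 0" "cball x d \<subseteq> S"
        using \<open>open S\<close> \<open>x \<in> S\<close> open_contains_cball[of S] by blast
      moreover have "uniform_limit (cball x d) f g sequentially"
        using \<open>uniform_limit S f g sequentially\<close> \<open>cball x d \<subseteq> S\<close>
        by (rule uniform_limit_on_subset)
      ultimately show ?thesis by auto
    qed
  qed
  show "(\<lambda>z. G (z, w)) holomorphic_on A" if "w \<in> B" for w
  proof (rule *[OF assms(1), where f = "\<lambda>n z. F n (z, w)"])
    show "uniform_limit A (\<lambda>n z. F n (z, w)) (\<lambda>z. G (z, w)) sequentially"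
      by (rule uniform_limit_compose'[OF lim]) (use that in auto)
  qed (use F that in \<open>auto simp: sep_holomorphic_def\<close>)
  show "(\<lambda>w. G (z, w)) holomorphic_on B" if "z \<in> A" for z
  proof (rule *[OF assms(2), where f = "\<lambda>n w. F n (z, w)"])
    show "uniform_limit B (\<lambda>n w. F n (z, w)) (\<lambda>w. G (z, w)) sequentially"
      by (rule uniform_limit_compose'[OF lim]) (use that in auto)
  qed (use F that in \<open>auto simp: sep_holomorphic_def\<close>)
qed

lemma sep_holomorphic_if_has_derivative:
  assumes "\<And>p. p \<in> A \<times> B \<Longrightarrow>
    \<exists>a b. (F has_derivative (\<lambda>(u, v). a * u + b * v)) (at p within A \<times> B)"
  shows "sep_holomorphic A B F"
  unfolding sep_holomorphic_def
proof (intro conjI ballI)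
  show "continuous_on (A \<times> B) F"
    using assms by (meson continuous_on_eq_continuous_within has_derivative_continuous)
  show "(\<lambda>z. F (z, w)) holomorphic_on A" if "w \<in> B" for w
  proof (unfold holomorphic_on_def, intro ballI)
    fix z assume "z \<in> A"
    then obtain a b where D: "(F has_derivative (\<lambda>(u, v). a * u + b * v)) (at (z, w) within A \<times> B)"
      using assms[of "(z, w)"] \<open>z \<in> A\<close> \<open>w \<in> B\<close> by blast
    have "((F \<circ> (\<lambda>z. (z, w))) has_derivative (\<lambda>(u, v). a * u + b * v) \<circ> (\<lambda>u. (u, 0))) (at z within A)"
      using \<open>w \<in> B\<close>
      by (intro diff_chain_within has_derivative_subset[OF D] derivative_eq_intros) auto
    then show "(\<lambda>z. F (z, w)) field_differentiable (at z within A)"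
      by (auto simp: field_differentiable_def has_field_derivative_def o_def mult_commute_abs)
  qed
  show "(\<lambda>w. F (z, w)) holomorphic_on B" if "z \<in> A" for z
  proof (unfold holomorphic_on_def, intro ballI)
    fix w assume "w \<in> B"
    then obtain a b where D: "(F has_derivative (\<lambda>(u, v). a * u + b * v)) (at (z, w) within A \<times> B)"
      using assms[of "(z, w)"] \<open>z \<in> A\<close> \<open>w \<in> B\<close> by blast
    have "((F \<circ> (\<lambda>w. (z, w))) has_derivative (\<lambda>(u, v). a * u + b * v) \<circ> (\<lambda>v. (0, v))) (at w within B)"
      using \<open>z \<in> A\<close>
      by (intro diff_chain_within has_derivative_subset[OF D] derivative_eq_intros) auto
    then show "(\<lambda>w. F (z, w)) field_differentiable (at w within B)"
      by (auto simp: field_differentiable_def has_field_derivative_def o_def mult_commute_abs)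
  qed
qed

section \<open>Strips, the identity theorem and real smoothness\<close>

definition band :: "real \<Rightarrow> complex set" where
  "band \<rho> = {z. \<bar>Im z\<bar> < \<rho>}"

lemma strip_eq: "strip \<rho> = band \<rho> \<times> band \<rho>"
  by (auto simp: strip_def band_def)

lemma open_band [simp]: "open (band \<rho>)"
  unfolding band_def by (intro open_Collect_less continuous_intros)

lemma connected_band [simp]: "connected (band \<rho>)"
proof -
  have "band \<rho> = {z. Im z < \<rho>} \<inter> {z. Im z > - \<rho>}"
    by (auto simp: band_def)
  then show ?thesis
    by (simp add: convex_connected convex_Int convex_halfspace_Im_lt convex_halfspace_Im_gt)
qed

lemma of_real_in_band [simp]: "\<rho> > 0 \<Longrightarrow> complex_of_real x \<in> band \<rho>"
  by (simp add: band_def)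

text \<open>\<open>holomorphic2_on\<close> is the notion in which the result is stated,
  \<open>sep_holomorphic\<close> the one to which the theorems on one complex variable
  apply.\<close>

lemma holomorphic2_on_strip_iff: "holomorphic2_on F (strip \<rho>) \<longleftrightarrow> sep_holomorphic (band \<rho>) (band \<rho>) F"
proof
  assume "holomorphic2_on F (strip \<rho>)"
  then show "sep_holomorphic (band \<rho>) (band \<rho>) F"
    by (intro sep_holomorphic_if_has_derivative) (auto simp: holomorphic2_on_def strip_eq)
next
  assume "sep_holomorphic (band \<rho>) (band \<rho>) F"
  then have "(F has_derivative (\<lambda>(u, v). partial1 F z * u + partial2 F z * v)) (at z within strip \<rho>)"
    if "z \<in> strip \<rho>" for z
    using that has_derivative_sep_holomorphic[of "band \<rho>" "band \<rho>" F z]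
    by (simp add: strip_eq has_derivative_at_withinI)
  then show "holomorphic2_on F (strip \<rho>)"
    unfolding holomorphic2_on_def by meson
qed

lemma holomorphic_eq_on_band:
  assumes "\<rho> > 0" "f holomorphic_on band \<rho>" "g holomorphic_on band \<rho>"
    and eq: "\<And>x. f (complex_of_real x) = g (complex_of_real x)" and "z \<in> band \<rho>"
  shows "f z = g z"
proof -
  have "f z - g z = 0"
  proof (rule analytic_continuation[where f = "\<lambda>z. f z - g z" and U = "range complex_of_real"
        and S = "band \<rho>" and \<xi> = 0])
    show "(0::complex) islimpt range complex_of_real"
      unfolding islimpt_approachable
    proof (intro allI impI)
      fix e :: real assume "e > 0"
      then show "\<exists>x'\<in>range complex_of_real. x' \<noteq> 0 \<and> dist x' 0 < e"
        by (intro bexI[of _ "complex_of_real (e / 2)"] rangeI) (auto simp: dist_norm)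
    qed
    show "range complex_of_real \<subseteq> band \<rho>"
      using assms(1) by auto
  qed (use assms in \<open>auto intro!: holomorphic_intros simp: \<open>\<rho> > 0\<close>[THEN of_real_in_band, of 0, simplified]\<close>)
  then show ?thesis by simp
qed

text \<open>The identity theorem is used twice: in the first variable while the second one is real,
  then in the second variable. Bounded extensions are thereby unique on the strip.\<close>

lemma holomorphic2_eq_on_strip:
  assumes "\<rho> > 0" "holomorphic2_on F (strip \<rho>)" "holomorphic2_on G (strip \<rho>)"
    and eq: "\<And>x y. F (complex_of_real x, complex_of_real y) = G (complex_of_real x, complex_of_real y)"
    and z: "z \<in> strip \<rho>"
  shows "F z = G z"
proof -
  have F: "sep_holomorphic (band \<rho>) (band \<rho>) F" and G: "sep_holomorphic (band \<rho>) (band \<rho>) G"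
    using assms by (auto simp: holomorphic2_on_strip_iff)
  have 1: "F (z, complex_of_real y) = G (z, complex_of_real y)" if "z \<in> band \<rho>" for y z
    using F G assms(1) eq that
      holomorphic_eq_on_band[of \<rho> "\<lambda>z. F (z, complex_of_real y)" "\<lambda>z. G (z, complex_of_real y)" z]
    by (simp add: sep_holomorphic_def)
  have "F (fst z, snd z) = G (fst z, snd z)"
    using F G assms(1) 1 z
      holomorphic_eq_on_band[of \<rho> "\<lambda>w. F (fst z, w)" "\<lambda>w. G (fst z, w)" "snd z"]
    by (simp add: sep_holomorphic_def strip_eq mem_Times_iff)
  then show ?thesis by simp
qed

text \<open>Partial derivatives of a separately holomorphic function are again separately
  holomorphic, so the induction on \<open>k\<close> runs with \<open>F\<close> and \<open>G\<close>
  arbitrary.\<close>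

lemma Ck_real_part:
  assumes "\<rho> > 0" "sep_holomorphic (band \<rho>) (band \<rho>) F" "sep_holomorphic (band \<rho>) (band \<rho>) G"
  shows "Ck k (\<lambda>(x, y). (Re (F (of_real x, of_real y)), Re (G (of_real x, of_real y))))"
  using assms(2,3)
proof (induction k arbitrary: F G)
  case 0
  have "continuous_on UNIV (\<lambda>p :: real \<times> real. H (complex_of_real (fst p), complex_of_real (snd p)))"
    if "sep_holomorphic (band \<rho>) (band \<rho>) H" for H :: "complex \<times> complex \<Rightarrow> complex"
    using that assms(1) unfolding sep_holomorphic_def
    by (auto intro!: continuous_on_compose2[of "band \<rho> \<times> band \<rho>" H] continuous_intros)
  with 0 show ?case
    by (auto simp: split_def intro!: continuous_intros)
next
  case (Suc k)
  have D: "((\<lambda>p. Re (H (of_real (fst p), of_real (snd p)))) has_derivative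
      (\<lambda>p. fst p * Re (partial1 H (of_real (fst x), of_real (snd x))) +
           snd p * Re (partial2 H (of_real (fst x), of_real (snd x))))) (at x)"
    if "sep_holomorphic (band \<rho>) (band \<rho>) H" for H and x :: "real \<times> real"
  proof -
    let ?x = "(complex_of_real (fst x), complex_of_real (snd x))"
    have "(H has_derivative (\<lambda>(u, v). partial1 H ?x * u + partial2 H ?x * v)) (at ?x)"
      using that assms(1) by (intro has_derivative_sep_holomorphic) auto
    moreover have "((\<lambda>p. (complex_of_real (fst p), complex_of_real (snd p))) has_derivative
        (\<lambda>p. (complex_of_real (fst p), complex_of_real (snd p)))) (at x)"
      by (intro has_derivative_Pair has_derivative_of_real has_derivative_fst has_derivative_snd
          has_derivative_ident)
    ultimately have "((\<lambda>p. H (complex_of_real (fst p), complex_of_real (snd p))) has_derivative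
       (\<lambda>p. partial1 H ?x * complex_of_real (fst p) + partial2 H ?x * complex_of_real (snd p))) (at x)"
      using diff_chain_at[of "\<lambda>p. (complex_of_real (fst p), complex_of_real (snd p))"
          "\<lambda>p. (complex_of_real (fst p), complex_of_real (snd p))" x H
          "\<lambda>(u, v). partial1 H ?x * u + partial2 H ?x * v"]
      by (simp add: o_def split_def)
    from has_derivative_Re[OF this] show ?thesis
      by (simp add: o_def mult_ac)
  qed
  let ?c = "\<lambda>x :: real \<times> real. (complex_of_real (fst x), complex_of_real (snd x))"
  have "((\<lambda>(x, y). (Re (F (of_real x, of_real y)), Re (G (of_real x, of_real y)))) has_derivative
      (\<lambda>(u, v). u *\<^sub>R (Re (partial1 F (?c x)), Re (partial1 G (?c x))) +
                v *\<^sub>R (Re (partial2 F (?c x)), Re (partial2 G (?c x))))) (at x)" for x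
    using has_derivative_Pair[OF D[OF Suc.prems(1)] D[OF Suc.prems(2)], of x]
    by (simp add: split_def scaleR_prod_def plus_prod_def)
  moreover have "Ck k (\<lambda>x. (Re (partial1 F (?c x)), Re (partial1 G (?c x))))"
    using Suc.IH[of "partial1 F" "partial1 G"] Suc.prems by (simp add: split_def sep_holomorphic_partial1)
  moreover have "Ck k (\<lambda>x. (Re (partial2 F (?c x)), Re (partial2 G (?c x))))"
    using Suc.IH[of "partial2 F" "partial2 G"] Suc.prems by (simp add: split_def sep_holomorphic_partial2)
  ultimately show ?case
    unfolding Ck.simps
    by (intro exI[of _ "\<lambda>x. (Re (partial1 F (?c x)), Re (partial1 G (?c x)))"]
        exI[of _ "\<lambda>x. (Re (partial2 F (?c x)), Re (partial2 G (?c x)))"] conjI allI)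
qed

section \<open>Oscillatory integrals\<close>

definition torus_periodic :: "(real \<times> real \<Rightarrow> 'a) \<Rightarrow> bool" where
  "torus_periodic u \<longleftrightarrow> (\<forall>x y. lattice_rel x y \<longrightarrow> u x = u y)"

text \<open>
  With \<open>g\<close> and \<open>\<phi>\<close> built from \<open>k\<close> and \<open>q\<close>, the map \<open>Phi k q t\<close> is the conjugate of the rotation
  \<open>R\<^sub>t\<close> by \<open>h = g \<circ> \<phi>\<close>, written out; \<open>'a\<close> is \<open>real\<close> or \<open>complex\<close>.
\<close>

definition Delta :: "int \<Rightarrow> int \<Rightarrow> real \<Rightarrow> 'a \<times> 'a \<Rightarrow> 'a::{real_normed_field,banach}" where
  "Delta k q t p = (of_int q)\<^sup>2 *
     (cos (of_real (2 * pi) * of_int q * (fst p - of_int k * snd p + of_real t)) -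
      cos (of_real (2 * pi) * of_int q * (fst p - of_int k * snd p)))"

definition Phi :: "int \<Rightarrow> int \<Rightarrow> real \<Rightarrow> 'a \<times> 'a \<Rightarrow> 'a \<times> 'a::{real_normed_field,banach}" where
  "Phi k q t p = (fst p + of_real t + of_int k * Delta k q t p, snd p + Delta k q t p)"

definition square_integral :: "(real \<times> real \<Rightarrow> complex) \<Rightarrow> complex" where
  "square_integral u = integral (cbox (0, 0) (1, 1)) u"

definition torus_char :: "int \<Rightarrow> int \<Rightarrow> real \<times> real \<Rightarrow> complex" where
  "torus_char a b p = cis (2 * pi * (of_int a * fst p + of_int b * snd p))"

section \<open>Integrals of periodic functions over one period\<close>

lemma integral_periodic_shift01:
  fixes v :: "real \<Rightarrow> complex"
  assumes cont: "continuous_on UNIV v" and per: "\<And>x. v (x + 1) = v x" and c: "0 \<le> c" "c \<le> 1"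
  shows "integral {0..1} (\<lambda>x. v (x + c)) = integral {0..1} v"
proof -
  have int: "v integrable_on {a..b}" for a b
    by (rule integrable_continuous_real) (rule continuous_on_subset[OF cont], simp)
  have "integral {0..1} (\<lambda>x. v (x + c)) = integral {0 + c..1 + c} v"
    using integral_shift_Icc_real[of 0 1 v c] by (simp add: o_def add.commute)
  also have "\<dots> = integral {c..1} v + integral {1..1 + c} v"
    using c Henstock_Kurzweil_Integration.integral_combine[of c 1 "1 + c" v] int by simp
  also have "integral {1..1 + c} v = integral {0..c} v"
    using integral_shift_Icc_real[of 0 c v 1] per by (simp add: o_def add.commute)
  also have "integral {c..1} v + integral {0..c} v = integral {0..1} v"
    using c Henstock_Kurzweil_Integration.integral_combine[of 0 c 1 v] int by (simp add: add.commute)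
  finally show ?thesis .
qed

lemma periodic_int:
  fixes v :: "real \<Rightarrow> 'a"
  assumes per: "\<And>x. v (x + 1) = v x"
  shows "v (x + of_int n) = v x"
proof (induction n arbitrary: x rule: int_induct[where k = 0])
  case base then show ?case by simp
next
  case (step1 i)
  then show ?case using per[of "x + of_int i"] by (simp add: add.assoc)
next
  case (step2 i)
  then show ?case using per[of "x + of_int (i - 1)"] by (simp add: algebra_simps)
qed

lemma integral_periodic_shift:
  fixes v :: "real \<Rightarrow> complex"
  assumes cont: "continuous_on UNIV v" and per: "\<And>x. v (x + 1) = v x"
  shows "integral {0..1} (\<lambda>x. v (x + c)) = integral {0..1} v"
proof -
  have "v (x + c) = v (x + frac c)" for x
    using periodic_int[of v "x + frac c" "\<lfloor>c\<rfloor>"] per by (simp add: frac_def)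
  then show ?thesis
    using integral_periodic_shift01[OF cont per, of "frac c"] by (simp add: frac_lt_1 less_imp_le)
qed

text \<open>The interval from 0 to \<open>q\<close> consists of \<open>q\<close> full periods, and
  the substitution of \<open>q * x\<close> divides by \<open>q\<close> again.\<close>

lemma integral_periodic_scale:
  fixes v :: "real \<Rightarrow> complex"
  assumes cont: "continuous_on UNIV v" and per: "\<And>x. v (x + 1) = v x" and q: "q > 0"
  shows "integral {0..1} (\<lambda>x. v (of_int q * x)) = integral {0..1} v"
proof -
  have int: "v integrable_on {a..b}" for a b
    by (rule integrable_continuous_real) (rule continuous_on_subset[OF cont], simp)
  have "integral {0..real n} v = of_nat n * integral {0..1} v" for n
  proof (induction n)
    case (Suc n)
    have "integral {0..real (Suc n)} v = integral {0..real n} v + integral {real n..real (Suc n)} v"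
      using Henstock_Kurzweil_Integration.integral_combine[of 0 "real n" "real (Suc n)" v] int by simp
    also have "integral {real n..real (Suc n)} v = integral {0..1} (\<lambda>x. v (x + real n))"
      using integral_shift_Icc_real[of 0 1 v "real n"] by (simp add: o_def add.commute)
    finally show ?case
      using Suc integral_periodic_shift[OF cont per] by (simp add: algebra_simps)
  qed simp
  from this[of "nat q"] have "integral {0..of_int q} v = of_int q * integral {0..1} v"
    using q by simp
  moreover have "(\<lambda>x. x / real_of_int q) ` {0..of_int q} = {0..1}"
    using q by (simp add: image_divide_atLeastAtMost)
  ultimately show ?thesis
    using integral_stretch_real[of "of_int q" 0 "of_int q" v] q by (simp add: scaleR_conv_of_real)
qed

lemma cis_mult_eq_1: "cis (2 * pi * of_int n) = 1"
  by (simp add: cis.ctr complex_eq_iff cos_int_2pin sin_int_2pin)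

text \<open>The integrand is bounded by 1 and tends to 0 with \<open>\<eta>\<close> wherever the
  cosine is nonzero, that is, off \<open>1/4\<close> and \<open>3/4\<close>. These are the critical
  points of the phase \<open>sin (2 * pi * x)\<close>, and the weight singles out their
  neighbourhoods.\<close>

lemma small_weight_integral:
  assumes "e > 0"
  shows "\<exists>\<eta>>0. integral {0..1} (\<lambda>x. \<eta> / ((cos (2 * pi * x))\<^sup>2 + \<eta>)) \<le> e"
proof -
  define f where "f = (\<lambda>n x. (1 / real (Suc n)) / ((cos (2 * pi * x))\<^sup>2 + 1 / real (Suc n)))"
  define g where "g = (\<lambda>x :: real. if cos (2 * pi * x) = 0 then 1 else 0 :: real)"
  have pos: "(cos (2 * pi * x))\<^sup>2 + 1 / real (Suc n) > 0" for x n
    by (simp add: add_nonneg_pos)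
  have "(\<lambda>n. integral {0..1} (f n)) \<longlonglongrightarrow> integral {0..1} g"
  proof (rule dominated_convergence(2)[where h = "\<lambda>_. 1"])
    show "f n integrable_on {0..1}" for n
      unfolding f_def using pos[of _ n]
      by (intro integrable_continuous_real continuous_intros) (auto simp: less_imp_neq[symmetric])
    show "norm (f n x) \<le> 1" for n x
      proof -
      have "f n x = (1 / real (Suc n)) / ((cos (2 * pi * x))\<^sup>2 + 1 / real (Suc n))"
        by (simp add: f_def)
      also have "\<dots> \<le> 1"
        by (subst divide_le_eq_1_pos[OF pos[of x n]]) simp
      finally show ?thesis
        using pos[of x n] by (simp add: f_def)
    qed
    show "(\<lambda>n. f n x) \<longlonglongrightarrow> g x" for x
    proof (cases "cos (2 * pi * x) = 0")
      case True then show ?thesis by (simp add: f_def g_def)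
    next
      case False
      have "(\<lambda>n. 1 / real (Suc n)) \<longlonglongrightarrow> 0"
        by (rule LIMSEQ_Suc[OF lim_1_over_n])
      from tendsto_divide[OF this tendsto_add[OF tendsto_const this]]
      have "(\<lambda>n. f n x) \<longlonglongrightarrow> 0 / ((cos (2 * pi * x))\<^sup>2 + 0)"
        unfolding f_def using False by simp
      then show ?thesis using False by (simp add: g_def)
    qed
  qed auto
  moreover have "integral {0..1} g = integral {0..1} (\<lambda>_. 0 :: real)"
  proof -
    have "x \<in> {1/4, 3/4}" if x: "x \<in> {0..1}" "cos (2 * pi * x) = 0" for x :: real
    proof -
      obtain i :: int where "odd i" "2 * pi * x = of_int i * (pi / 2)"
        using x cos_zero_iff_int by auto
      then have i: "x = of_int i / 4" "odd i" by auto
      then have "0 \<le> i" "i \<le> 4" using x by auto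
      then have "i = 1 \<or> i = 3" using i(2) by presburger
      then show ?thesis using i by auto
    qed
    then have "0 = g x" if "x \<in> {0..1} - {1/4, 3/4}" for x
      using that by (auto simp: g_def)
    then show ?thesis
      using integral_spike[of "{1/4, 3/4}" "{0..1}" "\<lambda>_. 0" g] by simp
  qed
  ultimately have "(\<lambda>n. integral {0..1} (f n)) \<longlonglongrightarrow> 0" by simp
  then have "\<forall>\<^sub>F n in sequentially. integral {0..1} (f n) < e"
    using assms by (rule order_tendstoD)
  then obtain n where "integral {0..1} (f n) < e"
    by (auto simp: eventually_sequentially)
  then show ?thesis
    unfolding f_def by (intro exI[of _ "1 / real (Suc n)"]) auto
qed

text \<open>
  Away from the critical points of the phase the weight \<open>cos\<^sup>2 / (cos\<^sup>2 + \<eta>)\<close> permits an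
  integration by parts without boundary terms.
\<close>

lemma bessel_decay:
  assumes "e > 0"
  shows "\<exists>Z>0. \<forall>z. \<bar>z\<bar> \<ge> Z \<longrightarrow> norm (integral {0..1} (\<lambda>x. cis (z * sin (2 * pi * x)))) \<le> e"
proof -
  obtain \<eta> where \<eta>: "\<eta> > 0" "integral {0..1} (\<lambda>x. \<eta> / ((cos (2 * pi * x))\<^sup>2 + \<eta>)) \<le> e / 2"
    using small_weight_integral[of "e / 2"] assms by auto
  define c where "c = (\<lambda>x. cos (2 * pi * x))"
  define s where "s = (\<lambda>x. sin (2 * pi * x))"
  \<comment> \<open>Up to a constant, \<open>g\<close> is the weight divided by the derivative of
    the phase \<open>s\<close>. The derivative of \<open>cis (z * s x) * g x\<close> therefore
    contains \<open>z\<close> times the weighted integrand.\<close>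
  define g where "g = (\<lambda>x. c x / ((c x)\<^sup>2 + \<eta>))"
  define g' where "g' = (\<lambda>x. 2 * pi * s x * ((c x)\<^sup>2 - \<eta>) / ((c x)\<^sup>2 + \<eta>)\<^sup>2)"
  have pos: "(c x)\<^sup>2 + \<eta> > 0" for x
    using \<eta> by (simp add: add_nonneg_pos)
  then have nz: "(c x)\<^sup>2 + \<eta> \<noteq> 0" for x
    by (metis less_irrefl)
  have dc: "(c has_real_derivative - (2 * pi * s x)) (at x)" for x
    unfolding c_def s_def by (auto intro!: derivative_eq_intros)
  have ds: "(s has_real_derivative 2 * pi * c x) (at x)" for x
    unfolding c_def s_def by (auto intro!: derivative_eq_intros)
  have dg: "(g has_real_derivative g' x) (at x)" for x
  proof -
    have "(g has_real_derivative (- (2 * pi * s x) * ((c x)\<^sup>2 + \<eta>) - c x * (2 * c x * - (2 * pi * s x)))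
        / (((c x)\<^sup>2 + \<eta>) * ((c x)\<^sup>2 + \<eta>))) (at x)"
      unfolding g_def using nz by (auto intro!: derivative_eq_intros dc)
    also have "(- (2 * pi * s x) * ((c x)\<^sup>2 + \<eta>) - c x * (2 * c x * - (2 * pi * s x)))
        / (((c x)\<^sup>2 + \<eta>) * ((c x)\<^sup>2 + \<eta>)) = g' x"
      unfolding g'_def by (simp add: power2_eq_square algebra_simps)
    finally show ?thesis .
  qed
  have g'_le: "\<bar>g' x\<bar> \<le> 2 * pi / \<eta>" for x
  proof -
    have "\<bar>2 * pi * s x\<bar> \<le> 2 * pi" unfolding s_def by (simp add: abs_mult)
    moreover have "\<bar>(c x)\<^sup>2 - \<eta>\<bar> \<le> (c x)\<^sup>2 + \<eta>" using \<eta> by (simp add: abs_le_iff)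
    ultimately have "\<bar>g' x\<bar> \<le> 2 * pi * ((c x)\<^sup>2 + \<eta>) / ((c x)\<^sup>2 + \<eta>)\<^sup>2"
      unfolding g'_def abs_divide by (simp only: abs_mult[of "2 * pi * s x"] abs_power2)
        (intro divide_right_mono mult_mono, auto)
    also have "\<dots> = 2 * pi / ((c x)\<^sup>2 + \<eta>)"
      using nz[of x] by (simp add: power2_eq_square)
    also have "\<dots> \<le> 2 * pi / \<eta>"
      using \<eta> pos[of x] by (intro divide_left_mono) auto
    finally show ?thesis .
  qed
  have cont: "continuous_on A c" "continuous_on A s" "continuous_on A g" "continuous_on A g'" for A
    unfolding g_def g'_def c_def s_def using nz
    by (auto intro!: continuous_intros simp: c_def)
  have bound: "norm (integral {0..1} (\<lambda>x. cis (z * s x))) \<le> 1 / (\<eta> * \<bar>z\<bar>) + e / 2" if "z \<noteq> 0" for z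
  proof -
    let ?E = "\<lambda>x. cis (z * s x)"
    have contE: "continuous_on A ?E" for A
      by (intro continuous_intros cont)
    have dE: "(?E has_vector_derivative (\<i> * of_real (z * (2 * pi * c x))) * ?E x) (at x)" for x
    proof -
      have "(?E has_derivative (\<lambda>t. (z * (t * (2 * pi * c x))) *\<^sub>R (\<i> * ?E x))) (at x)"
        using ds[of x] by (auto intro!: derivative_eq_intros simp: has_field_derivative_def mult_ac)
      then show ?thesis
        by (simp add: has_vector_derivative_def scaleR_conv_of_real mult_ac)
    qed
    have "((\<lambda>x. ?E x * of_real (g x)) has_vector_derivative
        (?E x * of_real (g' x) + \<i> * of_real (z * (2 * pi * c x)) * ?E x * of_real (g x))) (at x)" for x
      using has_vector_derivative_mult[OF dE[of x] has_vector_derivative_of_real[OF dg[of x]]] by simp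
    then have "((\<lambda>x. ?E x * of_real (g' x) + \<i> * of_real (z * (2 * pi * c x)) * ?E x * of_real (g x))
        has_integral ?E 1 * of_real (g 1) - ?E 0 * of_real (g 0)) {0..1}"
      by (intro fundamental_theorem_of_calculus) (auto intro: has_vector_derivative_at_within)
    \<comment> \<open>Both endpoints are the same point of the circle, so the boundary terms
      cancel.\<close>
    moreover have "?E 1 * of_real (g 1) - ?E 0 * of_real (g 0) = 0"
      by (simp add: g_def c_def s_def)
    ultimately have "integral {0..1} (\<lambda>x. ?E x * of_real (g' x) +
        (\<i> * of_real (z * 2 * pi)) * (?E x * of_real (c x * g x))) = 0"
      by (simp add: integral_unique mult_ac)
    moreover have "integral {0..1} (\<lambda>x. ?E x * of_real (g' x) +
        (\<i> * of_real (z * 2 * pi)) * (?E x * of_real (c x * g x))) =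
        integral {0..1} (\<lambda>x. ?E x * of_real (g' x)) +
        (\<i> * of_real (z * 2 * pi)) * integral {0..1} (\<lambda>x. ?E x * of_real (c x * g x))"
      by (subst integral_add)
        (auto intro!: integrable_continuous_real continuous_intros cont contE simp del: of_real_mult)
    ultimately have "integral {0..1} (\<lambda>x. ?E x * of_real (g' x)) +
        (\<i> * of_real (z * 2 * pi)) * integral {0..1} (\<lambda>x. ?E x * of_real (c x * g x)) = 0"
      by (rule trans[OF sym, rotated])
    then have "norm (\<i> * of_real (z * 2 * pi) * integral {0..1} (\<lambda>x. ?E x * of_real (c x * g x))) =
        norm (integral {0..1} (\<lambda>x. ?E x * of_real (g' x)))"
      by (subst norm_minus_cancel[symmetric]) (simp only: add_eq_0_iff2)
    also have "\<dots> \<le> 2 * pi / \<eta> * (1 - 0)"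
      by (rule integral_bound) (auto intro!: continuous_intros cont contE simp: norm_mult g'_le)
    finally have "\<bar>z\<bar> * norm (integral {0..1} (\<lambda>x. ?E x * of_real (c x * g x))) \<le> 1 / \<eta>"
      using \<eta> by (simp add: norm_mult abs_mult field_simps)
    then have 1: "norm (integral {0..1} (\<lambda>x. ?E x * of_real (c x * g x))) \<le> 1 / (\<eta> * \<bar>z\<bar>)"
      using that \<eta> by (simp add: field_simps)
    have "norm (integral {0..1} (\<lambda>x. ?E x * of_real (\<eta> / ((c x)\<^sup>2 + \<eta>)))) \<le>
        integral {0..1} (\<lambda>x. \<eta> / ((c x)\<^sup>2 + \<eta>))"
      using nz pos \<eta>
      by (intro integral_norm_bound_integral)
        (auto intro!: integrable_continuous_real continuous_intros cont contE simp: norm_mult abs_of_pos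
          simp del: of_real_divide of_real_add)
    then have 2: "norm (integral {0..1} (\<lambda>x. ?E x * of_real (\<eta> / ((c x)\<^sup>2 + \<eta>)))) \<le> e / 2"
      using \<eta> by (simp add: c_def)
    have "c x * g x + \<eta> / ((c x)\<^sup>2 + \<eta>) = 1" for x
    proof -
      have "c x * g x + \<eta> / ((c x)\<^sup>2 + \<eta>) = ((c x)\<^sup>2 + \<eta>) / ((c x)\<^sup>2 + \<eta>)"
        unfolding g_def add_divide_distrib by (simp add: power2_eq_square)
      then show ?thesis
        using nz[of x] by simp
    qed
    then have "?E x = ?E x * of_real (c x * g x) + ?E x * of_real (\<eta> / ((c x)\<^sup>2 + \<eta>))" for x
      by (metis distrib_left mult.right_neutral of_real_1 of_real_add)
    then have "integral {0..1} ?E = integral {0..1} (\<lambda>x. ?E x * of_real (c x * g x) +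
        ?E x * of_real (\<eta> / ((c x)\<^sup>2 + \<eta>)))"
      by presburger
    also have "\<dots> = integral {0..1} (\<lambda>x. ?E x * of_real (c x * g x)) +
        integral {0..1} (\<lambda>x. ?E x * of_real (\<eta> / ((c x)\<^sup>2 + \<eta>)))"
      using nz by (intro integral_add) (auto intro!: integrable_continuous_real continuous_intros cont contE
         simp del: of_real_divide of_real_add of_real_mult)
    finally show ?thesis
      using norm_triangle_mono[OF 1 2] by simp
  qed
  show ?thesis
  \<comment> \<open>At this value of \<open>\<bar>z\<bar>\<close> the term
    \<open>1 / (\<eta> * \<bar>z\<bar>)\<close> equals \<open>e / 2\<close>.\<close>
  proof (intro exI[of _ "2 / (\<eta> * e)"] conjI allI impI)
    show "2 / (\<eta> * e) > 0" using \<eta> assms by simp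
    fix z assume z: "2 / (\<eta> * e) \<le> \<bar>z\<bar>"
    have z0: "\<bar>z\<bar> > 0" using z \<open>2 / (\<eta> * e) > 0\<close> by linarith
    then have "1 / (\<eta> * \<bar>z\<bar>) \<le> e / 2"
      using z \<eta> assms by (simp add: field_simps)
    then show "norm (integral {0..1} (\<lambda>x. cis (z * sin (2 * pi * x)))) \<le> e"
      using bound[of z] z0 by (simp add: s_def)
  qed
qed

section \<open>Trigonometric polynomials on the torus\<close>

lemma torus_periodic_comp:
  "torus_periodic u \<Longrightarrow> (\<And>x y. lattice_rel x y \<Longrightarrow> lattice_rel (L x) (L y)) \<Longrightarrow> torus_periodic (\<lambda>x. u (L x))"
  unfolding torus_periodic_def by blast

lemma lattice_relE:
  assumes "lattice_rel x y"
  obtains m n :: int where "x = y + (of_int m, of_int n)"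
proof -
  from assms obtain m n :: int where "fst x - fst y = of_int m" "snd x - snd y = of_int n"
    unfolding lattice_rel_def by (meson Ints_cases)
  then have "x = y + (of_int m, of_int n)"
    by (intro prod_eqI) auto
  then show thesis using that by blast
qed

lemma torus_periodicI:
  assumes "\<And>x m n. u (x + (of_int m, of_int n)) = u x"
  shows "torus_periodic u"
  using assms unfolding torus_periodic_def by (metis lattice_relE)

lemma torus_periodic_shift:
  "torus_periodic u \<Longrightarrow> u (x + of_int m, y + of_int n) = u (x, y)"
  unfolding torus_periodic_def by (simp add: lattice_rel_def)

lemma torus_periodic_shift1:
  "torus_periodic u \<Longrightarrow> u (x + 1, y) = u (x, y)" "torus_periodic u \<Longrightarrow> u (x, y + 1) = u (x, y)"
  using torus_periodic_shift[of u x 1 y 0] torus_periodic_shift[of u x 0 y 1] by simp_all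

lemma continuous_on_Pair_slices:
  fixes u :: "real \<times> real \<Rightarrow> complex"
  assumes "continuous_on UNIV u"
  shows "continuous_on A (\<lambda>x. u (x, y))" "continuous_on A (\<lambda>y. u (x, y))"
  by (intro continuous_on_compose2[OF assms] continuous_intros subset_UNIV)+

lemma square_integral_Fubini:
  assumes "continuous_on UNIV u"
  shows "square_integral u = integral {0..1} (\<lambda>x. integral {0..1} (\<lambda>y. u (x, y)))"
    and "square_integral u = integral {0..1} (\<lambda>y. integral {0..1} (\<lambda>x. u (x, y)))"
proof -
  have c: "continuous_on (cbox (0, 0) (1, 1)) u"
    using assms continuous_on_subset by blast
  show 1: "square_integral u = integral {0..1} (\<lambda>x. integral {0..1} (\<lambda>y. u (x, y)))"
    using integral_prod_continuous[OF c] by (simp add: square_integral_def)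
  show "square_integral u = integral {0..1} (\<lambda>y. integral {0..1} (\<lambda>x. u (x, y)))"
    using integral_swap_continuous[of 0 0 1 1 "\<lambda>x y. u (x, y)"] c 1 by simp
qed

lemma square_integral_integrable:
  "continuous_on UNIV u \<Longrightarrow> u integrable_on cbox (0, 0) (1, 1 :: real)" for u :: "real \<times> real \<Rightarrow> complex"
  by (rule integrable_continuous) (rule continuous_on_subset, auto)

lemma square_integral_add:
  "continuous_on UNIV u \<Longrightarrow> continuous_on UNIV v \<Longrightarrow>
    square_integral (\<lambda>x. u x + v x) = square_integral u + square_integral v"
  by (simp add: square_integral_def integral_add square_integral_integrable)

lemma square_integral_diff:
  "continuous_on UNIV u \<Longrightarrow> continuous_on UNIV v \<Longrightarrow>
    square_integral (\<lambda>x. u x - v x) = square_integral u - square_integral v"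
  by (simp add: square_integral_def integral_diff square_integral_integrable)

lemma square_integral_cmult: "square_integral (\<lambda>x. c * u x) = c * square_integral u"
  by (simp add: square_integral_def)

lemma square_integral_norm_le:
  assumes "continuous_on UNIV u" "\<And>x. norm (u x) \<le> B"
  shows "norm (square_integral u) \<le> B"
proof -
  have "0 \<le> B" using assms(2)[of "(0, 0)"] norm_ge_zero order_trans by blast
  moreover have "(u has_integral square_integral u) (cbox (0, 0) (1, 1))"
    unfolding square_integral_def using square_integral_integrable[OF assms(1)] by blast
  ultimately have "norm (square_integral u) \<le> B * measure lborel (cbox (0, 0) (1, 1) :: (real \<times> real) set)"
    using assms(2) by (intro has_integral_bound) auto
  then show ?thesis by (simp add: content_Pair)
qed

lemma square_integral_diff_le:
  assumes "continuous_on UNIV u" "continuous_on UNIV v" "\<And>x. norm (u x - v x) \<le> B"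
  shows "norm (square_integral u - square_integral v) \<le> B"
  using square_integral_norm_le[of "\<lambda>x. u x - v x" B] assms
  by (simp add: square_integral_diff continuous_on_diff)

text \<open>In a suitable order of integration the shift is constant in the inner variable, and the
  inner integral over a full period does not see it. The two forms cover \<open>phi_lift\<close>,
  \<open>shear_lift\<close> and, with constant \<open>\<psi>\<close>, the rotations: all building
  blocks of the construction preserve area.\<close>

lemma square_integral_skew:
  assumes u: "continuous_on UNIV u" "torus_periodic u" and \<psi>: "continuous_on UNIV \<psi>"
  shows "square_integral (\<lambda>(x, y). u (x, y + \<psi> x)) = square_integral u"
    and "square_integral (\<lambda>(x, y). u (x + \<psi> y, y)) = square_integral u"
proof -
  have \<psi>': "continuous_on UNIV (\<lambda>p. \<psi> (fst p))" "continuous_on UNIV (\<lambda>p. \<psi> (snd p))"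
    by (intro continuous_on_compose2[OF \<psi>] continuous_intros subset_UNIV)+
  have "continuous_on UNIV (\<lambda>(x, y). u (x, y + \<psi> x))" "continuous_on UNIV (\<lambda>(x, y). u (x + \<psi> y, y))"
    unfolding split_def
    by (intro continuous_on_compose2[OF u(1)] continuous_intros \<psi>' subset_UNIV)+
  note F = square_integral_Fubini[OF this(1)] square_integral_Fubini[OF this(2)]
  have "integral {0..1} (\<lambda>y. u (x, y + c)) = integral {0..1} (\<lambda>y. u (x, y))" for x c
    using torus_periodic_shift1(2)[OF u(2)]
    by (intro integral_periodic_shift continuous_on_Pair_slices u)
  then show "square_integral (\<lambda>(x, y). u (x, y + \<psi> x)) = square_integral u"
    using F(1) square_integral_Fubini(1)[OF u(1)] by simp
  have "integral {0..1} (\<lambda>x. u (x + c, y)) = integral {0..1} (\<lambda>x. u (x, y))" for y c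
    using torus_periodic_shift1(1)[OF u(2)]
    by (intro integral_periodic_shift[of "\<lambda>x. u (x, y)"] continuous_on_Pair_slices u)
  then show "square_integral (\<lambda>(x, y). u (x + \<psi> y, y)) = square_integral u"
    using F(4) square_integral_Fubini(2)[OF u(1)] by simp
qed

section \<open>Characters and trigonometric polynomials\<close>

lemma torus_char_mult: "torus_char a b p * torus_char c d p = torus_char (a + c) (b + d) p"
  by (simp add: torus_char_def cis_mult algebra_simps)

lemma norm_torus_char [simp]: "norm (torus_char a b p) = 1"
  by (simp add: torus_char_def)

lemma continuous_torus_char [continuous_intros]: "continuous_on A (torus_char a b)"
  unfolding torus_char_def[abs_def] by (intro continuous_intros)

lemma torus_periodic_torus_char: "torus_periodic (torus_char a b)"
proof (rule torus_periodicI)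
  fix x m n
  have "2 * pi * (of_int a * fst (x + (of_int m, of_int n)) + of_int b * snd (x + (of_int m, of_int n)))
     = 2 * pi * (of_int a * fst x + of_int b * snd x) + 2 * pi * of_int (a * m + b * n)"
    by (simp add: algebra_simps)
  then show "torus_char a b (x + (of_int m, of_int n)) = torus_char a b x"
    unfolding torus_char_def by (simp only: cis_mult_eq_1 mult_1_right flip: cis_mult)
qed

inductive_set trig_poly :: "(real \<times> real \<Rightarrow> complex) set" where
  char: "(\<lambda>p. c * torus_char a b p) \<in> trig_poly"
| add: "f \<in> trig_poly \<Longrightarrow> g \<in> trig_poly \<Longrightarrow> (\<lambda>p. f p + g p) \<in> trig_poly"

lemma trig_poly_const: "(\<lambda>p. c) \<in> trig_poly"
  using trig_poly.char[of c 0 0] by (simp add: torus_char_def)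

lemma trig_poly_cmult: "f \<in> trig_poly \<Longrightarrow> (\<lambda>p. c * f p) \<in> trig_poly"
proof (induction rule: trig_poly.induct)
  case (char d a b)
  then show ?case using trig_poly.char[of "c * d" a b] by (simp add: mult.assoc)
next
  case (add f g)
  then show ?case using trig_poly.add[OF add.IH] by (simp add: distrib_left)
qed

lemma trig_poly_mult:
  assumes "f \<in> trig_poly" "g \<in> trig_poly"
  shows "(\<lambda>p. f p * g p) \<in> trig_poly"
  using assms(1)
proof (induction rule: trig_poly.induct)
  case (char c a b)
  show ?case using assms(2)
  proof (induction rule: trig_poly.induct)
    case (char d a' b')
    have "c * torus_char a b p * (d * torus_char a' b' p) = (c * d) * torus_char (a + a') (b + b') p" for p
      by (simp only: torus_char_mult[symmetric] mult_ac)
    then show ?case by (simp only: trig_poly.char)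
  next
    case (add f g)
    then show ?case using trig_poly.add[OF add.IH] by (simp add: distrib_left)
  qed
next
  case (add f g')
  then show ?case using trig_poly.add[OF add.IH] by (simp add: distrib_right)
qed

lemma continuous_trig_poly: "f \<in> trig_poly \<Longrightarrow> continuous_on UNIV f"
  by (induction rule: trig_poly.induct) (auto intro!: continuous_intros)

lemma torus_periodic_trig_poly: "f \<in> trig_poly \<Longrightarrow> torus_periodic f"
proof (induction rule: trig_poly.induct)
  case (char c a b)
  then show ?case using torus_periodic_torus_char[of a b] by (simp add: torus_periodic_def)
next
  case (add f g)
  then show ?case by (simp add: torus_periodic_def)
qed

lemma bounded_trig_poly: "f \<in> trig_poly \<Longrightarrow> \<exists>B>0. \<forall>p. norm (f p) \<le> B"
proof (induction rule: trig_poly.induct)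
  case (char c a b)
  show ?case by (rule exI[of _ "norm c + 1"]) (auto simp: norm_mult intro: add_nonneg_pos)
next
  case (add f g)
  then obtain B C where "B > 0" "C > 0" "\<forall>p. norm (f p) \<le> B" "\<forall>p. norm (g p) \<le> C" by blast
  then show ?case by (intro exI[of _ "B + C"]) (auto intro: norm_triangle_mono)
qed

text \<open>The torus is realised as a product of two unit circles, a compact subset of a Euclidean
  space, where the Stone-Weierstrass theorem for polynomial functions applies.\<close>

definition torus_emb :: "real \<times> real \<Rightarrow> complex \<times> complex" where
  "torus_emb p = (cis (2 * pi * fst p), cis (2 * pi * snd p))"

lemma continuous_torus_emb: "continuous_on A torus_emb"
  unfolding torus_emb_def[abs_def] by (intro continuous_intros)

lemma cis_2pi_eqD: "cis (2 * pi * x) = cis (2 * pi * y) \<Longrightarrow> x - y \<in> \<int>"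
proof -
  assume "cis (2 * pi * x) = cis (2 * pi * y)"
  then have "cis (2 * pi * x - 2 * pi * y) = 1"
    by (simp flip: cis_divide)
  then have "cos (2 * pi * x - 2 * pi * y) = 1"
    by (metis cis.sel(1) one_complex.sel(1))
  then obtain n :: int where "2 * pi * x - 2 * pi * y = of_int n * 2 * pi"
    unfolding cos_one_2pi_int by blast
  then have "2 * pi * (x - y) = 2 * pi * of_int n" by (simp add: algebra_simps)
  then show ?thesis by simp
qed

lemma torus_emb_eqD: "torus_emb x = torus_emb y \<Longrightarrow> lattice_rel x y"
  by (auto simp: torus_emb_def lattice_rel_def cis_2pi_eqD)

text \<open>A real-linear functional of \<open>torus_emb p\<close> is a combination of the sines and
  cosines of the two coordinates, hence of four characters; sums and products stay in
  \<open>trig_poly\<close>.\<close>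

lemma real_polynomial_torus_emb:
  "real_polynomial_function g \<Longrightarrow> (\<lambda>p. complex_of_real (g (torus_emb p))) \<in> trig_poly"
proof (induction rule: real_polynomial_function.induct)
  case (linear f)
  interpret f: bounded_linear f by fact
  have cs: "complex_of_real (cos (2 * pi * fst p)) = (1/2) * torus_char 1 0 p + (1/2) * torus_char (-1) 0 p"
    "complex_of_real (sin (2 * pi * fst p)) = (-\<i>/2) * torus_char 1 0 p + (\<i>/2) * torus_char (-1) 0 p"
    "complex_of_real (cos (2 * pi * snd p)) = (1/2) * torus_char 0 1 p + (1/2) * torus_char 0 (-1) p"
    "complex_of_real (sin (2 * pi * snd p)) = (-\<i>/2) * torus_char 0 1 p + (\<i>/2) * torus_char 0 (-1) p"
    for p
    by (simp_all add: torus_char_def complex_eq_iff)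
  have "f (torus_emb p) = cos (2 * pi * fst p) * f (1, 0) + sin (2 * pi * fst p) * f (\<i>, 0) +
      cos (2 * pi * snd p) * f (0, 1) + sin (2 * pi * snd p) * f (0, \<i>)" for p
  proof -
    have "torus_emb p = cos (2 * pi * fst p) *\<^sub>R (1, 0) + sin (2 * pi * fst p) *\<^sub>R (\<i>, 0) +
      cos (2 * pi * snd p) *\<^sub>R (0, 1) + sin (2 * pi * snd p) *\<^sub>R (0, \<i>)"
      by (simp add: torus_emb_def complex_eq_iff prod_eq_iff)
    then show ?thesis by (simp only: f.add f.scaleR real_scaleR_def)
  qed
  then have "complex_of_real (f (torus_emb p)) =
      of_real (f (1, 0)) * complex_of_real (cos (2 * pi * fst p)) +
      of_real (f (\<i>, 0)) * complex_of_real (sin (2 * pi * fst p)) +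
      of_real (f (0, 1)) * complex_of_real (cos (2 * pi * snd p)) +
      of_real (f (0, \<i>)) * complex_of_real (sin (2 * pi * snd p))" for p
    by (simp add: mult.commute)
  then show ?case
    unfolding cs by (simp only:) (intro trig_poly.add trig_poly_cmult trig_poly.char)
next
  case (const c)
  then show ?case by (simp add: trig_poly_const)
next
  case (add f g)
  then show ?case by (simp add: trig_poly.add)
next
  case (mult f g)
  then show ?case by (simp add: trig_poly_mult)
qed

text \<open>A periodic \<open>u\<close> factors through the product of circles by a continuous
  \<open>U\<close>. Polynomials that approximate the real and imaginary parts of \<open>U\<close>
  within \<open>e / 2\<close> pull back to trigonometric polynomials.\<close>

lemma trig_poly_dense:
  assumes cont: "continuous_on UNIV u" and per: "torus_periodic u" and e: "e > 0"
  shows "\<exists>P\<in>trig_poly. \<forall>p. norm (u p - P p) < e"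
proof -
  let ?Q = "cbox (0, 0) (1, 1) :: (real \<times> real) set"
  define T where "T = torus_emb ` ?Q"
  define U where "U = (\<lambda>t. u (SOME p. torus_emb p = t))"
  have U: "U (torus_emb p) = u p" for p
  proof -
    have "torus_emb (SOME p'. torus_emb p' = torus_emb p) = torus_emb p"
      by (rule someI[of "\<lambda>p'. torus_emb p' = torus_emb p" p]) simp
    then show ?thesis
      using per torus_emb_eqD unfolding U_def torus_periodic_def by blast
  qed
  have T: "torus_emb p \<in> T" for p
  proof -
    have "torus_emb p = torus_emb (frac (fst p), frac (snd p))"
    proof -
      have "cis (2 * pi * x) = cis (2 * pi * frac x)" for x
      proof -
        have "2 * pi * x = 2 * pi * frac x + 2 * pi * of_int \<lfloor>x\<rfloor>"
          by (simp add: frac_def algebra_simps)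
        then show ?thesis
          by (metis cis_mult cis_mult_eq_1 mult_1_right)
      qed
      then show ?thesis by (simp add: torus_emb_def)
    qed
    moreover have "(frac (fst p), frac (snd p)) \<in> ?Q"
      by (simp add: less_imp_le frac_lt_1 cbox_Pair_eq)
    ultimately show ?thesis unfolding T_def by blast
  qed
  have "compact T"
    unfolding T_def by (intro compact_continuous_image continuous_torus_emb compact_cbox)
  \<comment> \<open>A continuous map on the compact square is a quotient map onto its image, so
    openness of a preimage under \<open>U\<close> may be tested after composition with
    \<open>torus_emb\<close>, where \<open>U\<close> becomes \<open>u\<close>.\<close>
  moreover have "continuous_on T U"
    unfolding continuous_openin_preimage_eq
  proof (intro allI impI)
    fix S :: "complex set" assume "open S"
    have "?Q \<inter> torus_emb -` (T \<inter> U -` S) = ?Q \<inter> u -` S"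
    proof -
      have "torus_emb p \<in> U -` S \<longleftrightarrow> p \<in> u -` S" for p by (simp add: U)
      then show ?thesis using T by blast
    qed
    moreover have "openin (top_of_set ?Q) (?Q \<inter> u -` S)"
      using \<open>open S\<close> continuous_on_subset[OF cont, of ?Q] continuous_openin_preimage_eq by blast
    ultimately show "openin (top_of_set T) (T \<inter> U -` S)"
      using Abstract_Topology_2.continuous_imp_quotient_map[of ?Q torus_emb T "T \<inter> U -` S"] continuous_torus_emb
      by (simp add: T_def)
  qed
  ultimately obtain g h where
    g: "real_polynomial_function g" "\<And>x. x \<in> T \<Longrightarrow> \<bar>Re (U x) - g x\<bar> < e / 2" and
    h: "real_polynomial_function h" "\<And>x. x \<in> T \<Longrightarrow> \<bar>Im (U x) - h x\<bar> < e / 2"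
    using Stone_Weierstrass_real_polynomial_function[of T "\<lambda>x. Re (U x)" "e / 2"]
      Stone_Weierstrass_real_polynomial_function[of T "\<lambda>x. Im (U x)" "e / 2"] e
    by (metis continuous_on_Re continuous_on_Im half_gt_zero)
  show ?thesis
  proof (intro bexI allI)
    show "(\<lambda>p. complex_of_real (g (torus_emb p)) + \<i> * complex_of_real (h (torus_emb p))) \<in> trig_poly"
      by (intro trig_poly.add trig_poly_cmult real_polynomial_torus_emb g h)
    fix p
    have "norm (u p - (complex_of_real (g (torus_emb p)) + \<i> * complex_of_real (h (torus_emb p))))
      \<le> \<bar>Re (u p) - g (torus_emb p)\<bar> + \<bar>Im (u p) - h (torus_emb p)\<bar>"
      using cmod_le[of "u p - (complex_of_real (g (torus_emb p)) + \<i> * complex_of_real (h (torus_emb p)))"]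
      by simp
    then show "norm (u p - (complex_of_real (g (torus_emb p)) + \<i> * complex_of_real (h (torus_emb p)))) < e"
      using g(2)[OF T, of p] h(2)[OF T, of p] by (simp add: U)
  qed
qed

section \<open>Asymptotic mixing of the conjugated rotations\<close>

lemma continuous_on_Delta: "continuous_on A (Delta k q t :: 'a::{real_normed_field,banach} \<times> 'a \<Rightarrow> 'a)"
  unfolding Delta_def[abs_def] by (intro continuous_intros)

lemma continuous_on_Phi: "continuous_on A (Phi k q t :: 'a::{real_normed_field,banach} \<times> 'a \<Rightarrow> _)"
  unfolding Phi_def[abs_def] by (intro continuous_intros continuous_on_Delta)

lemma cos_2pi_int_shift: "cos (2 * pi * of_int q * (x + of_int n)) = cos (2 * pi * of_int q * x)"
proof -
  have "2 * pi * of_int q * (x + of_int n) = 2 * pi * of_int q * x + 2 * pi * of_int (q * n)"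
    by (simp add: algebra_simps)
  then show ?thesis
    by (simp only: cos_add sin_int_2pin cos_int_2pin mult_1_right mult_zero_right diff_0_right)
qed

text \<open>Translation by \<open>(c, d)\<close> preserves the integral and multiplies the character
  by a constant; if this constant is not 1, the integral vanishes.\<close>

lemma square_integral_torus_char:
  "square_integral (torus_char a b) = (if a = 0 \<and> b = 0 then 1 else 0)"
proof -
  have z: "square_integral (torus_char a b) = 0"
    if "cis (2 * pi * (of_int a * c + of_int b * d)) \<noteq> 1" for c d
  proof -
    note cp = continuous_torus_char[of UNIV a b] torus_periodic_torus_char[of a b]
    have "square_integral (torus_char a b) = square_integral (\<lambda>(x, y). torus_char a b (x + c, y + d))"
    proof -
      have "square_integral (\<lambda>(x, y). torus_char a b (x + c, y)) = square_integral (torus_char a b)"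
        using square_integral_skew(2)[OF cp, of "\<lambda>_. c"] by simp
      moreover have "continuous_on UNIV (\<lambda>(x, y). torus_char a b (x + c, y))"
        unfolding split_def by (intro continuous_on_compose2[OF cp(1)] continuous_intros subset_UNIV)
      moreover have "torus_periodic (\<lambda>(x, y). torus_char a b (x + c, y))"
        using cp(2) by (auto simp: torus_periodic_def lattice_rel_def)
      ultimately show ?thesis
        using square_integral_skew(1)[of "\<lambda>(x, y). torus_char a b (x + c, y)" "\<lambda>_. d"] by simp
    qed
    also have "\<dots> = square_integral (\<lambda>p. cis (2 * pi * (of_int a * c + of_int b * d)) * torus_char a b p)"
      by (simp add: torus_char_def cis_mult split_def algebra_simps)
    finally have "square_integral (torus_char a b) * (1 - cis (2 * pi * (of_int a * c + of_int b * d))) = 0"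
      unfolding square_integral_cmult by (simp add: algebra_simps)
    then show ?thesis using that by simp
  qed
  show ?thesis
  proof (cases "a = 0 \<and> b = 0")
    case True
    have "square_integral (\<lambda>_. 1) = 1"
      using square_integral_Fubini(1)[of "\<lambda>_. 1"] by simp
    moreover have "torus_char a b = (\<lambda>_. 1)"
      using True by (auto simp: torus_char_def)
    ultimately show ?thesis using True by simp
  next
    case False
    have c: "cis (pi :: real) \<noteq> 1" by simp
    \<comment> \<open>Translation by half a period in one coordinate gives the constant
      \<open>cis pi\<close>.\<close>
    have "square_integral (torus_char a b) = 0"
    proof (cases "a = 0")
      case True
      then show ?thesis using z[of 0 "1 / (2 * of_int b)"] False c by simp
    next
      case a: False
      then show ?thesis using z[of "1 / (2 * of_int a)" 0] c by simp
    qed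
    then show ?thesis using False by auto
  qed
qed

text \<open>The phase becomes a single sine wave. The time \<open>t\<close> survives only in the
  amplitude \<open>2 * sin (pi * q * t)\<close> and in a shift by \<open>t / 2\<close>, which the
  mean over a period does not see.\<close>

lemma cos_diff_shift:
  "cos (2 * pi * q * (x + t)) - cos (2 * pi * q * x) =
    - 2 * sin (pi * q * t) * sin (2 * pi * (q * (x + t / 2)))" for q x t :: real
proof -
  have "cos (2 * pi * q * (x + t)) - cos (2 * pi * q * x) =
      2 * sin ((2 * pi * q * (x + t) + 2 * pi * q * x) / 2) * sin ((2 * pi * q * x - 2 * pi * q * (x + t)) / 2)"
    by (rule cos_diff_cos)
  also have "(2 * pi * q * (x + t) + 2 * pi * q * x) / 2 = 2 * pi * (q * (x + t / 2))"
    by (simp add: algebra_simps)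
  also have "(2 * pi * q * x - 2 * pi * q * (x + t)) / 2 = - (pi * q * t)"
    by (simp add: algebra_simps)
  finally show ?thesis by simp
qed

text \<open>
  The integrand depends on \<open>x\<close> through \<open>torus_char A 0\<close> and a function of period \<open>1 / q\<close>; the
  mean of the latter is a Bessel function of a large argument.
\<close>

lemma oscillation_small:
  assumes "e > 0"
  shows "\<exists>K. \<forall>A N q t. K \<le> q \<longrightarrow> \<bar>A\<bar> < q \<longrightarrow> N \<noteq> 0 \<longrightarrow> \<bar>sin (pi * of_int q * t)\<bar> \<ge> 1/2 \<longrightarrow>
    norm (integral {0..1} (\<lambda>x. cis (2 * pi * of_int A * x) *
      cis (2 * pi * of_int N * ((of_int q)\<^sup>2 * (cos (2 * pi * of_int q * (x + t)) - cos (2 * pi * of_int q * x)))))) \<le> e"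
proof -
  obtain Z where Z: "Z > 0" "\<And>z. \<bar>z\<bar> \<ge> Z \<Longrightarrow> norm (integral {0..1} (\<lambda>x. cis (z * sin (2 * pi * x)))) \<le> e"
    using bessel_decay[OF assms] by blast
  show ?thesis
  \<comment> \<open>\<open>Z\<close> is rounded up to get \<open>q \<ge> Z\<close>, and
    \<open>q \<ge> 1\<close> gives \<open>q\<^sup>2 \<ge> q\<close>; the Bessel argument is
    proportional to \<open>q\<^sup>2\<close>.\<close>
  proof (intro exI[of _ "max 1 \<lceil>Z\<rceil>"] allI impI)
    fix A N q :: int and t :: real
    assume q: "max 1 \<lceil>Z\<rceil> \<le> q" and A: "\<bar>A\<bar> < q" and N: "N \<noteq> 0" and t: "\<bar>sin (pi * of_int q * t)\<bar> \<ge> 1/2"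
    define E where "E = (\<lambda>x. cis (2 * pi * of_int N * ((of_int q)\<^sup>2 *
        (cos (2 * pi * of_int q * (x + t)) - cos (2 * pi * of_int q * x)))))"
    have contE: "continuous_on UNIV E"
      unfolding E_def by (intro continuous_intros)
    have perE: "E (x + 1) = E x" for x
      unfolding E_def using cos_2pi_int_shift[of q x 1] cos_2pi_int_shift[of q "x + t" 1]
      by (simp add: algebra_simps)
    let ?J = "integral {0..1} (\<lambda>x. cis (2 * pi * of_int A * x) * E x)"
    have "norm ?J \<le> e"
    proof (cases "A = 0")
      case True
      \<comment> \<open>The Bessel argument. By \<open>cos_diff_shift\<close> the phase is
        \<open>z * sin (2 * pi * (q * (x + t / 2)))\<close>, and
        \<open>\<bar>z\<bar> \<ge> 2 * pi * q\<^sup>2\<close> because the sine in \<open>t\<close>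
        is at least \<open>1/2\<close> in modulus.\<close>
      define z where "z = - 4 * pi * of_int N * (of_int q)\<^sup>2 * sin (pi * of_int q * t)"
      define v where "v = (\<lambda>x. cis (z * sin (2 * pi * x)))"
      have v: "continuous_on UNIV v" "\<And>x. v (x + 1) = v x"
        unfolding v_def by (auto intro!: continuous_intros simp: distrib_left)
      have vq: "continuous_on UNIV (\<lambda>x. v (of_int q * x))"
        by (intro continuous_on_compose2[OF v(1)] continuous_intros subset_UNIV)
      have vq': "v (of_int q * (x + 1)) = v (of_int q * x)" for x
        using periodic_int[of v "of_int q * x" q, OF v(2)] by (simp add: distrib_left)
      have "E x = v (of_int q * (x + t / 2))" for x
        unfolding E_def v_def z_def cos_diff_shift by (simp add: mult_ac)
      then have "?J = integral {0..1} (\<lambda>x. v (of_int q * (x + t / 2)))"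
        using True by simp
      also have "\<dots> = integral {0..1} (\<lambda>x. v (of_int q * x))"
        using integral_periodic_shift[OF vq vq', of "t / 2"] by simp
      also have "\<dots> = integral {0..1} v"
        using q by (intro integral_periodic_scale v) auto
      finally have J: "?J = integral {0..1} v" .
      have "\<bar>of_int N\<bar> \<ge> (1 :: real)"
        using N by linarith
      moreover have "(of_int q :: real)\<^sup>2 \<ge> of_int q"
        using q by (simp add: power2_eq_square)
      moreover have "of_int q \<ge> Z"
        using q by linarith
      ultimately have Nq: "\<bar>of_int N\<bar> \<ge> (1 :: real)" "Z \<le> (of_int q :: real)\<^sup>2"
        by linarith+
      have "\<bar>z\<bar> = (4 * pi) * \<bar>of_int N\<bar> * (of_int q)\<^sup>2 * \<bar>sin (pi * of_int q * t)\<bar>"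
        by (simp add: z_def abs_mult)
      moreover have "1 * 1 * Z \<le> (4 * pi) * \<bar>of_int N\<bar> * (of_int q)\<^sup>2 * \<bar>sin (pi * of_int q * t)\<bar>"
      proof -
        have "1 * 1 * Z \<le> (4 * pi * (1/2)) * \<bar>of_int N\<bar> * (of_int q)\<^sup>2"
          using Nq Z(1) pi_gt3
          by (intro mult_mono) (auto intro: mult_nonneg_nonneg)
        also have "\<dots> = (4 * pi) * \<bar>of_int N\<bar> * (of_int q)\<^sup>2 * (1/2)" by simp
        also have "\<dots> \<le> (4 * pi) * \<bar>of_int N\<bar> * (of_int q)\<^sup>2 * \<bar>sin (pi * of_int q * t)\<bar>"
          using t by (intro mult_left_mono) auto
        finally show ?thesis .
      qed
      ultimately show ?thesis
        using Z(2)[of z] J by (simp add: v_def)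
    next
      case False
      have q0: "q > 0" using q by auto
      \<comment> \<open>Translation by \<open>1 / q\<close> leaves \<open>E\<close> unchanged and
        multiplies the character by \<open>cis (2 * pi * A / q)\<close>. This is not 1 for
        \<open>0 < \<bar>A\<bar> < q\<close>, so the integral is exactly 0.\<close>
      define w where "w = (\<lambda>x. cis (2 * pi * of_int A * x) * E x)"
      have "continuous_on UNIV w"
        unfolding w_def by (intro continuous_intros contE)
      moreover have "w (x + 1) = w x" for x
        using cis_mult_eq_1[of A] perE by (simp add: w_def distrib_left mult.assoc flip: cis_mult)
      ultimately have "integral {0..1} (\<lambda>x. w (x + 1 / of_int q)) = integral {0..1} w"
        by (rule integral_periodic_shift)
      moreover have "w (x + 1 / of_int q) = cis (2 * pi * (of_int A / of_int q)) * w x" for x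
      proof -
        have c: "cos (2 * pi * of_int q * (y + 1 / of_int q)) = cos (2 * pi * of_int q * y)" for y
        proof -
          have "2 * pi * of_int q * (y + 1 / of_int q) = 2 * pi * of_int q * y + 2 * pi"
            using q0 by (simp add: field_simps)
          then show ?thesis by simp
        qed
        have "E (x + 1 / of_int q) = E x"
          unfolding E_def using c[of x] c[of "x + t"] by (simp add: add_ac)
        then show ?thesis
          by (simp add: w_def distrib_left mult_ac flip: cis_mult)
      qed
      ultimately have "(1 - cis (2 * pi * (of_int A / of_int q))) * integral {0..1} w = 0"
        by (simp add: algebra_simps)
      moreover have "cis (2 * pi * (of_int A / of_int q)) \<noteq> 1"
      proof
        assume "cis (2 * pi * (of_int A / of_int q)) = 1"
        then have "cis (2 * pi * (of_int A / of_int q)) = cis (2 * pi * 0)" by simp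
        then have "of_int A / of_int q - 0 \<in> (\<int> :: real set)"
          by (rule cis_2pi_eqD)
        then obtain n where "of_int A / of_int q = (of_int n :: real)"
          by (auto elim: Ints_cases)
        then have "(of_int A :: real) = of_int (n * q)"
          using q0 by (simp add: field_simps)
        then have "A = n * q" by (simp only: of_int_eq_iff)
        moreover have "n \<noteq> 0" using \<open>A = n * q\<close> False by auto
        ultimately have "\<bar>A\<bar> \<ge> q"
          using q0 by (simp add: abs_mult)
        then show False using A by simp
      qed
      ultimately have "integral {0..1} w = 0" by simp
      then show ?thesis using assms by (simp add: w_def)
    qed
    then show "norm (integral {0..1} (\<lambda>x. cis (2 * pi * of_int A * x) *
      cis (2 * pi * of_int N * ((of_int q)\<^sup>2 * (cos (2 * pi * of_int q * (x + t)) - cos (2 * pi * of_int q * x)))))) \<le> e"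
      by (simp add: E_def)
  qed
qed

text \<open>Under \<open>Phi\<close> the second coordinate moves by \<open>Delta\<close> and the
  first, apart from the rotation, by \<open>k\<close> times as much; so the character with indices
  \<open>a, b\<close> sees \<open>Delta\<close> with the frequency \<open>a * k + b\<close>.\<close>

lemma torus_char_Phi:
  "torus_char a b (Phi k q t p) * torus_char c d p =
    cis (2 * pi * of_int a * t) * (torus_char (a + c) (b + d) p * cis (2 * pi * of_int (a * k + b) * Delta k q t p))"
  by (simp add: torus_char_def Phi_def cis_mult algebra_simps)

text \<open>Substituting \<open>x + k * y\<close> for \<open>x\<close> straightens the shear:
  \<open>E\<close> then depends on \<open>x\<close> alone, and \<open>y\<close> enters only through
  factors of modulus 1. What remains is the integral of \<open>oscillation_small\<close>.\<close>

lemma square_integral_skew_product: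
  assumes "continuous_on UNIV E" "\<And>x. E (x + 1) = E x"
    and J: "norm (integral {0..1} (\<lambda>x. cis (2 * pi * of_int A * x) * E x)) \<le> e"
  shows "norm (square_integral (\<lambda>p. torus_char A B p * E (fst p - of_int k * snd p))) \<le> e"
proof -
  let ?u = "\<lambda>p. torus_char A B p * E (fst p - of_int k * snd p)"
  have cu: "continuous_on UNIV ?u"
    by (intro continuous_intros continuous_on_compose2[OF assms(1)] subset_UNIV)
  moreover have "torus_periodic ?u"
  proof (rule torus_periodicI)
    fix x :: "real \<times> real" and m n
    have "fst (x + (of_int m, of_int n)) - of_int k * snd (x + (of_int m, of_int n)) =
      (fst x - of_int k * snd x) + of_int (m - k * n)"
      by (simp add: algebra_simps)
    moreover have "torus_char A B (x + (of_int m, of_int n)) = torus_char A B x"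
      using torus_periodic_shift[OF torus_periodic_torus_char, of A B "fst x" m "snd x" n]
      by (simp add: plus_prod_def)
    ultimately show "?u (x + (of_int m, of_int n)) = ?u x"
      by (simp only: periodic_int[of E, OF assms(2)])
  qed
  ultimately have "square_integral ?u = square_integral (\<lambda>(x, y). ?u (x + of_int k * y, y))"
    using square_integral_skew(2)[of ?u "\<lambda>y. of_int k * y"] by (simp add: continuous_intros)
  also have "\<dots> = square_integral (\<lambda>p. torus_char A (A * k + B) p * E (fst p))"
    by (simp add: split_def torus_char_def algebra_simps)
  also have "\<dots> = integral {0..1} (\<lambda>y. integral {0..1} (\<lambda>x. torus_char A (A * k + B) (x, y) * E x))"
  proof -
    have "continuous_on UNIV (\<lambda>p :: real \<times> real. torus_char A (A * k + B) p * E (fst p))"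
      by (intro continuous_intros continuous_on_compose2[OF assms(1)] subset_UNIV)
    from square_integral_Fubini(2)[OF this] show ?thesis by simp
  qed
  also have "\<dots> = integral {0..1} (\<lambda>y. cis (2 * pi * of_int (A * k + B) * y) *
      integral {0..1} (\<lambda>x. cis (2 * pi * of_int A * x) * E x))"
  proof -
    have "torus_char A (A * k + B) (x, y) * E x =
       cis (2 * pi * of_int (A * k + B) * y) * (cis (2 * pi * of_int A * x) * E x)" for x y
    proof -
      have "torus_char A (A * k + B) (x, y) =
          cis (2 * pi * of_int (A * k + B) * y) * cis (2 * pi * of_int A * x)"
        by (simp add: torus_char_def cis_mult algebra_simps)
      then show ?thesis by (simp only: mult.assoc)
    qed
    then show ?thesis by (simp only: Henstock_Kurzweil_Integration.integral_mult_right)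
  qed
  also have "norm \<dots> \<le> e * (1 - 0)"
    by (rule integral_bound) (auto intro!: continuous_intros simp: norm_mult J)
  finally show ?thesis by simp
qed

abbreviation correlation_defect ::
    "(real \<times> real \<Rightarrow> complex) \<Rightarrow> (real \<times> real \<Rightarrow> complex) \<Rightarrow> int \<Rightarrow> int \<Rightarrow> real \<Rightarrow> real" where
  "correlation_defect U V k q t \<equiv>
     norm (square_integral (\<lambda>p. U (Phi k q t p) * V p) - square_integral U * square_integral V)"

text \<open>For \<open>a = b = 0\<close> the correlation factorises exactly. Otherwise the product
  of the means is 0, and the correlation itself has to be small.\<close>

lemma mixing_char:
  assumes "e > 0"
  shows "\<exists>K. \<forall>q k t. K \<le> q \<longrightarrow> K \<le> k \<longrightarrow> \<bar>sin (pi * of_int q * t)\<bar> \<ge> 1/2 \<longrightarrow>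
    correlation_defect (torus_char a b) (torus_char c d) k q t \<le> e"
proof (cases "a = 0 \<and> b = 0")
  case True
  then have "torus_char a b p = 1" for p
    by (simp add: torus_char_def)
  then have "square_integral (\<lambda>p. torus_char a b (Phi k q t p) * torus_char c d p) =
    square_integral (torus_char a b) * square_integral (torus_char c d)" for q k t
    using True square_integral_torus_char[of 0 0] by simp
  then show ?thesis using assms by (simp add: less_imp_le)
next
  case False
  from oscillation_small[OF assms] obtain K where K: "\<forall>A N q t. K \<le> q \<longrightarrow> \<bar>A\<bar> < q \<longrightarrow> N \<noteq> 0 \<longrightarrow> \<bar>sin (pi * of_int q * t)\<bar> \<ge> 1/2 \<longrightarrow>
    norm (integral {0..1} (\<lambda>x. cis (2 * pi * of_int A * x) *
      cis (2 * pi * of_int N * ((of_int q)\<^sup>2 * (cos (2 * pi * of_int q * (x + t)) - cos (2 * pi * of_int q * x)))))) \<le> e" ..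
  show ?thesis
  \<comment> \<open>Three thresholds: \<open>K\<close> for the Bessel decay,
    \<open>q > \<bar>a + c\<bar>\<close> to avoid resonance with a phase of period
    \<open>1 / q\<close>, and \<open>k > \<bar>b\<bar>\<close> to exclude
    \<open>a * k + b = 0\<close>.\<close>
  proof (intro exI[of _ "max K (max (\<bar>a + c\<bar> + 1) (\<bar>b\<bar> + 1))"] allI impI)
    fix q k :: int and t :: real
    assume q: "max K (max (\<bar>a + c\<bar> + 1) (\<bar>b\<bar> + 1)) \<le> q"
      and k: "max K (max (\<bar>a + c\<bar> + 1) (\<bar>b\<bar> + 1)) \<le> k" and t: "\<bar>sin (pi * of_int q * t)\<bar> \<ge> 1/2"
    have N: "a * k + b \<noteq> 0"
    proof
      assume "a * k + b = 0"
      then have b: "b = - (a * k)" by simp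
      have "a \<noteq> 0" using b False by auto
      then have "1 * \<bar>k\<bar> \<le> \<bar>a\<bar> * \<bar>k\<bar>" by (intro mult_right_mono) auto
      moreover have "\<bar>b\<bar> = \<bar>a\<bar> * \<bar>k\<bar>" by (subst b) (simp add: abs_mult)
      ultimately show False using k abs_ge_self[of k] by linarith
    qed
    define E where "E = (\<lambda>x. cis (2 * pi * of_int (a * k + b) * ((of_int q)\<^sup>2 *
        (cos (2 * pi * of_int q * (x + t)) - cos (2 * pi * of_int q * x)))))"
    have "continuous_on UNIV E"
      unfolding E_def by (intro continuous_intros)
    moreover have "E (x + 1) = E x" for x
      unfolding E_def using cos_2pi_int_shift[of q x 1] cos_2pi_int_shift[of q "x + t" 1]
      by (simp add: algebra_simps)
    moreover have "norm (integral {0..1} (\<lambda>x. cis (2 * pi * of_int (a + c) * x) * E x)) \<le> e"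
      unfolding E_def using q t N by (intro K[rule_format]) auto
    ultimately have "norm (square_integral (\<lambda>p. torus_char (a + c) (b + d) p * E (fst p - of_int k * snd p))) \<le> e"
      by (rule square_integral_skew_product)
    then have "norm (square_integral (\<lambda>p. torus_char a b (Phi k q t p) * torus_char c d p)) \<le> e"
      unfolding torus_char_Phi square_integral_cmult by (simp add: norm_mult E_def Delta_def)
    then show "correlation_defect (torus_char a b) (torus_char c d) k q t \<le> e"
      using False by (auto simp: square_integral_torus_char[of a b])
  qed
qed

text \<open>One threshold serves \<open>q\<close> and \<open>k\<close> and is independent of
  \<open>t\<close>: in the construction \<open>t\<close> is a multiple of a rational that is chosen
  after \<open>q\<close> and \<open>k\<close>.\<close>

definition asymp_mixing :: "(real \<times> real \<Rightarrow> complex) \<Rightarrow> (real \<times> real \<Rightarrow> complex) \<Rightarrow> bool" where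
  "asymp_mixing U V \<longleftrightarrow> (\<forall>e>0. \<exists>K. \<forall>q k t. K \<le> q \<longrightarrow> K \<le> k \<longrightarrow> \<bar>sin (pi * of_int q * t)\<bar> \<ge> 1/2 \<longrightarrow>
    correlation_defect U V k q t \<le> e)"

lemma asymp_mixing_approx:
  assumes appr: "\<And>e. e > 0 \<Longrightarrow> \<exists>P Q. asymp_mixing P Q \<and> (\<forall>q k t.
    norm (square_integral (\<lambda>p. U (Phi k q t p) * V p) - square_integral (\<lambda>p. P (Phi k q t p) * Q p)) \<le> e) \<and>
    norm (square_integral U * square_integral V - square_integral P * square_integral Q) \<le> e"
  shows "asymp_mixing U V"
  unfolding asymp_mixing_def
proof (intro allI impI)
  fix e :: real assume "e > 0"
  then obtain P Q where PQ: "asymp_mixing P Q"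
    "\<And>q k t. norm (square_integral (\<lambda>p. U (Phi k q t p) * V p) - square_integral (\<lambda>p. P (Phi k q t p) * Q p)) \<le> e / 3"
    "norm (square_integral U * square_integral V - square_integral P * square_integral Q) \<le> e / 3"
    using appr[of "e / 3"] by auto
  obtain K where K: "\<And>q k t. K \<le> q \<Longrightarrow> K \<le> k \<Longrightarrow> \<bar>sin (pi * of_int q * t)\<bar> \<ge> 1/2 \<Longrightarrow>
    correlation_defect P Q k q t \<le> e / 3"
    using PQ(1) \<open>e > 0\<close> unfolding asymp_mixing_def by (meson divide_pos_pos zero_less_numeral)
  have "correlation_defect U V k q t \<le> e"
    if "K \<le> q" "K \<le> k" "\<bar>sin (pi * of_int q * t)\<bar> \<ge> 1/2" for q k t
  proof -
    have "norm ((x - y) + (y - z) + (z - w)) \<le> e"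
      if "norm (x - y) \<le> e / 3" "norm (y - z) \<le> e / 3" "norm (w - z) \<le> e / 3" for x y z w :: complex
      using norm_triangle_mono[OF norm_triangle_mono[OF that(1,2)], of "z - w" "e / 3"] that(3)
      by (simp add: norm_minus_commute)
    from this[OF PQ(2)[of k q t] K[OF that] PQ(3)] show ?thesis by simp
  qed
  then show "\<exists>K. \<forall>q k t. K \<le> q \<longrightarrow> K \<le> k \<longrightarrow> \<bar>sin (pi * of_int q * t)\<bar> \<ge> 1/2 \<longrightarrow>
    correlation_defect U V k q t \<le> e"
    by blast
qed

text \<open>Two pairs of functions with two coefficients are allowed so that the lemma yields
  additivity in either argument and also scalar multiples, the latter with
  \<open>d = 0\<close>.\<close>

lemma asymp_mixing_add:
  assumes "asymp_mixing F H" "asymp_mixing G H'"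
    and eq: "\<And>k q t. square_integral (\<lambda>p. U (Phi k q t p) * V p) =
      c * square_integral (\<lambda>p. F (Phi k q t p) * H p) + d * square_integral (\<lambda>p. G (Phi k q t p) * H' p)"
    "square_integral U * square_integral V =
      c * (square_integral F * square_integral H) + d * (square_integral G * square_integral H')"
  shows "asymp_mixing U V"
  unfolding asymp_mixing_def
proof (intro allI impI)
  fix e :: real assume e: "e > 0"
  define a where "a = e / (norm c + norm d + 1)"
  have pos: "norm c + norm d + 1 > 0"
    by (simp add: add_nonneg_pos)
  then have a: "a > 0"
    using e by (simp add: a_def)
  have "(norm c + norm d) * a \<le> (norm c + norm d + 1) * a"
    using a by (intro mult_right_mono) auto
  also have "\<dots> = e"
    using pos by (simp add: a_def)
  finally have a': "(norm c + norm d) * a \<le> e" .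
  obtain K where K: "\<And>q k t. K \<le> q \<Longrightarrow> K \<le> k \<Longrightarrow> \<bar>sin (pi * of_int q * t)\<bar> \<ge> 1/2 \<Longrightarrow>
    correlation_defect F H k q t \<le> a"
    using assms(1) a unfolding asymp_mixing_def by meson
  obtain L where L: "\<And>q k t. L \<le> q \<Longrightarrow> L \<le> k \<Longrightarrow> \<bar>sin (pi * of_int q * t)\<bar> \<ge> 1/2 \<Longrightarrow>
    correlation_defect G H' k q t \<le> a"
    using assms(2) a unfolding asymp_mixing_def by meson
  show "\<exists>K. \<forall>q k t. K \<le> q \<longrightarrow> K \<le> k \<longrightarrow> \<bar>sin (pi * of_int q * t)\<bar> \<ge> 1/2 \<longrightarrow>
    correlation_defect U V k q t \<le> e"
  proof (intro exI[of _ "max K L"] allI impI)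
    fix q k t assume *: "max K L \<le> q" "max K L \<le> k" "1/2 \<le> \<bar>sin (pi * of_int q * t)\<bar>"
    define x where "x = square_integral (\<lambda>p. F (Phi k q t p) * H p) - square_integral F * square_integral H"
    define y where "y = square_integral (\<lambda>p. G (Phi k q t p) * H' p) - square_integral G * square_integral H'"
    have "norm x \<le> a" "norm y \<le> a"
      using K[of q k t] L[of q k t] * by (auto simp: x_def y_def)
    then have "norm (c * x + d * y) \<le> norm c * a + norm d * a"
      by (intro norm_triangle_mono) (auto simp: norm_mult intro: mult_left_mono)
    also have "\<dots> \<le> e" using a' by (simp add: distrib_right)
    also have "c * x + d * y = square_integral (\<lambda>p. U (Phi k q t p) * V p) - square_integral U * square_integral V"
      unfolding eq x_def y_def by (simp add: algebra_simps)
    finally show "correlation_defect U V k q t \<le> e" .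
  qed
qed

lemma continuous_on_comp_Phi:
  "continuous_on UNIV U \<Longrightarrow> continuous_on UNIV (\<lambda>p. U (Phi k q t p))" for U :: "real \<times> real \<Rightarrow> complex"
  by (rule continuous_on_compose2) (auto intro: continuous_on_Phi)

lemma asymp_mixing_trig_poly:
  assumes "P \<in> trig_poly" "Q \<in> trig_poly"
  shows "asymp_mixing P Q"
  using assms(1)
proof (induction rule: trig_poly.induct)
  case (char c a b)
  show ?case using assms(2)
  proof (induction rule: trig_poly.induct)
    case (char c' a' b')
    have "asymp_mixing (torus_char a b) (torus_char a' b')"
      unfolding asymp_mixing_def using mixing_char by blast
    then show ?case
      using asymp_mixing_add[of "torus_char a b" "torus_char a' b'" "torus_char a b" "torus_char a' b'"
          "\<lambda>p. c * torus_char a b p" "\<lambda>p. c' * torus_char a' b' p" "c * c'" 0]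
      by (simp add: square_integral_cmult mult_ac flip: square_integral_cmult[of "c * c'"])
  next
    case (add f g)
    let ?P = "\<lambda>p. c * torus_char a b p"
    note cont = add(1,2)[THEN continuous_trig_poly] continuous_on_comp_Phi[OF continuous_trig_poly[OF trig_poly.char[of c a b]]]
    show ?case
      by (rule asymp_mixing_add[OF add.IH, of _ _ 1 1])
        (use cont in \<open>simp_all add: distrib_left square_integral_add continuous_on_mult\<close>)
  qed
next
  case (add f g)
  note cont = add(1,2)[THEN continuous_trig_poly] add(1,2)[THEN continuous_trig_poly, THEN continuous_on_comp_Phi]
    continuous_trig_poly[OF assms(2)]
  show ?case
    by (rule asymp_mixing_add[OF add.IH, of _ _ 1 1])
      (use cont in \<open>simp_all add: distrib_right square_integral_add continuous_on_mult\<close>)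
qed

text \<open>The correlation and the product of the means depend continuously on \<open>U\<close> and
  \<open>V\<close> in the supremum norm, uniformly in \<open>k\<close>, \<open>q\<close> and
  \<open>t\<close>, because \<open>Phi\<close> enters only by composition. Hence trigonometric
  polynomials suffice.\<close>

proposition asymp_mixing_continuous:
  assumes U: "continuous_on UNIV U" "torus_periodic U" and V: "continuous_on UNIV V" "torus_periodic V"
  shows "asymp_mixing U V"
proof (rule asymp_mixing_approx)
  fix e :: real assume "e > 0"
  \<comment> \<open>This first approximation provides the bound \<open>B + 1\<close> for
    \<open>V\<close>. The order \<open>B\<close>, \<open>P\<close>, \<open>C\<close>,
    \<open>Q\<close> matters: the precision of \<open>P\<close> depends on the bound for
    \<open>V\<close>, and the precision of \<open>Q\<close> on the bound for
    \<open>P\<close>.\<close>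
  obtain V0 where V0: "V0 \<in> trig_poly" "\<And>p. norm (V p - V0 p) < 1"
    using trig_poly_dense[OF V, of 1] by auto
  obtain B where B: "B > 0" "\<And>p. norm (V0 p) \<le> B"
    using bounded_trig_poly[OF V0(1)] by auto
  have VB: "norm (V p) \<le> B + 1" for p
    using norm_triangle_mono[OF less_imp_le[OF V0(2)[of p]] B(2)[of p]] by simp
  define \<eta> where "\<eta> = e / 2 / (B + 1)"
  have "B + 1 \<noteq> 0" using B(1) by simp
  then have "\<eta> * (B + 1) = e / 2" using nonzero_eq_divide_eq[of "B + 1" \<eta> "e / 2"] \<eta>_def by blast
  then have \<eta>: "\<eta> > 0" "\<eta> * (B + 1) = e / 2" using \<open>e > 0\<close> B by (auto simp: \<eta>_def)
  obtain P where P: "P \<in> trig_poly" "\<And>p. norm (U p - P p) < \<eta>"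
    using trig_poly_dense[OF U \<eta>(1)] by auto
  obtain C where C: "C > 0" "\<And>p. norm (P p) \<le> C"
    using bounded_trig_poly[OF P(1)] by auto
  define \<zeta> where "\<zeta> = e / (2 * C)"
  have \<zeta>: "\<zeta> > 0" "C * \<zeta> = e / 2" using \<open>e > 0\<close> C by (auto simp: \<zeta>_def)
  obtain Q where Q: "Q \<in> trig_poly" "\<And>p. norm (V p - Q p) < \<zeta>"
    using trig_poly_dense[OF V \<zeta>(1)] by auto
  note contP = continuous_trig_poly[OF P(1)] and contQ = continuous_trig_poly[OF Q(1)]
  have key: "norm (u * v - p * q) \<le> e"
    if "norm (u - p) \<le> \<eta>" "norm v \<le> B + 1" "norm p \<le> C" "norm (v - q) \<le> \<zeta>" for u v p q :: complex
  proof -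
    have "norm ((u - p) * v + p * (v - q)) \<le> \<eta> * (B + 1) + C * \<zeta>"
      using that \<eta> C by (intro norm_triangle_mono) (auto simp: norm_mult intro!: mult_mono)
    then show ?thesis using \<eta> \<zeta> by (simp add: algebra_simps)
  qed
  have "norm (square_integral (\<lambda>p. U (Phi k q t p) * V p) - square_integral (\<lambda>p. P (Phi k q t p) * Q p)) \<le> e"
    for q k t
    by (intro square_integral_diff_le key less_imp_le P Q C VB continuous_on_mult continuous_on_comp_Phi U V contP contQ)
  moreover have "norm (square_integral U * square_integral V - square_integral P * square_integral Q) \<le> e"
    by (intro key square_integral_diff_le square_integral_norm_le less_imp_le P Q C VB U V contP contQ)
  ultimately show "\<exists>P Q. asymp_mixing P Q \<and> (\<forall>q k t.
    norm (square_integral (\<lambda>p. U (Phi k q t p) * V p) - square_integral (\<lambda>p. P (Phi k q t p) * Q p)) \<le> e) \<and>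
    norm (square_integral U * square_integral V - square_integral P * square_integral Q) \<le> e"
    using asymp_mixing_trig_poly[OF P(1) Q(1)] by blast
qed

section \<open>Lebesgue measure on the torus\<close>

abbreviation "unit_square \<equiv> {0..<1} \<times> {0..<1} :: (real \<times> real) set"

lemma unit_square_lebesgue: "unit_square \<in> sets lebesgue"
proof -
  have "unit_square \<in> sets (borel \<Otimes>\<^sub>M borel)" by (intro pair_measureI) auto
  then have "unit_square \<in> sets borel" by (simp only: borel_prod)
  then show ?thesis by simp
qed

lemma torus_proj_rep [simp]: "torus_proj (torus_rep t) = t"
  by (rule Quotient3_abs_rep[OF Quotient3_torus])

lemma torus_periodic_rep_proj [simp]: "torus_periodic u \<Longrightarrow> u (torus_rep (torus_proj x)) = u x"
proof -
  assume u: "torus_periodic u"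
  have "lattice_rel (torus_rep (torus_proj x)) x"
    by (simp flip: torus.abs_eq_iff)
  then show ?thesis using u unfolding torus_periodic_def by blast
qed

lemma torus_proj_shift: "torus_proj (x + (of_int m, of_int n)) = torus_proj x"
  by (simp add: torus.abs_eq_iff lattice_rel_def)

lemma sets_torus_measure: "sets torus_measure = {B. torus_proj -` B \<in> sets lebesgue}"
  and space_torus_measure [simp]: "space torus_measure = UNIV"
proof -
  have "sigma_algebra UNIV {B. torus_proj -` B \<in> sets lebesgue}"
    unfolding sigma_algebra_iff2
    by (auto simp: vimage_UN vimage_Diff Compl_in_sets_lebesgue[of "torus_proj -` _"] Compl_eq_Diff_UNIV[symmetric] vimage_Compl)
  then show "sets torus_measure = {B. torus_proj -` B \<in> sets lebesgue}"
    by (simp add: torus_measure_def sigma_algebra.sigma_sets_eq)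
  show "space torus_measure = UNIV"
    by (simp add: torus_measure_def)
qed

lemma measurable_torus_proj:
  "torus_proj \<in> measurable (lebesgue_on unit_square) (sigma UNIV {B. torus_proj -` B \<in> sets lebesgue})"
proof (rule measurableI)
  fix A assume "A \<in> sets (sigma UNIV {B. torus_proj -` B \<in> sets lebesgue})"
  then have "torus_proj -` A \<in> sets lebesgue"
    using sets_torus_measure by (simp add: torus_measure_def)
  then show "torus_proj -` A \<inter> space (lebesgue_on unit_square) \<in> sets (lebesgue_on unit_square)"
    by (auto simp: sets_restrict_space Int_commute)
qed simp

lemma emeasure_torus_measure:
  assumes "B \<in> sets torus_measure"
  shows "emeasure torus_measure B = emeasure lebesgue (torus_proj -` B \<inter> unit_square)"
proof -
  have "emeasure torus_measure B = emeasure (lebesgue_on unit_square) (torus_proj -` B \<inter> unit_square)"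
    using assms emeasure_distr[OF measurable_torus_proj, of B] by (simp add: torus_measure_def)
  also have "\<dots> = emeasure lebesgue (torus_proj -` B \<inter> unit_square)"
    using unit_square_lebesgue by (intro emeasure_restrict_space) auto
  finally show ?thesis .
qed

lemma emeasure_unit_square: "emeasure lebesgue unit_square = 1"
proof -
  have "emeasure lebesgue unit_square = emeasure (lborel \<Otimes>\<^sub>M lborel) unit_square"
    using unit_square_lebesgue by (simp add: lborel_prod borel_prod[symmetric] pair_measureI)
  also have "\<dots> = 1"
    by (subst lborel.emeasure_pair_measure_Times) auto
  finally show ?thesis .
qed

interpretation torus: prob_space torus_measure
proof
  show "emeasure torus_measure (space torus_measure) = 1"
    using emeasure_torus_measure[of UNIV] emeasure_unit_square by (simp add: sets_torus_measure)
qed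

lemma borel_measurable_torusI:
  assumes "(\<lambda>x. g (torus_proj x)) \<in> borel_measurable lebesgue"
  shows "g \<in> borel_measurable torus_measure"
proof (rule measurableI)
  fix A :: "'a set" assume "A \<in> sets borel"
  from measurable_sets[OF assms this] have "torus_proj -` (g -` A) \<in> sets lebesgue"
    by (simp add: vimage_def)
  then show "g -` A \<inter> space torus_measure \<in> sets torus_measure"
    by (simp add: sets_torus_measure)
qed simp

lemma borel_measurable_torus_rep:
  fixes u :: "real \<times> real \<Rightarrow> 'a::real_normed_vector"
  assumes "continuous_on UNIV u" "torus_periodic u"
  shows "(\<lambda>t. u (torus_rep t)) \<in> borel_measurable torus_measure"
proof (rule borel_measurable_torusI)
  have "u \<in> measurable lborel borel"
    using borel_measurable_continuous_onI[OF assms(1)] by simp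
  then have "u \<in> borel_measurable lebesgue"
    by (rule measurable_completion)
  then show "(\<lambda>x. u (torus_rep (torus_proj x))) \<in> borel_measurable lebesgue"
    by (simp only: torus_periodic_rep_proj[OF assms(2)])
qed

text \<open>Passes from the Bochner integral on the quotient to the gauge integral over the closed
  square, where Fubini and the skew substitutions are available. The half-open and the closed square
  differ by a part of the frontier, a null set.\<close>

lemma integral_torus_rep:
  assumes u: "continuous_on UNIV u" "torus_periodic u"
  shows "(LINT t|torus_measure. u (torus_rep t)) = square_integral u"
proof -
  have "(LINT t|torus_measure. u (torus_rep t)) = (LINT x|lebesgue_on unit_square. u (torus_rep (torus_proj x)))"
    using borel_measurable_torus_rep[OF u] unfolding torus_measure_def
    by (intro integral_distr measurable_torus_proj) simp
  also have "\<dots> = (LINT x|lebesgue_on unit_square. u x)"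
    using u by simp
  also have "\<dots> = integral unit_square u"
  proof (rule lebesgue_integral_eq_integral)
    have "u absolutely_integrable_on cbox (0, 0) (1, 1)"
      using absolutely_integrable_continuous continuous_on_subset[OF u(1)] by blast
    then have "u absolutely_integrable_on unit_square"
      by (rule set_integrable_subset) (use unit_square_lebesgue in \<open>auto simp: cbox_Pair_eq\<close>)
    then show "integrable (lebesgue_on unit_square) u"
      using unit_square_lebesgue by (simp add: integrable_restrict_space set_integrable_def)
  qed (rule unit_square_lebesgue)
  also have "\<dots> = square_integral u"
    unfolding square_integral_def
  proof (rule integral_spike_set)
    have b: "box (0, 0) (1, 1) \<subseteq> unit_square" "unit_square \<subseteq> cbox (0, 0) (1, 1)"
      by (auto simp: cbox_Pair_eq mem_box Basis_prod_def)
    have "{x \<in> unit_square - cbox (0, 0) (1, 1). u x \<noteq> 0} = {}"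
      using b(2) by blast
    then show "negligible {x \<in> unit_square - cbox (0, 0) (1, 1). u x \<noteq> 0}"
      by (simp only: negligible_empty)
    show "negligible {x \<in> cbox (0, 0) (1, 1) - unit_square. u x \<noteq> 0}"
      by (rule negligible_subset[OF negligible_frontier_interval[of "(0, 0)" "(1, 1) :: real \<times> real"]])
        (use b(1) in blast)
  qed
  finally show ?thesis .
qed

section \<open>Approximation of measurable sets and invariance of the measure\<close>

lemma infdist_lattice_shift:
  fixes S :: "(real \<times> real) set"
  assumes "\<And>x m n. x \<in> S \<Longrightarrow> x + (of_int m, of_int n) \<in> S" and "S \<noteq> {}"
  shows "infdist (x + (of_int m, of_int n)) S = infdist x S"
proof -
  have le: "infdist (x + (of_int m, of_int n)) S \<le> infdist x S" for x and m n :: int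
    unfolding infdist_notempty[OF assms(2), of x]
  proof (rule cINF_greatest[OF assms(2)])
    fix a assume "a \<in> S"
    then have "infdist (x + (of_int m, of_int n)) S \<le> dist (x + (of_int m, of_int n)) (a + (of_int m, of_int n))"
      by (intro infdist_le assms)
    then show "infdist (x + (of_int m, of_int n)) S \<le> dist x a" by (simp add: dist_norm)
  qed
  have "infdist (x + (of_int m, of_int n) + (of_int (- m), of_int (- n))) S \<le> infdist (x + (of_int m, of_int n)) S"
    by (rule le)
  then show ?thesis using le[of x m n] by (simp add: add.assoc zero_prod_def[symmetric])
qed

text \<open>Urysohn functions with slope \<open>j\<close> in the distance to the full preimage. The
  preimage is invariant under the lattice, so the distance, and with it each function, is
  periodic.\<close>

lemma closed_torus_set_approx:
  assumes D: "closed (torus_proj -` D)"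
  obtains u :: "nat \<Rightarrow> real \<times> real \<Rightarrow> complex"
  where "\<And>j. continuous_on UNIV (u j)" "\<And>j. torus_periodic (u j)" "\<And>j x. norm (u j x) \<le> 1"
    "\<And>x. (\<lambda>j. u j x) \<longlonglongrightarrow> indicator (torus_proj -` D) x"
proof (cases "D = {}")
  \<comment> \<open>Treated apart, since \<open>infdist\<close> to the empty set is 0 and the
    formula used below would give the constant 1.\<close>
  case True
  then show ?thesis by (intro that[of "\<lambda>_ _. 0"]) (auto simp: torus_periodic_def)
next
  case False
  let ?S = "torus_proj -` D"
  have S: "?S \<noteq> {}"
    using False by (metis ex_in_conv torus_proj_rep vimage_eq)
  define u where "u = (\<lambda>(j::nat) x. complex_of_real (max 0 (1 - real j * infdist x ?S)))"
  show ?thesis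
  proof (rule that[of u])
    show "continuous_on UNIV (u j)" for j
      unfolding u_def by (intro continuous_intros)
    show "torus_periodic (u j)" for j
      unfolding u_def
      by (intro torus_periodicI) (subst infdist_lattice_shift[OF _ S], simp_all add: torus_proj_shift)
    show "norm (u j x) \<le> 1" for j x
      unfolding u_def norm_of_real by (simp add: infdist_nonneg)
    show "(\<lambda>j. u j x) \<longlonglongrightarrow> indicator ?S x" for x
    proof (cases "x \<in> ?S")
      case True
      then show ?thesis by (simp add: u_def)
    next
      case False
      then have d: "infdist x ?S > 0"
        using infdist_pos_not_in_closed[OF D S] by simp
      then obtain N :: nat where N: "real N * infdist x ?S > 1"
        using reals_Archimedean3 by blast
      have "u j x = 0" if "j \<ge> N" for j
      proof -
        have "real N * infdist x ?S \<le> real j * infdist x ?S"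
          using that d by (intro mult_right_mono) auto
        then show ?thesis using N by (simp add: u_def)
      qed
      then have "\<forall>\<^sub>F j in sequentially. u j x = 0"
        by (auto simp: eventually_sequentially)
      then have "(\<lambda>j. u j x) \<longlonglongrightarrow> 0" by (rule tendsto_eventually)
      then show ?thesis using False by simp
    qed
  qed
qed

text \<open>A closed set \<open>T\<close> inside the unit square is compact, so the union of its
  lattice translates is closed. This union is the full preimage of the image \<open>D\<close> of
  \<open>T\<close>.\<close>

lemma torus_inner_closed:
  assumes B: "B \<in> sets torus_measure" and e: "e > 0"
  obtains D where "D \<subseteq> B" "closed (torus_proj -` D)" "measure torus_measure (B - D) < e"
proof -
  let ?S = "torus_proj -` B \<inter> unit_square"
  have S: "?S \<in> sets lebesgue"
    using B unit_square_lebesgue by (auto simp: sets_torus_measure)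
  obtain T where T: "closed T" "T \<subseteq> ?S" "?S - T \<in> lmeasurable" "emeasure lebesgue (?S - T) < ennreal e"
    using sets_lebesgue_inner_closed[OF S e] by blast
  define D where "D = torus_proj ` T"
  have D: "torus_proj -` D = (\<Union>x\<in>T. \<Union>y\<in>\<int> \<times> \<int>. {x + y})"
  proof (intro equalityI subsetI)
    fix x assume "x \<in> torus_proj -` D"
    then obtain y where y: "y \<in> T" "lattice_rel x y"
      by (auto simp: D_def torus.abs_eq_iff)
    then obtain m n :: int where "x = y + (of_int m, of_int n)" using lattice_relE by blast
    with y(1) show "x \<in> (\<Union>x\<in>T. \<Union>y\<in>\<int> \<times> \<int>. {x + y})"
      by (intro UN_I[of y] UN_I[of "(of_int m, of_int n)"]) auto
  next
    fix x assume "x \<in> (\<Union>x\<in>T. \<Union>y\<in>\<int> \<times> \<int>. {x + y})"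
    then obtain y a b where "y \<in> T" "x = y + (a, b)" "a \<in> \<int>" "b \<in> \<int>" by auto
    then show "x \<in> torus_proj -` D"
      by (auto simp: D_def torus_proj_shift elim!: Ints_cases)
  qed
  have "bounded T"
  proof (rule bounded_subset[OF bounded_cbox])
    show "T \<subseteq> cbox (0, 0) (1, 1)" using T(2) by (auto simp: cbox_Pair_eq)
  qed
  then have "closed (torus_proj -` D)"
    unfolding D using T(1) by (intro compact_closed_sums closed_Times) (auto simp: compact_eq_bounded_closed)
  moreover have "D \<subseteq> B" using T(2) by (auto simp: D_def)
  moreover have "measure torus_measure (B - D) < e"
  proof -
    have "B - D \<in> sets torus_measure"
      using B \<open>closed (torus_proj -` D)\<close> by (auto simp: sets_torus_measure vimage_Diff)
    from emeasure_torus_measure[OF this]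
    have "emeasure torus_measure (B - D) \<le> emeasure lebesgue (?S - T)"
      using S T(1) by (auto simp: D_def intro!: emeasure_mono)
    then have "emeasure torus_measure (B - D) < ennreal e" using T(4) by simp
    then show ?thesis
      using e by (simp add: torus.emeasure_eq_measure ennreal_less_iff)
  qed
  ultimately show ?thesis using that by blast
qed

lemma measurable_torus_if_lift:
  assumes "is_lift F f" and F: "\<And>S. S \<in> sets lebesgue \<Longrightarrow> F -` S \<in> sets lebesgue"
  shows "f \<in> measurable torus_measure torus_measure"
proof (rule measurableI)
  fix A assume "A \<in> sets torus_measure"
  then have "F -` (torus_proj -` A) \<in> sets lebesgue"
    by (intro F) (simp add: sets_torus_measure)
  moreover have "torus_proj -` (f -` A) = F -` (torus_proj -` A)"
    using assms(1) by (auto simp: is_lift_def)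
  ultimately show "f -` A \<inter> space torus_measure \<in> sets torus_measure"
    by (simp add: sets_torus_measure)
qed simp

lemma is_lift_lattice_rel: "is_lift F f \<Longrightarrow> lattice_rel x y \<Longrightarrow> lattice_rel (F x) (F y)"
  unfolding is_lift_def by (metis torus.abs_eq_iff)

lemma torus_rep_lift:
  "is_lift F f \<Longrightarrow> torus_periodic u \<Longrightarrow> u (torus_rep (f t)) = u (F (torus_rep t))"
  unfolding is_lift_def by (metis torus_periodic_rep_proj torus_proj_rep)

lemma measure_closed_torus_set:
  assumes D: "closed (torus_proj -` D)" "D \<in> sets torus_measure"
    and u: "\<And>j. continuous_on UNIV (u j)" "\<And>j. torus_periodic (u j)" "\<And>j x. norm (u j x) \<le> 1"
      "\<And>x. (\<lambda>j. u j x) \<longlonglongrightarrow> (indicator (torus_proj -` D) x :: complex)"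
  shows "(\<lambda>j. LINT t|torus_measure. norm (indicator D t - u j (torus_rep t))) \<longlonglongrightarrow> 0"
    "(\<lambda>j. square_integral (u j)) \<longlonglongrightarrow> of_real (measure torus_measure D)"
proof -
  have lim: "(\<lambda>j. u j (torus_rep t)) \<longlonglongrightarrow> indicator D t" for t
    using u(4)[of "torus_rep t"] by (simp add: indicator_def)
  have m [measurable]: "(\<lambda>t. u j (torus_rep t)) \<in> borel_measurable torus_measure" for j
    using u by (intro borel_measurable_torus_rep)
  have D' [measurable]: "D \<in> sets torus_measure" by fact
  have "(\<lambda>j. LINT t|torus_measure. u j (torus_rep t)) \<longlonglongrightarrow> (LINT t|torus_measure. indicator D t)"
    by (rule integral_dominated_convergence[where w = "\<lambda>_. 1"]) (use lim u(3) in auto)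
  moreover have "(LINT t|torus_measure. indicator D t) = complex_of_real (measure torus_measure D)"
  proof -
    have "(indicator D t :: complex) = of_real (indicator D t)" for t
      by (simp add: indicator_def)
    then show ?thesis
      using D' by simp
  qed
  ultimately show "(\<lambda>j. square_integral (u j)) \<longlonglongrightarrow> of_real (measure torus_measure D)"
    using u by (simp add: integral_torus_rep)
  have "(\<lambda>j. LINT t|torus_measure. norm (indicator D t - u j (torus_rep t))) \<longlonglongrightarrow> (LINT t|torus_measure. 0)"
  proof (rule integral_dominated_convergence[where w = "\<lambda>_. 2"])
    have "(\<lambda>j. norm (indicator D t - u j (torus_rep t))) \<longlonglongrightarrow> norm (indicator D t - indicator D t :: complex)" for t
      by (intro tendsto_intros lim)
    then show "AE t in torus_measure. (\<lambda>j. norm (indicator D t - u j (torus_rep t))) \<longlonglongrightarrow> 0" by simp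
    have "norm (indicator D t - u j (torus_rep t)) \<le> 1 + 1" for j t
      by (rule order_trans[OF norm_triangle_ineq4 add_mono]) (auto simp: u indicator_def)
    then show "AE t in torus_measure. norm (norm (indicator D t - u j (torus_rep t))) \<le> 2" for j by simp
  qed auto
  then show "(\<lambda>j. LINT t|torus_measure. norm (indicator D t - u j (torus_rep t))) \<longlonglongrightarrow> 0" by simp
qed

lemma closed_torus_set_measurable: "closed (torus_proj -` D) \<Longrightarrow> D \<in> sets torus_measure"
  by (simp add: sets_torus_measure)

text \<open>Invariance of the integrals of continuous functions passes to closed sets by
  approximation of indicators. Inner regularity then bounds the measure of a set by that of its
  preimage, and complements give the reverse inequality. The condition on Lebesgue sets is stated
  separately since a continuous preimage of a Lebesgue set need not be Lebesgue measurable.\<close>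

proposition measure_preserving_torus:
  assumes lift: "is_lift F f" and cont: "continuous_on UNIV F"
    and leb: "\<And>S. S \<in> sets lebesgue \<Longrightarrow> F -` S \<in> sets lebesgue"
    and int: "\<And>u. continuous_on UNIV u \<Longrightarrow> torus_periodic u \<Longrightarrow> square_integral (\<lambda>x. u (F x)) = square_integral u"
  shows "measure_preserving torus_measure f"
proof -
  have f [measurable]: "f \<in> measurable torus_measure torus_measure"
    using lift leb by (rule measurable_torus_if_lift)
  have vim: "f -` A \<in> sets torus_measure" if "A \<in> sets torus_measure" for A
    using measurable_sets[OF f that] by simp
  have closed: "measure torus_measure (f -` D) = measure torus_measure D" if D: "closed (torus_proj -` D)" for D
  proof -
    obtain u where u: "\<And>j. continuous_on UNIV (u j)" "\<And>j. torus_periodic (u j)" "\<And>j x. norm (u j x) \<le> 1"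
      "\<And>x. (\<lambda>j. u j x) \<longlonglongrightarrow> (indicator (torus_proj -` D) x :: complex)"
      using closed_torus_set_approx[OF D] by blast
    have vD: "torus_proj -` (f -` D) = F -` (torus_proj -` D)"
      using lift by (auto simp: is_lift_def)
    have cD: "closed (torus_proj -` (f -` D))"
      unfolding vD using D cont by (rule closed_vimage)
    have "(\<lambda>j. square_integral (\<lambda>x. u j (F x))) \<longlonglongrightarrow> of_real (measure torus_measure (f -` D))"
    proof (rule measure_closed_torus_set(2)[OF cD closed_torus_set_measurable[OF cD]])
      show "continuous_on UNIV (\<lambda>x. u j (F x))" for j
        using continuous_on_compose2[OF u(1) cont] by simp
      show "torus_periodic (\<lambda>x. u j (F x))" for j
        using u(2) is_lift_lattice_rel[OF lift] by (rule torus_periodic_comp)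
      show "norm (u j (F x)) \<le> 1" for j x by (rule u)
      show "(\<lambda>j. u j (F x)) \<longlonglongrightarrow> indicator (torus_proj -` (f -` D)) x" for x
        using u(4)[of "F x"] by (simp add: vD indicator_def)
    qed
    moreover have "(\<lambda>j. square_integral (u j)) \<longlonglongrightarrow> of_real (measure torus_measure D)"
      using D closed_torus_set_measurable[OF D] u by (rule measure_closed_torus_set(2))
    ultimately have "complex_of_real (measure torus_measure (f -` D)) = of_real (measure torus_measure D)"
      using int[OF u(1,2)] LIMSEQ_unique[of "\<lambda>j. square_integral (u j)"
          "complex_of_real (measure torus_measure (f -` D))" "complex_of_real (measure torus_measure D)"]
      by simp
    then show ?thesis by (simp only: of_real_eq_iff)
  qed
  have le: "measure torus_measure B \<le> measure torus_measure (f -` B)" if B: "B \<in> sets torus_measure" for B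
  proof (rule field_le_epsilon)
    fix e :: real assume "e > 0"
    then obtain D where D: "D \<subseteq> B" "closed (torus_proj -` D)" "measure torus_measure (B - D) < e"
      using torus_inner_closed[OF B] by blast
    have Dm: "D \<in> sets torus_measure" using D(2) by (rule closed_torus_set_measurable)
    have "measure torus_measure B = measure torus_measure D + measure torus_measure (B - D)"
      using torus.finite_measure_Diff[OF B Dm D(1)] by simp
    also have "measure torus_measure D = measure torus_measure (f -` D)"
      using closed[OF D(2)] by simp
    also have "\<dots> \<le> measure torus_measure (f -` B)"
      using D(1) vim[OF B] by (intro torus.finite_measure_mono) auto
    finally show "measure torus_measure B \<le> measure torus_measure (f -` B) + e" using D(3) by simp
  qed
  have "measure torus_measure B = measure torus_measure (f -` B)" if B: "B \<in> sets torus_measure" for B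
  proof (rule antisym[OF le[OF B]])
    have "measure torus_measure (UNIV - B) \<le> measure torus_measure (f -` (UNIV - B))"
      using sets.compl_sets[OF B] by (intro le) simp
    then show "measure torus_measure (f -` B) \<le> measure torus_measure B"
      using torus.prob_compl[OF B] torus.prob_compl[OF vim[OF B]] by (simp add: vimage_Diff)
  qed
  then have "emeasure (distr torus_measure torus_measure f) B = emeasure torus_measure B"
    if "B \<in> sets torus_measure" for B
    using that f by (simp add: emeasure_distr torus.emeasure_eq_measure)
  then have "distr torus_measure torus_measure f = torus_measure"
    by (intro measure_eqI) auto
  then show ?thesis using f by (simp add: measure_preserving_def)
qed

lemma integrable_torus_rep:
  fixes u :: "real \<times> real \<Rightarrow> complex"
  assumes "continuous_on UNIV u" "torus_periodic u" "\<And>x. norm (u x) \<le> B"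
  shows "integrable torus_measure (\<lambda>t. u (torus_rep t))"
  by (rule torus.integrable_const_bound[of _ B]) (use assms borel_measurable_torus_rep in auto)

lemma bounded_torus_periodic:
  fixes u :: "real \<times> real \<Rightarrow> complex"
  assumes "continuous_on UNIV u" "torus_periodic u"
  obtains B where "B > 0" "\<And>x. norm (u x) \<le> B"
proof -
  obtain P where P: "P \<in> trig_poly" "\<And>p. norm (u p - P p) < 1"
    using trig_poly_dense[OF assms, of 1] by auto
  obtain B where B: "B > 0" "\<And>p. norm (P p) \<le> B"
    using bounded_trig_poly[OF P(1)] by auto
  have "norm (u p) \<le> 1 + B" for p
    using norm_triangle_mono[OF less_imp_le[OF P(2)[of p]] B(2)[of p]] by simp
  then show ?thesis using B(1) by (intro that[of "1 + B"]) auto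
qed

lemma integrable_trig_poly:
  assumes "P \<in> trig_poly"
  shows "integrable torus_measure (\<lambda>t. P (torus_rep t))"
  using bounded_trig_poly[OF assms]
    integrable_torus_rep[OF continuous_trig_poly[OF assms] torus_periodic_trig_poly[OF assms]] by blast

text \<open>Integrable functions arise from indicators by sums and dominated limits. An indicator is
  replaced by that of a closed subset \<open>D\<close>, this by a continuous periodic function, and
  this by a trigonometric polynomial.\<close>

lemma trig_poly_dense_L1:
  fixes h :: "torus \<Rightarrow> complex"
  assumes "integrable torus_measure h" "e > 0"
  shows "\<exists>P\<in>trig_poly. (LINT t|torus_measure. norm (h t - P (torus_rep t))) < e"
proof -
  have "\<forall>e>0. \<exists>P\<in>trig_poly. (LINT t|torus_measure. norm (h t - P (torus_rep t))) < e"
    using assms(1)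
  proof (induction rule: integrable_induct)
    case (base A c)
    show ?case
    proof (intro allI impI)
      fix e :: real assume e: "e > 0"
      \<comment> \<open>Each of the three replacements costs \<open>d\<close>, multiplied by
        \<open>norm c\<close>. The added 1 covers \<open>c = 0\<close> and makes the final
        inequality strict.\<close>
      define d where "d = e / 3 / (norm c + 1)"
      have c1: "norm c + 1 > 0" by (simp add: add_nonneg_pos)
      have d: "d > 0" using e c1 by (simp add: d_def)
      obtain D where D: "D \<subseteq> A" "closed (torus_proj -` D)" "measure torus_measure (A - D) < d"
        using torus_inner_closed[OF base(1) d] by blast
      have Dm: "D \<in> sets torus_measure" using D(2) by (rule closed_torus_set_measurable)
      obtain u where u: "\<And>j. continuous_on UNIV (u j)" "\<And>j. torus_periodic (u j)" "\<And>j x. norm (u j x) \<le> 1"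
        "\<And>x. (\<lambda>j. u j x) \<longlonglongrightarrow> (indicator (torus_proj -` D) x :: complex)"
        using closed_torus_set_approx[OF D(2)] by blast
      have "(\<lambda>j. LINT t|torus_measure. norm (indicator D t - u j (torus_rep t))) \<longlonglongrightarrow> 0"
        using D(2) Dm u by (rule measure_closed_torus_set(1))
      then have "\<forall>\<^sub>F j in sequentially. (LINT t|torus_measure. norm (indicator D t - u j (torus_rep t))) < d"
        using d by (rule order_tendstoD)
      then obtain j where j: "(LINT t|torus_measure. norm (indicator D t - u j (torus_rep t))) < d"
        by (auto simp: eventually_sequentially)
      obtain P where P: "P \<in> trig_poly" "\<And>p. norm (u j p - P p) < d"
        using trig_poly_dense[OF u(1,2) d] by blast
      have intu: "integrable torus_measure (\<lambda>t. u j (torus_rep t))"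
        by (rule integrable_torus_rep[OF u(1-3)])
      have intI: "integrable torus_measure (indicator B :: _ \<Rightarrow> real)" "integrable torus_measure (indicator B :: _ \<Rightarrow> complex)"
        if "B \<in> sets torus_measure" for B
        using that by (auto intro!: torus.integrable_const_bound[of _ 1] borel_measurable_indicator simp: indicator_def)
      have intn: "integrable torus_measure (\<lambda>t. norm (indicator D t - u j (torus_rep t)))"
        using intu intI(2)[OF Dm] by auto
      have "(LINT t|torus_measure. norm (indicator A t *\<^sub>R c - c * P (torus_rep t))) \<le>
        (LINT t|torus_measure. norm c * (indicator (A - D) t + norm (indicator D t - u j (torus_rep t)) + d))"
      proof (rule integral_mono)
        show "integrable torus_measure (\<lambda>t. norm (indicator A t *\<^sub>R c - c * P (torus_rep t)))"
          using integrable_trig_poly[OF P(1)] intI(1)[OF base(1)] by auto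
        show "integrable torus_measure (\<lambda>t. norm c * (indicator (A - D) t + norm (indicator D t - u j (torus_rep t)) + d))"
          using intn intI(1)[of "A - D"] base(1) Dm by auto
        fix t
        have "indicator A t = (indicator (A - D) t + indicator D t :: complex)"
          using D(1) by (auto simp: indicator_def)
        then have "indicator A t *\<^sub>R c - c * P (torus_rep t) = c * (indicator (A - D) t + (indicator D t - u j (torus_rep t))
            + (u j (torus_rep t) - P (torus_rep t)))"
          by (auto simp: indicator_def algebra_simps split: if_splits)
        moreover have "norm (indicator (A - D) t + (indicator D t - u j (torus_rep t)) + (u j (torus_rep t) - P (torus_rep t)))
            \<le> indicator (A - D) t + norm (indicator D t - u j (torus_rep t)) + d"
          using P(2) by (intro norm_triangle_mono) (auto simp: indicator_def less_imp_le)
        ultimately show "norm (indicator A t *\<^sub>R c - c * P (torus_rep t)) \<le>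
            norm c * (indicator (A - D) t + norm (indicator D t - u j (torus_rep t)) + d)"
          by (simp only: norm_mult) (rule mult_left_mono, auto)
      qed
      also have "\<dots> = norm c * (measure torus_measure (A - D) +
          (LINT t|torus_measure. norm (indicator D t - u j (torus_rep t))) + d)"
      proof -
        have "A - D \<in> sets torus_measure" using base(1) Dm by auto
        then show ?thesis using intn intI(1)[of "A - D"] torus.prob_space by simp
      qed
      also have "\<dots> \<le> norm c * (3 * d)"
        using j D(3) by (intro mult_left_mono) auto
      also have "\<dots> < (norm c + 1) * (3 * d)"
        using d by (intro mult_strict_right_mono) auto
      also have "\<dots> = 3 * (d * (norm c + 1))" by simp
      also have "d * (norm c + 1) = e / 3"
        using nonzero_eq_divide_eq[of "norm c + 1" d "e / 3"] c1 d_def by (metis less_irrefl)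
      finally have "(LINT t|torus_measure. norm (indicator A t *\<^sub>R c - c * P (torus_rep t))) < e"
        by simp
      then show "\<exists>P\<in>trig_poly. (LINT t|torus_measure. norm (indicator A t *\<^sub>R c - P (torus_rep t))) < e"
        using trig_poly_cmult[OF P(1), of c] by (intro bexI[of _ "\<lambda>p. c * P p"])
    qed
  next
    case (add f g)
    show ?case
    proof (intro allI impI)
      fix e :: real assume e: "e > 0"
      obtain P where P: "P \<in> trig_poly" "(LINT t|torus_measure. norm (f t - P (torus_rep t))) < e / 2"
        using add.IH(1) e half_gt_zero by blast
      obtain Q where Q: "Q \<in> trig_poly" "(LINT t|torus_measure. norm (g t - Q (torus_rep t))) < e / 2"
        using add.IH(2) e half_gt_zero by blast
      note int = add.hyps integrable_trig_poly[OF P(1)] integrable_trig_poly[OF Q(1)]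
      have "(LINT t|torus_measure. norm (f t + g t - (P (torus_rep t) + Q (torus_rep t)))) \<le>
          (LINT t|torus_measure. norm (f t - P (torus_rep t)) + norm (g t - Q (torus_rep t)))"
        using int by (intro integral_mono)
          (auto intro!: Bochner_Integration.integrable_add Bochner_Integration.integrable_diff integrable_norm
            simp: add_diff_add norm_triangle_ineq)
      also have "\<dots> = (LINT t|torus_measure. norm (f t - P (torus_rep t))) + (LINT t|torus_measure. norm (g t - Q (torus_rep t)))"
        using int by (intro Bochner_Integration.integral_add) auto
      finally show "\<exists>P\<in>trig_poly. (LINT t|torus_measure. norm (f t + g t - P (torus_rep t))) < e"
        using P Q trig_poly.add[OF P(1) Q(1)] by (intro bexI[of _ "\<lambda>p. P p + Q p"]) auto
    qed
  next
    case (lim f s)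
    have "(\<lambda>i. LINT t|torus_measure. norm (f t - s i t)) \<longlonglongrightarrow> (LINT t|torus_measure. 0)"
    \<comment> \<open>The induction rule provides \<open>norm (s i t) \<le> 2 * norm (f t)\<close>,
      hence the factor 3.\<close>
    proof (rule integral_dominated_convergence[where w = "\<lambda>t. 3 * norm (f t)"])
      have "(\<lambda>i. norm (f t - s i t)) \<longlonglongrightarrow> norm (f t - f t)" for t
        using lim.hyps by (intro tendsto_intros) auto
      then show "AE t in torus_measure. (\<lambda>i. norm (f t - s i t)) \<longlonglongrightarrow> 0" by simp
      have "norm (f t - s i t) \<le> norm (f t) + 2 * norm (f t)" for i t
        by (rule order_trans[OF norm_triangle_ineq4 add_mono]) (use lim.hyps in auto)
      then show "AE t in torus_measure. norm (norm (f t - s i t)) \<le> 3 * norm (f t)" for i by simp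
    qed (use lim.hyps in auto)
    then have L: "(\<lambda>i. LINT t|torus_measure. norm (f t - s i t)) \<longlonglongrightarrow> 0" by simp
    show ?case
    proof (intro allI impI)
      fix e :: real assume e: "e > 0"
      have "\<forall>\<^sub>F i in sequentially. (LINT t|torus_measure. norm (f t - s i t)) < e / 2"
        by (intro order_tendstoD(2)[OF L]) (use e in simp)
      then obtain i where i: "(LINT t|torus_measure. norm (f t - s i t)) < e / 2"
        by (auto simp: eventually_sequentially)
      obtain P where P: "P \<in> trig_poly" "(LINT t|torus_measure. norm (s i t - P (torus_rep t))) < e / 2"
        using lim.IH e half_gt_zero by blast
      have int: "integrable torus_measure f" "integrable torus_measure (s i)" "integrable torus_measure (\<lambda>t. P (torus_rep t))"
        using lim.hyps integrable_trig_poly[OF P(1)] by auto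
      have "(LINT t|torus_measure. norm (f t - P (torus_rep t))) \<le>
          (LINT t|torus_measure. norm (f t - s i t) + norm (s i t - P (torus_rep t)))"
      proof (rule integral_mono)
        show "norm (f t - P (torus_rep t)) \<le> norm (f t - s i t) + norm (s i t - P (torus_rep t))" for t
          using norm_triangle_ineq[of "f t - s i t" "s i t - P (torus_rep t)"] by simp
      qed (use int in auto)
      also have "\<dots> = (LINT t|torus_measure. norm (f t - s i t)) + (LINT t|torus_measure. norm (s i t - P (torus_rep t)))"
        using int by (intro Bochner_Integration.integral_add) auto
      finally show "\<exists>P\<in>trig_poly. (LINT t|torus_measure. norm (f t - P (torus_rep t))) < e"
        using P(1) P(2) i by (intro bexI[of _ P]) auto
    qed
  qed
  then show ?thesis using assms(2) by blast
qed

section \<open>A criterion for weak mixing\<close>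

lemma measure_preserving_AE:
  assumes "measure_preserving M f" "AE x in M. P x"
  shows "AE x in M. P (f x)"
  using assms AE_distrD[of f M M P] unfolding measure_preserving_def by metis

lemma measure_preserving_integral:
  fixes g :: "'a \<Rightarrow> 'b::{banach, second_countable_topology}"
  assumes "measure_preserving M f" "g \<in> borel_measurable M"
  shows "(LINT x|M. g (f x)) = (LINT x|M. g x)"
  using integral_distr[of f M M g] assms by (simp add: measure_preserving_def)

lemma measure_preserving_funpow:
  assumes "measure_preserving M f"
  shows "measure_preserving M (f ^^ n)"
proof (induction n)
  case 0
  then show ?case by (simp add: measure_preserving_def id_def distr_id)
next
  case (Suc n)
  have "f \<in> measurable M M" "distr M M f = M" "f ^^ n \<in> measurable M M" "distr M M (f ^^ n) = M"
    using assms Suc by (auto simp: measure_preserving_def)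
  then show ?case
    using distr_distr[of f M M "f ^^ n" M] measurable_comp[of "f ^^ n" M M f M]
    by (simp add: measure_preserving_def o_def)
qed

text \<open>
  Unless \<open>\<bar>l\<bar> = 1\<close>, the function \<open>\<bar>h\<bar> / (1 + \<bar>h\<bar>)\<close> moves strictly in one direction wherever \<open>h\<close> is
  nonzero, whereas its integral is invariant.
\<close>

lemma (in finite_measure) eigenfunction_modulus:
  fixes h :: "'a \<Rightarrow> complex"
  assumes f: "measure_preserving M f" and h [measurable]: "h \<in> borel_measurable M"
    and eig: "AE x in M. h (f x) = l * h x" and l: "norm l \<noteq> 1"
  shows "AE x in M. h x = 0"
proof -
  have fm [measurable]: "f \<in> measurable M M" using f by (simp add: measure_preserving_def)
  define s where "s = (\<lambda>z :: complex. norm z / (1 + norm z))"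
  have pos: "1 + norm z > 0" for z :: complex by (simp add: add_pos_nonneg)
  have s01: "0 \<le> s z" "s z \<le> 1" for z
    using pos[of z] by (auto simp: s_def divide_le_eq)
  have [measurable]: "s \<in> borel_measurable borel" unfolding s_def by measurable
  have int: "integrable M (\<lambda>x. s (h x))" "integrable M (\<lambda>x. s (h (f x)))"
    using s01 by (auto intro!: integrable_const_bound[of _ 1])
  have "(LINT x|M. s (h (f x))) = (LINT x|M. s (h x))"
    using f by (intro measure_preserving_integral[of M f "\<lambda>x. s (h x)"]) measurable
  then have zero: "(LINT x|M. s (h (f x)) - s (h x)) = 0" "(LINT x|M. s (h x) - s (h (f x))) = 0"
    using int by auto
  have mono: "s z \<le> s w \<longleftrightarrow> norm z \<le> norm w" for z w
    unfolding s_def using pos[of z] pos[of w] by (simp add: field_simps)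
  have "AE x in M. s (h (f x)) = s (h x)"
  proof (cases "norm l < 1")
    case True
    have "AE x in M. 0 \<le> s (h x) - s (h (f x))"
      using eig
    proof eventually_elim
      case (elim x)
      have "norm l * norm (h x) \<le> 1 * norm (h x)" using True by (intro mult_right_mono) auto
      then show ?case using mono[of "h (f x)" "h x"] elim by (simp add: norm_mult)
    qed
    then have "AE x in M. s (h x) - s (h (f x)) = 0"
      using integral_nonneg_eq_0_iff_AE[of M "\<lambda>x. s (h x) - s (h (f x))"] int zero(2) by auto
    then show ?thesis by eventually_elim simp
  next
    case False
    have "AE x in M. 0 \<le> s (h (f x)) - s (h x)"
      using eig
    proof eventually_elim
      case (elim x)
      have "1 * norm (h x) \<le> norm l * norm (h x)" using False by (intro mult_right_mono) auto
      then show ?case using mono[of "h x" "h (f x)"] elim by (simp add: norm_mult)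
    qed
    then have "AE x in M. s (h (f x)) - s (h x) = 0"
      using integral_nonneg_eq_0_iff_AE[of M "\<lambda>x. s (h (f x)) - s (h x)"] int zero(1) by auto
    then show ?thesis by eventually_elim simp
  qed
  then show ?thesis
    using eig
  proof eventually_elim
    case (elim x)
    then have "norm (l * h x) = norm (h x)"
      using mono[of "h (f x)" "h x"] mono[of "h x" "h (f x)"] by simp
    then show ?case using l by (simp add: norm_mult)
  qed
qed

lemma norm_integral_diff_mult_le:
  fixes g h k :: "torus \<Rightarrow> complex"
  assumes "integrable torus_measure g" "integrable torus_measure h"
    and k: "k \<in> borel_measurable torus_measure" "\<And>t. norm (k t) \<le> 1"
  shows "norm ((LINT t|torus_measure. g t * k t) - (LINT t|torus_measure. h t * k t))
    \<le> (LINT t|torus_measure. norm (g t - h t))"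
proof -
  have int: "integrable torus_measure (\<lambda>t. g t * k t)" if "integrable torus_measure g" for g
    using that
  proof (rule Bochner_Integration.integrable_bound)
    show "AE t in torus_measure. norm (g t * k t) \<le> norm (g t)"
      using k(2) by (simp add: norm_mult mult_left_le)
  qed (use that k in auto)
  have "norm ((LINT t|torus_measure. g t * k t) - (LINT t|torus_measure. h t * k t)) =
      norm (LINT t|torus_measure. g t * k t - h t * k t)"
    using int assms by simp
  also have "\<dots> \<le> (LINT t|torus_measure. norm (g t * k t - h t * k t))"
    by (rule integral_norm_bound)
  also have "\<dots> \<le> (LINT t|torus_measure. norm (g t - h t))"
  proof (rule integral_mono)
    show "norm (g t * k t - h t * k t) \<le> norm (g t - h t)" for t
      using mult_left_le[OF k(2)[of t] norm_ge_zero[of "g t - h t"]]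
      by (simp add: norm_mult flip: left_diff_distrib)
  qed (use int assms in auto)
  finally show ?thesis .
qed

text \<open>For an eigenfunction \<open>k\<close> with eigenvalue of modulus 1, the correlation of
  \<open>k \<circ> f ^^ m n\<close> with a character is \<open>l ^ m n\<close> times a Fourier
  coefficient of \<open>k\<close>. Its modulus does not depend on \<open>n\<close>, so decay along a
  single sequence of times forces the coefficient to vanish. For other moduli,
  \<open>eigenfunction_modulus\<close> makes \<open>h\<close> vanish almost everywhere.\<close>

proposition weak_mixing_torus:
  assumes f: "measure_preserving torus_measure f"
    and mix: "\<And>a b c d. (\<lambda>n. LINT t|torus_measure. torus_char a b (torus_rep ((f ^^ m n) t)) * torus_char c d (torus_rep t))
      \<longlonglongrightarrow> square_integral (torus_char a b) * square_integral (torus_char c d)"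
  shows "weak_mixing torus_measure f"
proof -
  have char_m [measurable]: "(\<lambda>t. torus_char c d (torus_rep t)) \<in> borel_measurable torus_measure" for c d
    by (intro borel_measurable_torus_rep continuous_torus_char torus_periodic_torus_char)
  have P_m: "(\<lambda>t. P (torus_rep t)) \<in> borel_measurable torus_measure" if "P \<in> trig_poly" for P
    using that by (intro borel_measurable_torus_rep continuous_trig_poly torus_periodic_trig_poly)
  have fn [measurable]: "(f ^^ n) \<in> measurable torus_measure torus_measure" for n
    using measure_preserving_funpow[OF f, of n] by (simp add: measure_preserving_def)
  have intPf: "integrable torus_measure (\<lambda>t. P (torus_rep ((f ^^ n) t)) * torus_char c d (torus_rep t))"
    if P: "P \<in> trig_poly" for P n c d
  proof -
    obtain B where B: "\<And>p. norm (P p) \<le> B" using bounded_trig_poly[OF P] by blast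
    have "(\<lambda>t. P (torus_rep ((f ^^ n) t))) \<in> borel_measurable torus_measure"
      using measurable_compose[OF fn P_m[OF P]] .
    then show ?thesis
      using B by (intro torus.integrable_const_bound[of _ B]) (auto simp: norm_mult)
  qed
  have mixP: "(\<lambda>n. LINT t|torus_measure. P (torus_rep ((f ^^ m n) t)) * torus_char c d (torus_rep t))
      \<longlonglongrightarrow> square_integral P * square_integral (torus_char c d)" if "P \<in> trig_poly" for P c d
    using that
  proof (induction rule: trig_poly.induct)
    case (char z a b)
    show ?case
      using tendsto_mult_left[OF mix[of a b c d], of z] by (simp add: square_integral_cmult mult.assoc)
  next
    case (add g h)
    have "square_integral (\<lambda>p. g p + h p) = square_integral g + square_integral h"
      using add.hyps by (intro square_integral_add continuous_trig_poly)
    then show ?case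
      using tendsto_add[OF add.IH] intPf add.hyps by (simp add: distrib_right)
  qed
  have "\<exists>c. AE t in torus_measure. h t = c"
    if h [measurable]: "h \<in> borel_measurable torus_measure" and eig: "AE t in torus_measure. h (f t) = l * h t"
    for h :: "torus \<Rightarrow> complex" and l
  proof (cases "norm l = 1")
    case False
    then show ?thesis using torus.eigenfunction_modulus[OF f h eig] by blast
  next
    case l: True
    \<comment> \<open>An eigenfunction need not be integrable. Dividing by
      \<open>1 + norm (h t)\<close>, which is invariant because \<open>norm l = 1\<close>, gives a
      bounded eigenfunction with the same eigenvalue.\<close>
    define k where "k = (\<lambda>t. h t / of_real (1 + norm (h t)))"
    have pos: "1 + norm (h t) > 0" for t by (simp add: add_pos_nonneg)
    have k_m [measurable]: "k \<in> borel_measurable torus_measure" unfolding k_def by measurable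
    have k1: "norm (k t) \<le> 1" for t
    proof -
      have "norm (k t) = norm (h t) / (1 + norm (h t))"
        unfolding k_def norm_divide norm_of_real using pos[of t] by simp
      then show ?thesis using pos[of t] by simp
    qed
    have int_k: "integrable torus_measure k"
      using k1 by (intro torus.integrable_const_bound[of _ 1]) auto
    have eig_k: "AE t in torus_measure. k (f t) = l * k t"
      using eig by eventually_elim (simp add: k_def norm_mult l)
    have eig_n: "AE t in torus_measure. k ((f ^^ n) t) = l ^ n * k t" for n
    proof (induction n)
      case (Suc n)
      have "AE t in torus_measure. k (f ((f ^^ n) t)) = l * k ((f ^^ n) t)"
        by (rule measure_preserving_AE[OF measure_preserving_funpow[OF f] eig_k])
      then show ?case using Suc by eventually_elim (simp add: mult.assoc)
    qed simp
    have coeff: "(LINT t|torus_measure. k t * torus_char c d (torus_rep t)) = 0" if cd: "\<not> (c = 0 \<and> d = 0)" for c d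
    proof -
      let ?A = "LINT t|torus_measure. k t * torus_char c d (torus_rep t)"
      have "norm ?A \<le> e" if e: "e > 0" for e
      proof -
        obtain P where P: "P \<in> trig_poly" "(LINT t|torus_measure. norm (k t - P (torus_rep t))) < e / 2"
          using trig_poly_dense_L1[OF int_k, of "e / 2"] e by auto
        have L: "(\<lambda>n. LINT t|torus_measure. P (torus_rep ((f ^^ m n) t)) * torus_char c d (torus_rep t)) \<longlonglongrightarrow> 0"
          using mixP[OF P(1), of c d] cd square_integral_torus_char[of c d] by auto
        have "\<forall>\<^sub>F n in sequentially. norm (LINT t|torus_measure. P (torus_rep ((f ^^ m n) t)) * torus_char c d (torus_rep t)) < e / 2"
          by (intro order_tendstoD(2)[OF tendsto_norm_zero[OF L]]) (use e in simp)
        then obtain n where n: "norm (LINT t|torus_measure. P (torus_rep ((f ^^ m n) t)) * torus_char c d (torus_rep t)) < e / 2"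
          by (auto simp: eventually_sequentially)
        have fp: "measure_preserving torus_measure (f ^^ m n)" by (rule measure_preserving_funpow[OF f])
        have comp: "(\<lambda>t. g ((f ^^ m n) t)) \<in> borel_measurable torus_measure" "integrable torus_measure (\<lambda>t. g ((f ^^ m n) t))"
          if "integrable torus_measure g" for g :: "torus \<Rightarrow> complex"
        proof -
          show "(\<lambda>t. g ((f ^^ m n) t)) \<in> borel_measurable torus_measure"
            using that by (intro measurable_compose[OF fn]) auto
          show "integrable torus_measure (\<lambda>t. g ((f ^^ m n) t))"
            using fp that integrable_distr[OF fn, of "m n" g] by (simp add: measure_preserving_def)
        qed
        \<comment> \<open>The iterate preserves the measure, so replacing \<open>k\<close> by
          \<open>P\<close> along the orbit costs the same \<open>L1\<close> distance at every time;
          this is why \<open>P\<close> can be chosen before \<open>n\<close>.\<close>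
        have "norm ((LINT t|torus_measure. k ((f ^^ m n) t) * torus_char c d (torus_rep t)) -
            (LINT t|torus_measure. P (torus_rep ((f ^^ m n) t)) * torus_char c d (torus_rep t)))
          \<le> (LINT t|torus_measure. norm (k ((f ^^ m n) t) - P (torus_rep ((f ^^ m n) t))))"
          using int_k integrable_trig_poly[OF P(1)] by (intro norm_integral_diff_mult_le comp) auto
        also have "\<dots> = (LINT t|torus_measure. norm (k t - P (torus_rep t)))"
          using P_m[OF P(1)]
          by (intro measure_preserving_integral[OF fp, of "\<lambda>t. norm (k t - P (torus_rep t))"]) measurable
        finally have "norm ((LINT t|torus_measure. k ((f ^^ m n) t) * torus_char c d (torus_rep t)) -
            (LINT t|torus_measure. P (torus_rep ((f ^^ m n) t)) * torus_char c d (torus_rep t))) \<le> e / 2"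
          using P(2) by simp
        then have "norm (LINT t|torus_measure. k ((f ^^ m n) t) * torus_char c d (torus_rep t)) \<le> e / 2 + e / 2"
          using norm_triangle_mono[OF _ less_imp_le[OF n]] by fastforce
        moreover have "(LINT t|torus_measure. k ((f ^^ m n) t) * torus_char c d (torus_rep t)) = l ^ m n * ?A"
        proof -
          have "(LINT t|torus_measure. k ((f ^^ m n) t) * torus_char c d (torus_rep t)) =
              (LINT t|torus_measure. l ^ m n * (k t * torus_char c d (torus_rep t)))"
          proof (rule integral_cong_AE)
            show "AE t in torus_measure. k ((f ^^ m n) t) * torus_char c d (torus_rep t) =
                l ^ m n * (k t * torus_char c d (torus_rep t))"
              using eig_n[of "m n"] by eventually_elim simp
          qed (use comp(1)[OF int_k] in measurable)
          then show ?thesis by simp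
        qed
        ultimately show ?thesis by (simp add: norm_mult norm_power l)
      qed
      then have "norm ?A \<le> 0" by (rule field_le_epsilon[where y = 0, simplified])
      then show ?thesis by simp
    qed
    define c where "c = (LINT t|torus_measure. k t)"
    have int_kk: "integrable torus_measure (\<lambda>t. k t * cnj (k t))"
    proof (rule torus.integrable_const_bound[of _ 1])
      have [measurable]: "cnj \<in> borel_measurable borel"
        by (intro borel_measurable_continuous_onI continuous_intros)
      show "(\<lambda>t. k t * cnj (k t)) \<in> borel_measurable torus_measure" by measurable
      have "norm (k t) * norm (k t) \<le> 1 * 1" for t
        by (intro mult_mono k1) auto
      then show "AE t in torus_measure. norm (k t * cnj (k t)) \<le> 1"
        by (simp add: norm_mult)
    qed
    \<comment> \<open>All nonconstant coefficients vanish, so against trigonometric polynomials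
      \<open>k\<close> acts like its mean \<open>c\<close>.\<close>
    have kP: "(LINT t|torus_measure. k t * P (torus_rep t)) = c * (LINT t|torus_measure. P (torus_rep t))" if "P \<in> trig_poly" for P
      using that
    proof (induction rule: trig_poly.induct)
      case (char z a b)
      have "(LINT t|torus_measure. torus_char a b (torus_rep t)) = square_integral (torus_char a b)"
        by (intro integral_torus_rep continuous_torus_char torus_periodic_torus_char)
      moreover have "(LINT t|torus_measure. k t * torus_char a b (torus_rep t)) = c * square_integral (torus_char a b)"
      proof (cases "a = 0 \<and> b = 0")
        case True
        then have "torus_char a b p = 1" for p by (simp add: torus_char_def)
        then show ?thesis using True by (simp add: square_integral_torus_char c_def)
      next
        case False
        then show ?thesis using coeff[OF False] square_integral_torus_char[of a b] by auto
      qed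
      moreover have "(LINT t|torus_measure. k t * (z * torus_char a b (torus_rep t))) =
          z * (LINT t|torus_measure. k t * torus_char a b (torus_rep t))"
        by (simp add: mult.left_commute)
      ultimately show ?case by simp
    next
      case (add g g')
      have "integrable torus_measure (\<lambda>t. k t * P (torus_rep t))" if P: "P \<in> trig_poly" for P
      proof -
        obtain B where B: "\<And>p. norm (P p) \<le> B" using bounded_trig_poly[OF P] by blast
        have "norm (k t * P (torus_rep t)) \<le> 1 * B" for t
          unfolding norm_mult by (intro mult_mono B k1) auto
        then show ?thesis
          using P_m[OF P] by (intro torus.integrable_const_bound[of _ B]) auto
      qed
      then show ?case using add integrable_trig_poly by (simp add: distrib_left)
    qed
    \<comment> \<open>A trigonometric polynomial close to \<open>cnj k\<close> turns the previous
      fact into equality of the second moment with \<open>cnj c * c\<close>, which means variance 0.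
      Approximation in \<open>L1\<close> is enough because \<open>k\<close> is bounded.\<close>
    have "norm ((LINT t|torus_measure. cnj (k t) * k t) - cnj c * c) \<le> e" if e: "e > 0" for e
    proof -
      have int_cnj: "integrable torus_measure (\<lambda>t. cnj (k t))" using int_k by simp
      obtain P where P: "P \<in> trig_poly" "(LINT t|torus_measure. norm (cnj (k t) - P (torus_rep t))) < e / 2"
        using trig_poly_dense_L1[OF int_cnj, of "e / 2"] e by auto
      have 1: "norm ((LINT t|torus_measure. cnj (k t) * k t) - (LINT t|torus_measure. P (torus_rep t) * k t)) \<le> e / 2"
        using norm_integral_diff_mult_le[OF int_cnj integrable_trig_poly[OF P(1)] k_m k1] P(2) by simp
      have "norm ((LINT t|torus_measure. cnj (k t) * 1) - (LINT t|torus_measure. P (torus_rep t) * 1)) \<le> e / 2"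
        using norm_integral_diff_mult_le[OF int_cnj integrable_trig_poly[OF P(1)], of "\<lambda>_. 1"] P(2) by simp
      then have "norm ((LINT t|torus_measure. P (torus_rep t)) - cnj c) \<le> e / 2"
        by (simp add: c_def norm_minus_commute)
      moreover have "norm c \<le> 1"
      proof -
        have "norm c \<le> (LINT t|torus_measure. norm (k t))"
          unfolding c_def by (rule integral_norm_bound)
        also have "\<dots> \<le> (LINT t|torus_measure. 1)"
          using int_k k1 by (intro integral_mono) auto
        also have "\<dots> = 1" using torus.prob_space by simp
        finally show ?thesis .
      qed
      ultimately have 2: "norm (((LINT t|torus_measure. P (torus_rep t)) - cnj c) * c) \<le> e / 2 * 1"
        unfolding norm_mult using e by (intro mult_mono) auto
      have "(LINT t|torus_measure. P (torus_rep t) * k t) = (LINT t|torus_measure. P (torus_rep t)) * c"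
        using kP[OF P(1)] by (simp add: mult.commute)
      with norm_triangle_mono[OF 1 2] show ?thesis by (simp add: algebra_simps)
    qed
    then have "norm ((LINT t|torus_measure. cnj (k t) * k t) - cnj c * c) \<le> 0"
      by (rule field_le_epsilon[where y = 0, simplified])
    then have kk: "(LINT t|torus_measure. k t * cnj (k t)) = c * cnj c"
      by (simp add: mult.commute)
    have int_sq: "integrable torus_measure (\<lambda>t. (norm (k t - c))\<^sup>2)"
    proof (rule torus.integrable_const_bound[of _ "(1 + norm c)\<^sup>2"])
      have "norm (k t - c) \<le> 1 + norm c" for t
        by (rule order_trans[OF norm_triangle_ineq4 add_mono]) (auto simp: k1)
      then show "AE t in torus_measure. norm ((norm (k t - c))\<^sup>2) \<le> (1 + norm c)\<^sup>2"
        by (auto intro: power_mono)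
    qed measurable
    have "complex_of_real (LINT t|torus_measure. (norm (k t - c))\<^sup>2) =
        (LINT t|torus_measure. complex_of_real ((norm (k t - c))\<^sup>2))"
      using int_sq by (rule integral_of_real[symmetric])
    also have "\<dots> = (LINT t|torus_measure. k t * cnj (k t) - cnj c * k t - c * cnj (k t) + c * cnj c)"
      by (simp only: complex_norm_square) (simp add: algebra_simps)
    also have "\<dots> = c * cnj c - cnj c * c - c * cnj c + c * cnj c"
      using int_k int_kk kk torus.prob_space by (simp add: c_def)
    finally have "(LINT t|torus_measure. (norm (k t - c))\<^sup>2) = 0"
      by simp
    then have "AE t in torus_measure. (norm (k t - c))\<^sup>2 = 0"
      using int_sq integral_nonneg_eq_0_iff_AE[of torus_measure "\<lambda>t. (norm (k t - c))\<^sup>2"] by simp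
    \<comment> \<open>The map taking \<open>z\<close> to \<open>z / (1 + norm z)\<close> is
      injective, with inverse \<open>w / (1 - norm w)\<close>; so \<open>h\<close> is recovered from
      the constant \<open>k\<close>.\<close>
    then have "AE t in torus_measure. h t = c / of_real (1 - norm c)"
    proof eventually_elim
      case (elim t)
      define N where "N = 1 + norm (h t)"
      have N: "N > 0" using pos[of t] by (simp add: N_def)
      have c: "c = h t / of_real N" using elim by (simp add: k_def N_def)
      then have "norm c = norm (h t) / N"
        using N by (simp only: norm_divide norm_of_real abs_of_pos)
      moreover have "norm (h t) = N - 1" by (simp add: N_def)
      ultimately have "1 - norm c = 1 / N" using N by (simp add: field_simps)
      then show ?case using N by (simp add: c)
    qed
    then show ?thesis by blast
  qed
  then show ?thesis using f unfolding weak_mixing_def by blast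
qed

section \<open>Lifts of analytic diffeomorphisms\<close>

definition complexify :: "real \<times> real \<Rightarrow> complex \<times> complex" where
  "complexify x = (of_real (fst x), of_real (snd x))"

lemma complexify_in_strip [simp]: "\<rho> > 0 \<Longrightarrow> complexify x \<in> strip \<rho>"
  by (simp add: complexify_def strip_def)

text \<open>A lift together with its complex extension. The last clause, trivial action on the
  lattice, is periodicity of the displacement; its boundedness on the strip is what
  \<open>C_omega\<close> demands.\<close>

definition analytic_lift ::
    "real \<Rightarrow> (real \<times> real \<Rightarrow> real \<times> real) \<Rightarrow> (complex \<times> complex \<Rightarrow> complex \<times> complex) \<Rightarrow> bool" where
  "analytic_lift \<rho> a A \<longleftrightarrow>
     sep_holomorphic (band \<rho>) (band \<rho>) (\<lambda>z. fst (A z)) \<and> sep_holomorphic (band \<rho>) (band \<rho>) (\<lambda>z. snd (A z)) \<and>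
     (\<exists>M. \<forall>z\<in>strip \<rho>. norm (A z - z) \<le> M) \<and>
     (\<forall>x. A (complexify x) = complexify (a x)) \<and>
     (\<forall>x m n. a (x + (of_int m, of_int n)) = a x + (of_int m, of_int n))"

lemma norm_fst_le_norm: "norm (fst p) \<le> norm p" and norm_snd_le_norm: "norm (snd p) \<le> norm p"
  for p :: "'a::real_normed_vector \<times> 'b::real_normed_vector"
  by (metis norm_fst_le norm_snd_le prod.collapse)+

lemma sep_holomorphic_fst: "sep_holomorphic A B fst" and sep_holomorphic_snd: "sep_holomorphic A B snd"
  by (auto simp: sep_holomorphic_def intro!: continuous_intros holomorphic_intros)

lemma sep_holomorphic_diff: "sep_holomorphic A B F \<Longrightarrow> sep_holomorphic A B G \<Longrightarrow> sep_holomorphic A B (\<lambda>z. F z - G z)"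
  by (auto simp: sep_holomorphic_def intro!: continuous_intros holomorphic_intros)

lemma analytic_lift_real_part:
  assumes "analytic_lift \<rho> a A"
  shows "a = (\<lambda>(x, y). (Re (fst (A (of_real x, of_real y))), Re (snd (A (of_real x, of_real y)))))"
proof
  fix x
  have "A (complexify x) = complexify (a x)" using assms unfolding analytic_lift_def by blast
  then show "a x = (case x of (x, y) \<Rightarrow> (Re (fst (A (of_real x, of_real y))), Re (snd (A (of_real x, of_real y)))))"
    by (simp add: complexify_def split_def)
qed

lemma smooth_analytic_lift:
  assumes "\<rho> > 0" "analytic_lift \<rho> a A"
  shows "smooth a"
proof -
  have "smooth (\<lambda>(x, y). (Re (fst (A (of_real x, of_real y))), Re (snd (A (of_real x, of_real y)))))"
    unfolding smooth_def
  proof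
    fix k
    show "Ck k (\<lambda>(x, y). (Re (fst (A (of_real x, of_real y))), Re (snd (A (of_real x, of_real y)))))"
      using Ck_real_part[of \<rho> "\<lambda>z. fst (A z)" "\<lambda>z. snd (A z)" k] assms by (simp add: analytic_lift_def)
  qed
  then show ?thesis by (simp only: analytic_lift_real_part[OF assms(2), symmetric])
qed

lemma continuous_analytic_lift:
  assumes "\<rho> > 0" "analytic_lift \<rho> a A"
  shows "continuous_on UNIV a"
  using smooth_analytic_lift[OF assms] unfolding smooth_def by (metis Ck.simps(1))

lemma differentiable_analytic_lift:
  assumes "\<rho> > 0" "analytic_lift \<rho> a A"
  shows "a differentiable_on S"
proof -
  have "Ck (Suc 0) a" using smooth_analytic_lift[OF assms] by (simp only: smooth_def)
  then show ?thesis
    unfolding Ck.simps differentiable_on_def differentiable_def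
    using has_derivative_at_withinI by blast
qed

definition lift_displacement ::
    "(real \<times> real \<Rightarrow> real \<times> real) \<Rightarrow> (real \<times> real \<Rightarrow> real) \<times> (real \<times> real \<Rightarrow> real)" where
  "lift_displacement a = (\<lambda>x. fst (a x) - fst x, \<lambda>x. snd (a x) - snd x)"

lemma bounded_extension_analytic_lift:
  assumes "analytic_lift \<rho> a A"
  shows "bounded_extension \<rho> (fst (lift_displacement a)) (\<lambda>z. fst (A z) - fst z)"
    and "bounded_extension \<rho> (snd (lift_displacement a)) (\<lambda>z. snd (A z) - snd z)"
proof -
  obtain M where M: "\<And>z. z \<in> strip \<rho> \<Longrightarrow> norm (A z - z) \<le> M"
    using assms by (auto simp: analytic_lift_def)
  have "norm (fst (A z) - fst z) \<le> M" "norm (snd (A z) - snd z) \<le> M" if "z \<in> strip \<rho>" for z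
    using M[OF that] order_trans[OF norm_fst_le_norm[of "A z - z"]] order_trans[OF norm_snd_le_norm[of "A z - z"]]
    by simp_all
  then have bd: "bounded ((\<lambda>z. fst (A z) - fst z) ` strip \<rho>)" "bounded ((\<lambda>z. snd (A z) - snd z) ` strip \<rho>)"
    unfolding bounded_iff by blast+
  have hol: "holomorphic2_on (\<lambda>z. fst (A z) - fst z) (strip \<rho>)" "holomorphic2_on (\<lambda>z. snd (A z) - snd z) (strip \<rho>)"
    using assms unfolding holomorphic2_on_strip_iff analytic_lift_def
    by (auto intro: sep_holomorphic_diff sep_holomorphic_fst sep_holomorphic_snd)
  have "A (of_real x, of_real y) = (of_real (fst (a (x, y))), of_real (snd (a (x, y))))" for x y
    using assms unfolding analytic_lift_def complexify_def by (metis fst_conv snd_conv)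
  then show "bounded_extension \<rho> (fst (lift_displacement a)) (\<lambda>z. fst (A z) - fst z)"
    "bounded_extension \<rho> (snd (lift_displacement a)) (\<lambda>z. snd (A z) - snd z)"
    using bd hol by (auto simp: bounded_extension_def lift_displacement_def)
qed

lemma displacement_analytic_lift:
  assumes a: "analytic_lift \<rho> a A" and T: "is_lift a T"
  shows "displacement \<rho> T (lift_displacement a)"
proof -
  have "a (\<theta> + of_int m, r + of_int n) = a (\<theta>, r) + (of_int m, of_int n)" for \<theta> r m n
    using a unfolding analytic_lift_def by (metis add_Pair)
  then have "periodic2 (fst (lift_displacement a))" "periodic2 (snd (lift_displacement a))"
    by (auto simp: periodic2_def lift_displacement_def)
  moreover have "(\<lambda>(\<theta>, r). (\<theta> + fst (lift_displacement a) (\<theta>, r), r + snd (lift_displacement a) (\<theta>, r))) = a"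
    by (auto simp: lift_displacement_def)
  ultimately show ?thesis
    using bounded_extension_analytic_lift[OF a] T unfolding displacement_def C_omega_def by auto
qed

lemma torus_inverse_if_lifts:
  assumes "is_lift a T" "is_lift b T'" "\<And>x. a (b x) = x"
  shows "T (T' t) = t"
  using assms torus_proj_rep[of t] unfolding is_lift_def by metis

text \<open>The inverse comes with an analytic lift of its own, so that smoothness in both
  directions is obtained in the same way and no inverse function theorem is involved.\<close>

lemma Diff_omega_if_lifts:
  assumes \<rho>: "\<rho> > 0" and a: "analytic_lift \<rho> a A" and b: "analytic_lift \<rho> b B"
    and T: "is_lift a T" and T': "is_lift b T'" and inv: "\<And>x. a (b x) = x" "\<And>x. b (a x) = x"
  shows "T \<in> Diff_omega \<rho>"
proof -
  have TT': "T (T' t) = t" "T' (T t) = t" for t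
    using torus_inverse_if_lifts T T' inv by metis+
  then have "bij T" by (metis bij_betw_def inj_on_def surj_def)
  moreover have "inv T = T'"
    using TT' by (intro inv_equality) auto
  ultimately have "torus_diffeo T"
    unfolding torus_diffeo_def using T T' smooth_analytic_lift[OF \<rho> a] smooth_analytic_lift[OF \<rho> b] by metis
  then show ?thesis
    unfolding Diff_omega_def using displacement_analytic_lift[OF a T] by blast
qed

section \<open>Independence of norm and distance from the chosen extensions and
  displacements\<close>

lemma strip_norm_eq:
  assumes "\<rho> > 0" "bounded_extension \<rho> f F"
  shows "strip_norm \<rho> f = (SUP z\<in>strip \<rho>. norm (F z))"
proof -
  define G where "G = (SOME F. bounded_extension \<rho> f F)"
  have G: "bounded_extension \<rho> f G"
    using someI[of "bounded_extension \<rho> f" F] assms(2) by (simp add: G_def)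
  have "G z = F z" if "z \<in> strip \<rho>" for z
    using assms G that holomorphic2_eq_on_strip[of \<rho> G F z] unfolding bounded_extension_def by simp
  then show ?thesis unfolding strip_norm_def G_def[symmetric] by simp
qed

lemma strip_norm_le:
  assumes "\<rho> > 0" "bounded_extension \<rho> f F" "\<And>z. z \<in> strip \<rho> \<Longrightarrow> norm (F z) \<le> e"
  shows "strip_norm \<rho> f \<le> e"
  unfolding strip_norm_eq[OF assms(1,2)]
  using complexify_in_strip[OF assms(1)] assms(3) by (intro cSUP_least) blast+

lemma strip_norm_nonneg:
  assumes "\<rho> > 0" "bounded_extension \<rho> f F"
  shows "0 \<le> strip_norm \<rho> f"
proof -
  have "bdd_above ((\<lambda>z. norm (F z)) ` strip \<rho>)"
    using assms(2) by (auto simp: bounded_extension_def bounded_iff bdd_above_def)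
  then have "norm (F (complexify 0)) \<le> strip_norm \<rho> f"
    unfolding strip_norm_eq[OF assms] using assms(1) by (intro cSUP_upper) auto
  then show ?thesis using norm_ge_zero order_trans by blast
qed

lemma bounded_extension_diff:
  assumes "bounded_extension \<rho> f F" "bounded_extension \<rho> g G"
  shows "bounded_extension \<rho> (\<lambda>x. f x - g x + of_int p) (\<lambda>z. F z - G z + of_int p)"
proof -
  have "sep_holomorphic (band \<rho>) (band \<rho>) (\<lambda>z. F z - G z + of_int p)"
    using assms unfolding bounded_extension_def holomorphic2_on_strip_iff
    by (auto simp: sep_holomorphic_def intro!: continuous_intros holomorphic_intros)
  moreover have "bounded ((\<lambda>z. F z - G z + of_int p) ` strip \<rho>)"
    using assms unfolding bounded_extension_def
    by (intro bounded_plus_comp bounded_minus_comp) (auto simp: image_constant_conv)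
  ultimately show ?thesis
    using assms by (auto simp: bounded_extension_def holomorphic2_on_strip_iff)
qed

lemma continuous_bounded_extension:
  assumes "\<rho> > 0" "bounded_extension \<rho> f F"
  shows "continuous_on UNIV f"
proof -
  have "continuous_on (band \<rho> \<times> band \<rho>) F"
    using assms by (auto simp: bounded_extension_def holomorphic2_on_strip_iff sep_holomorphic_def)
  then have "continuous_on UNIV (\<lambda>x :: real \<times> real. F (of_real (fst x), of_real (snd x)))"
    by (rule continuous_on_compose2) (use assms(1) in \<open>auto intro!: continuous_intros\<close>)
  then have "continuous_on UNIV (\<lambda>x :: real \<times> real. Re (F (of_real (fst x), of_real (snd x))))"
    by (rule continuous_on_Re)
  moreover have "(\<lambda>x. Re (F (of_real (fst x), of_real (snd x)))) = f"
    using assms(2) by (auto simp: bounded_extension_def)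
  ultimately show ?thesis by (simp only:)
qed

lemma continuous_Ints_constant:
  fixes f :: "real \<times> real \<Rightarrow> real"
  assumes "continuous_on UNIV f" "\<And>x. f x \<in> \<int>"
  shows "\<exists>n :: int. \<forall>x. f x = of_int n"
proof -
  have "f constant_on UNIV"
  proof (rule continuous_discrete_range_constant[OF _ assms(1)])
    show "connected (UNIV :: (real \<times> real) set)" by (rule connected_UNIV)
    show "\<exists>e>0. \<forall>y. y \<in> UNIV \<and> f y \<noteq> f x \<longrightarrow> e \<le> norm (f y - f x)" for x
    proof (intro exI[of _ 1] conjI allI impI)
      fix y assume "y \<in> UNIV \<and> f y \<noteq> f x"
      moreover obtain m n :: int where "f y = of_int m" "f x = of_int n"
        using assms(2) by (meson Ints_cases)
      ultimately show "1 \<le> norm (f y - f x)" by auto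
    qed simp
  qed
  then show ?thesis
    unfolding constant_on_def using assms(2)[of 0] by (metis Ints_cases UNIV_I)
qed

text \<open>The difference of two displacements is continuous and integer-valued on the connected
  plane.\<close>

lemma displacement_unique:
  assumes \<rho>: "\<rho> > 0" and f: "displacement \<rho> T f" and g: "displacement \<rho> T g"
  shows "\<exists>n :: int. \<forall>x. fst f x = fst g x + of_int n" "\<exists>n :: int. \<forall>x. snd f x = snd g x + of_int n"
proof -
  have cont: "continuous_on UNIV (fst h)" "continuous_on UNIV (snd h)" if "displacement \<rho> T h" for h
    using that continuous_bounded_extension[OF \<rho>] by (auto simp: displacement_def C_omega_def)
  have I: "fst f x - fst g x \<in> \<int>" "snd f x - snd g x \<in> \<int>" for x
  proof -
    have "torus_proj (fst x + fst f x, snd x + snd f x) = torus_proj (fst x + fst g x, snd x + snd g x)"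
      using f g unfolding displacement_def is_lift_def by (metis (mono_tags, lifting) case_prod_beta prod.collapse)
    then show "fst f x - fst g x \<in> \<int>" "snd f x - snd g x \<in> \<int>"
      by (auto simp: torus.abs_eq_iff lattice_rel_def)
  qed
  have "\<exists>m :: int. \<forall>x. fst f x - fst g x = of_int m" "\<exists>n :: int. \<forall>x. snd f x - snd g x = of_int n"
    by (intro continuous_Ints_constant continuous_on_diff cont f g I)+
  then obtain m n :: int where "\<forall>x. fst f x - fst g x = of_int m" "\<forall>x. snd f x - snd g x = of_int n"
    by blast
  then have "\<forall>x. fst f x = fst g x + of_int m" "\<forall>x. snd f x = snd g x + of_int n"
    by (simp_all add: algebra_simps)
  then show "\<exists>n :: int. \<forall>x. fst f x = fst g x + of_int n" "\<exists>n :: int. \<forall>x. snd f x = snd g x + of_int n"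
    by blast+
qed

text \<open>\<open>f'\<close> and \<open>g'\<close> stand for the displacements picked by the choice
  operator in \<open>d_rho\<close>, known only up to integers. Nonnegativity of the members also
  bounds the set from below, which is what allows the infimum to be estimated by one of
  them.\<close>

lemma INF_strip_norm:
  assumes \<rho>: "\<rho> > 0" and F: "bounded_extension \<rho> f F" and G: "bounded_extension \<rho> g G"
    and e: "\<And>z. z \<in> strip \<rho> \<Longrightarrow> norm (F z - G z) \<le> e"
    and f': "\<And>x. f' x = f x + of_int m" and g': "\<And>x. g' x = g x + of_int n"
  shows "0 \<le> (INF p :: int. strip_norm \<rho> (\<lambda>x. f' x - g' x + of_int p))"
    "(INF p :: int. strip_norm \<rho> (\<lambda>x. f' x - g' x + of_int p)) \<le> e"
proof -
  have eq: "(\<lambda>x. f' x - g' x + of_int p) = (\<lambda>x. f x - g x + of_int (m - n + p))" for p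
    by (auto simp: f' g')
  have nn: "0 \<le> strip_norm \<rho> (\<lambda>x. f' x - g' x + of_int p)" for p
    unfolding eq using \<rho> bounded_extension_diff[OF F G] by (rule strip_norm_nonneg)
  then show "0 \<le> (INF p :: int. strip_norm \<rho> (\<lambda>x. f' x - g' x + of_int p))"
    by (intro cINF_greatest) auto
  \<comment> \<open>The integer \<open>n - m\<close> undoes both ambiguities.\<close>
  have "(INF p :: int. strip_norm \<rho> (\<lambda>x. f' x - g' x + of_int p)) \<le> strip_norm \<rho> (\<lambda>x. f' x - g' x + of_int (n - m))"
    using nn by (intro cINF_lower) (auto simp: bdd_below_def)
  also have "\<dots> \<le> e"
    unfolding eq using e by (intro strip_norm_le[OF \<rho> bounded_extension_diff[OF F G]]) simp
  finally show "(INF p :: int. strip_norm \<rho> (\<lambda>x. f' x - g' x + of_int p)) \<le> e" .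
qed

lemma d_rho_analytic_lift:
  assumes \<rho>: "\<rho> > 0" and a: "analytic_lift \<rho> a A" "is_lift a S" and b: "analytic_lift \<rho> b B" "is_lift b T"
    and e: "\<And>z. z \<in> strip \<rho> \<Longrightarrow> norm (A z - B z) \<le> e"
  shows "0 \<le> d_rho \<rho> S T" "d_rho \<rho> S T \<le> e"
proof -
  define f where "f = (SOME f. displacement \<rho> S f)"
  define g where "g = (SOME g. displacement \<rho> T g)"
  note da = displacement_analytic_lift[OF a] and db = displacement_analytic_lift[OF b]
  have df: "displacement \<rho> S f" using someI[of "displacement \<rho> S", OF da] by (simp add: f_def)
  have dg: "displacement \<rho> T g" using someI[of "displacement \<rho> T", OF db] by (simp add: g_def)
  obtain m m' where m: "\<And>x. fst f x = fst (lift_displacement a) x + of_int m"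
    "\<And>x. snd f x = snd (lift_displacement a) x + of_int m'"
    using displacement_unique[OF \<rho> df da] by blast
  obtain n n' where n: "\<And>x. fst g x = fst (lift_displacement b) x + of_int n"
    "\<And>x. snd g x = snd (lift_displacement b) x + of_int n'"
    using displacement_unique[OF \<rho> dg db] by blast
  have e': "norm (fst (A z) - fst z - (fst (B z) - fst z)) \<le> e" "norm (snd (A z) - snd z - (snd (B z) - snd z)) \<le> e"
    if "z \<in> strip \<rho>" for z
    using e[OF that] order_trans[OF norm_fst_le_norm[of "A z - B z"]] order_trans[OF norm_snd_le_norm[of "A z - B z"]]
    by simp_all
  note 1 = INF_strip_norm[OF \<rho> bounded_extension_analytic_lift(1)[OF a(1)] bounded_extension_analytic_lift(1)[OF b(1)]
      e'(1) m(1) n(1)]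
  note 2 = INF_strip_norm[OF \<rho> bounded_extension_analytic_lift(2)[OF a(1)] bounded_extension_analytic_lift(2)[OF b(1)]
      e'(2) m(2) n(2)]
  show "0 \<le> d_rho \<rho> S T" "d_rho \<rho> S T \<le> e"
    unfolding d_rho_def f_def[symmetric] g_def[symmetric] Let_def using 1 2 by (auto simp: max_def)
qed

section \<open>The conjugating maps\<close>

text \<open>The lifts are polymorphic so that one formula serves the real plane and its
  complexification; \<open>F_lift_complexify\<close> below relates the two.\<close>

definition rot_lift :: "real \<Rightarrow> 'a \<times> 'a \<Rightarrow> 'a \<times> 'a::{real_normed_field,banach}" where
  "rot_lift t p = (fst p + of_real t, snd p)"

definition shear_lift :: "int \<Rightarrow> 'a \<times> 'a \<Rightarrow> 'a \<times> 'a::{real_normed_field,banach}" where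
  "shear_lift k p = (fst p + of_int k * snd p, snd p)"

definition phi_lift :: "real \<Rightarrow> int \<Rightarrow> 'a \<times> 'a \<Rightarrow> 'a \<times> 'a::{real_normed_field,banach}" where
  "phi_lift c q p = (fst p, snd p + of_real c * cos (of_real (2 * pi) * of_int q * fst p))"

definition h_lift :: "int \<Rightarrow> int \<Rightarrow> 'a \<times> 'a \<Rightarrow> 'a \<times> 'a::{real_normed_field,banach}" where
  "h_lift k q = shear_lift k \<circ> phi_lift ((of_int q)\<^sup>2) q"

definition h_inv :: "int \<Rightarrow> int \<Rightarrow> 'a \<times> 'a \<Rightarrow> 'a \<times> 'a::{real_normed_field,banach}" where
  "h_inv k q = phi_lift (- (of_int q)\<^sup>2) q \<circ> shear_lift (- k)"

lemma shear_lift_inverse: "shear_lift k (shear_lift (- k) p) = p" "shear_lift (- k) (shear_lift k p) = p"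
  by (simp_all add: shear_lift_def)

lemma phi_lift_inverse: "phi_lift c q (phi_lift (- c) q p) = p" "phi_lift (- c) q (phi_lift c q p) = p"
  by (simp_all add: phi_lift_def)

lemma h_lift_inverse: "h_lift k q (h_inv k q p) = p" "h_inv k q (h_lift k q p) = p"
  by (simp_all add: h_lift_def h_inv_def shear_lift_inverse phi_lift_inverse)

lemma h_lift_conj: "h_lift k q (rot_lift t (h_inv k q p)) = Phi k q t p"
  by (simp add: h_lift_def h_inv_def rot_lift_def Phi_def Delta_def shear_lift_def phi_lift_def algebra_simps)

text \<open>Takes the value of the denominator instead of the sequence, so that a candidate for the
  next denominator can be tested before the sequence is extended.\<close>

definition shear_number :: "real \<Rightarrow> nat \<Rightarrow> int \<Rightarrow> int" where
  "shear_number \<sigma> n q = \<lfloor>of_nat n * of_int q powr \<sigma>\<rfloor>"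

primrec H_lift :: "real \<Rightarrow> (nat \<Rightarrow> int) \<Rightarrow> nat \<Rightarrow> 'a \<times> 'a \<Rightarrow> 'a \<times> 'a::{real_normed_field,banach}" where
  "H_lift \<sigma> q 0 = id"
| "H_lift \<sigma> q (Suc n) = H_lift \<sigma> q n \<circ> h_lift (shear_number \<sigma> (Suc n) (q (Suc n))) (q (Suc n))"

primrec H_inv :: "real \<Rightarrow> (nat \<Rightarrow> int) \<Rightarrow> nat \<Rightarrow> 'a \<times> 'a \<Rightarrow> 'a \<times> 'a::{real_normed_field,banach}" where
  "H_inv \<sigma> q 0 = id"
| "H_inv \<sigma> q (Suc n) = h_inv (shear_number \<sigma> (Suc n) (q (Suc n))) (q (Suc n)) \<circ> H_inv \<sigma> q n"

text \<open>Needed for the recursive choice of \<open>q\<close>, where the later denominators do not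
  exist yet.\<close>

lemma H_lift_cong:
  "(\<And>i. 0 < i \<Longrightarrow> i \<le> n \<Longrightarrow> q i = q' i) \<Longrightarrow> H_lift \<sigma> q n = H_lift \<sigma> q' n"
  "(\<And>i. 0 < i \<Longrightarrow> i \<le> n \<Longrightarrow> q i = q' i) \<Longrightarrow> H_inv \<sigma> q n = H_inv \<sigma> q' n"
  by (induction n) auto

lemma H_lift_inverse: "H_lift \<sigma> q n (H_inv \<sigma> q n p) = p" "H_inv \<sigma> q n (H_lift \<sigma> q n p) = p"
  by (induction n arbitrary: p) (simp_all add: h_lift_inverse)

text \<open>The time \<open>t\<close> is free because the \<open>m\<close>-th iterate of
  \<open>f_n\<close> is this map at \<open>m\<close> times the rotation number, for \<open>m\<close>
  of either sign. An estimate for long iterates is thus an estimate for a single conjugated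
  rotation.\<close>

definition F_lift :: "real \<Rightarrow> (nat \<Rightarrow> int) \<Rightarrow> nat \<Rightarrow> real \<Rightarrow> 'a \<times> 'a \<Rightarrow> 'a \<times> 'a::{real_normed_field,banach}" where
  "F_lift \<sigma> q n t p = H_lift \<sigma> q n (rot_lift t (H_inv \<sigma> q n p))"

lemma F_lift_Suc:
  "F_lift \<sigma> q (Suc n) t p = H_lift \<sigma> q n (Phi (shear_number \<sigma> (Suc n) (q (Suc n))) (q (Suc n)) t (H_inv \<sigma> q n p))"
  by (simp add: F_lift_def h_lift_conj)

lemma rot_lift_add: "rot_lift s (rot_lift t p) = rot_lift (s + t) p"
  by (simp add: rot_lift_def add_ac)

lemma F_lift_add: "F_lift \<sigma> q n s (F_lift \<sigma> q n t p) = F_lift \<sigma> q n (s + t) p"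
  by (simp add: F_lift_def H_lift_inverse rot_lift_add)

lemma F_lift_0: "F_lift \<sigma> q n 0 p = p"
  by (simp add: F_lift_def H_lift_inverse rot_lift_def)

lemma cos_add_2pi_int: "cos (z + of_real (2 * pi * of_int n)) = cos (z :: 'a::{real_normed_field,banach})"
proof -
  have "cos (of_real (2 * pi * of_int n)) = (1 :: 'a)" "sin (of_real (2 * pi * of_int n)) = (0 :: 'a)"
    by (simp_all only: cos_of_real sin_of_real cos_int_2pin sin_int_2pin of_real_1 of_real_0)
  then show ?thesis by (simp only: cos_add) simp
qed

text \<open>
  The map \<open>h\<close> commutes with rotations by multiples of \<open>1 / q\<close>.
\<close>

lemma Phi_rational:
  assumes "of_int q * r = of_int m"
  shows "Phi k q (r + s) p = rot_lift r (Phi k q s p)"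
proof -
  have "of_real (2 * pi) * of_int q * (fst p - of_int k * snd p + of_real (r + s)) =
      of_real (2 * pi) * of_int q * (fst p - of_int k * snd p + of_real s) + of_real (2 * pi * (of_int q * r))"
    by (simp add: algebra_simps)
  then have "Delta k q (r + s) p = Delta k q s p"
    unfolding Delta_def assms by (simp only: cos_add_2pi_int)
  then show ?thesis by (simp add: Phi_def rot_lift_def algebra_simps)
qed

text \<open>Every strip goes into some strip, with a Lipschitz constant valid there. A map such as
  \<open>phi_lift\<close> is in general not globally Lipschitz on the complex plane, since the
  cosine grows exponentially with the imaginary part; this local form is stable under
  composition.\<close>

definition tame :: "(complex \<times> complex \<Rightarrow> complex \<times> complex) \<Rightarrow> bool" where
  "tame L \<longleftrightarrow> (\<forall>R>0. \<exists>R' C. R' > 0 \<and> C > 0 \<and> (\<forall>z\<in>strip R. L z \<in> strip R') \<and>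
     (\<forall>z\<in>strip R. \<forall>w\<in>strip R. norm (L z - L w) \<le> C * norm (z - w)))"

lemma tameI:
  assumes "\<And>R. R > 0 \<Longrightarrow> \<exists>R' C. R' > 0 \<and> C > 0 \<and> (\<forall>z\<in>strip R. L z \<in> strip R') \<and>
     (\<forall>z\<in>strip R. \<forall>w\<in>strip R. norm (L z - L w) \<le> C * norm (z - w))"
  shows "tame L"
  using assms by (simp only: tame_def) blast

lemma tame_witness:
  assumes "R' > 0" "C > 0" "\<And>z. z \<in> strip R \<Longrightarrow> L z \<in> strip R'"
    "\<And>z w. z \<in> strip R \<Longrightarrow> w \<in> strip R \<Longrightarrow> norm (L z - L w) \<le> C * norm (z - w)"
  shows "\<exists>R' C. R' > 0 \<and> C > 0 \<and> (\<forall>z\<in>strip R. L z \<in> strip R') \<and>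
     (\<forall>z\<in>strip R. \<forall>w\<in>strip R. norm (L z - L w) \<le> C * norm (z - w))"
  using assms by blast

lemma tameD:
  assumes "tame L" "R > 0"
  shows "\<exists>R' C. R' > 0 \<and> C > 0 \<and> (\<forall>z\<in>strip R. L z \<in> strip R') \<and>
     (\<forall>z\<in>strip R. \<forall>w\<in>strip R. norm (L z - L w) \<le> C * norm (z - w))"
  using assms by (simp only: tame_def)

lemma tame_comp:
  assumes "tame L" "tame K"
  shows "tame (L \<circ> K)"
proof (rule tameI)
  fix R :: real assume "R > 0"
  obtain R1 C1 where K: "R1 > 0" "C1 > 0" "\<forall>z\<in>strip R. K z \<in> strip R1"
    "\<forall>z\<in>strip R. \<forall>w\<in>strip R. norm (K z - K w) \<le> C1 * norm (z - w)"
    using tameD[OF assms(2) \<open>R > 0\<close>] by blast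
  obtain R2 C2 where L: "R2 > 0" "C2 > 0" "\<forall>z\<in>strip R1. L z \<in> strip R2"
    "\<forall>z\<in>strip R1. \<forall>w\<in>strip R1. norm (L z - L w) \<le> C2 * norm (z - w)"
    using tameD[OF assms(1) \<open>R1 > 0\<close>] by blast
  have "norm (L (K z) - L (K w)) \<le> C2 * C1 * norm (z - w)" if "z \<in> strip R" "w \<in> strip R" for z w
  proof -
    have "norm (L (K z) - L (K w)) \<le> C2 * norm (K z - K w)" using L(4) K(3) that by blast
    also have "\<dots> \<le> C2 * (C1 * norm (z - w))" using K(4) that L(2) by (intro mult_left_mono) auto
    finally show ?thesis by (simp add: mult.assoc)
  qed
  then show "\<exists>R' C. R' > 0 \<and> C > 0 \<and> (\<forall>z\<in>strip R. (L \<circ> K) z \<in> strip R') \<and>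
     (\<forall>z\<in>strip R. \<forall>w\<in>strip R. norm ((L \<circ> K) z - (L \<circ> K) w) \<le> C * norm (z - w))"
    using L(1-3) K(2,3) by (intro tame_witness[of R2 "C2 * C1"]) simp_all
qed

lemma norm_prod_le: "norm p \<le> norm (fst p) + norm (snd p)"
  for p :: "'a::real_normed_vector \<times> 'b::real_normed_vector"
  by (metis norm_Pair_le prod.collapse)

lemma tame_id: "tame id"
proof (rule tameI)
  fix R :: real assume "R > 0"
  then show "\<exists>R' C. R' > 0 \<and> C > 0 \<and> (\<forall>z\<in>strip R. id z \<in> strip R') \<and>
     (\<forall>z\<in>strip R. \<forall>w\<in>strip R. norm (id z - id w) \<le> C * norm (z - w))"
    by (intro tame_witness[of R 1]) simp_all
qed

lemma tame_shear_lift: "tame (shear_lift k)"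
proof (rule tameI)
  fix R :: real assume R: "R > 0"
  let ?c = "1 + \<bar>of_int k\<bar> :: real"
  have "shear_lift k z \<in> strip (?c * R)" if "z \<in> strip R" for z
  proof -
    have z: "\<bar>Im (fst z)\<bar> < R" "\<bar>Im (snd z)\<bar> < R" using that by (auto simp: strip_def)
    have "\<bar>of_int k * Im (snd z)\<bar> \<le> \<bar>of_int k\<bar> * R"
      using z by (simp add: abs_mult mult_left_mono)
    moreover have "?c * R = R + \<bar>of_int k\<bar> * R" "0 \<le> \<bar>of_int k :: real\<bar> * R" using R by (auto simp: distrib_right)
    ultimately have "\<bar>Im (fst z) + of_int k * Im (snd z)\<bar> < ?c * R" "\<bar>Im (snd z)\<bar> < ?c * R"
      using z abs_triangle_ineq[of "Im (fst z)" "of_int k * Im (snd z)"] by linarith+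
    then show ?thesis
      unfolding shear_lift_def strip_def by simp
  qed
  moreover have "norm (shear_lift k z - shear_lift k w) \<le> (2 + \<bar>of_int k\<bar>) * norm (z - w)" for z w :: "complex \<times> complex"
  proof -
    have "norm (shear_lift k z - shear_lift k w) \<le>
        norm (fst (z - w) + of_int k * snd (z - w)) + norm (snd (z - w))"
      using norm_prod_le[of "shear_lift k z - shear_lift k w"] by (simp add: shear_lift_def algebra_simps)
    also have "norm (fst (z - w) + of_int k * snd (z - w)) \<le> norm (z - w) + \<bar>of_int k\<bar> * norm (z - w)"
      by (intro norm_triangle_mono) (auto simp: norm_mult norm_fst_le_norm norm_snd_le_norm mult_left_mono simp del: fst_diff snd_diff)
    finally show ?thesis
      using norm_snd_le_norm[of "z - w"] by (simp add: distrib_right del: snd_diff)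
  qed
  moreover have "0 < ?c * R" "0 < 2 + \<bar>of_int k :: real\<bar>"
    using R by (auto intro: mult_pos_pos add_pos_nonneg)
  ultimately show "\<exists>R' C. R' > 0 \<and> C > 0 \<and> (\<forall>z\<in>strip R. shear_lift k z \<in> strip R') \<and>
     (\<forall>z\<in>strip R. \<forall>w\<in>strip R. norm (shear_lift k z - shear_lift k w) \<le> C * norm (z - w))"
    by (intro tame_witness[of "?c * R" "2 + \<bar>of_int k\<bar>"])
qed

lemma norm_sin_cos_le:
  "norm (sin z) \<le> exp \<bar>Im z\<bar>" "norm (cos z) \<le> exp \<bar>Im z\<bar>" for z :: complex
proof -
  have e: "norm (exp (\<i> * z)) \<le> exp \<bar>Im z\<bar>" "norm (exp (- (\<i> * z))) \<le> exp \<bar>Im z\<bar>"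
    by (simp_all add: norm_exp_eq_Re)
  have "norm (exp (\<i> * z) - exp (- (\<i> * z))) \<le> exp \<bar>Im z\<bar> + exp \<bar>Im z\<bar>"
    by (rule order_trans[OF norm_triangle_ineq4 add_mono[OF e]])
  then show "norm (sin z) \<le> exp \<bar>Im z\<bar>"
    by (simp add: sin_exp_eq norm_divide norm_mult)
  have "norm (exp (\<i> * z) + exp (- (\<i> * z))) \<le> exp \<bar>Im z\<bar> + exp \<bar>Im z\<bar>"
    by (rule order_trans[OF norm_triangle_ineq add_mono[OF e]])
  then show "norm (cos z) \<le> exp \<bar>Im z\<bar>"
    by (simp add: cos_exp_eq norm_divide)
qed

lemma cos_Lipschitz_band:
  assumes "\<bar>Im z\<bar> \<le> Y" "\<bar>Im w\<bar> \<le> Y"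
  shows "norm (cos z - cos w) \<le> exp Y * norm (z - w)"
proof (rule field_differentiable_bound[where S = "{z. \<bar>Im z\<bar> \<le> Y}"])
  have "{z. \<bar>Im z\<bar> \<le> Y} = {z. Im z \<le> Y} \<inter> {z. Im z \<ge> - Y}" by auto
  then show "convex {z. \<bar>Im z\<bar> \<le> Y}"
    by (simp add: convex_Int convex_halfspace_Im_le convex_halfspace_Im_ge)
  show "(cos has_field_derivative - sin z) (at z within {z. \<bar>Im z\<bar> \<le> Y})" for z :: complex
    by (auto intro!: derivative_eq_intros)
  show "norm (- sin z) \<le> exp Y" if "z \<in> {z. \<bar>Im z\<bar> \<le> Y}" for z :: complex
    using norm_sin_cos_le(1)[of z] that by (simp add: order_trans[OF norm_sin_cos_le(1)])
qed (use assms in auto)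

lemma tame_phi_lift: "tame (phi_lift c q)"
proof (rule tameI)
  fix R :: real assume R: "R > 0"
  define Y where "Y = 2 * pi * \<bar>of_int q\<bar> * R"
  have Im: "\<bar>Im (of_real (2 * pi) * of_int q * fst z)\<bar> \<le> Y" if "z \<in> strip R" for z
  proof -
    have "\<bar>Im (fst z)\<bar> \<le> R" using that by (auto simp: strip_def)
    then have "2 * pi * \<bar>of_int q\<bar> * \<bar>Im (fst z)\<bar> \<le> Y" unfolding Y_def by (intro mult_left_mono) auto
    then show ?thesis by (simp add: abs_mult)
  qed
  define R' where "R' = R + \<bar>c\<bar> * exp Y"
  define C where "C = 2 + \<bar>c\<bar> * exp Y * (2 * pi * \<bar>of_int q\<bar>)"
  have C: "C > 0" unfolding C_def by (intro add_pos_nonneg) auto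
  have "phi_lift c q z \<in> strip R'" if z: "z \<in> strip R" for z
  proof -
    let ?w = "of_real (2 * pi) * of_int q * fst z"
    have "\<bar>Im (of_real c * cos ?w)\<bar> \<le> norm (of_real c * cos ?w)" by (rule abs_Im_le_cmod)
    also have "\<dots> \<le> \<bar>c\<bar> * exp Y"
      unfolding norm_mult norm_of_real using Im[OF z]
      by (intro mult_left_mono order_trans[OF norm_sin_cos_le(2)]) auto
    finally have "\<bar>Im (of_real c * cos ?w)\<bar> \<le> \<bar>c\<bar> * exp Y" .
    moreover have "\<bar>Im (fst z)\<bar> < R" "\<bar>Im (snd z)\<bar> < R" using z by (auto simp: strip_def)
    moreover have "0 \<le> \<bar>c\<bar> * exp Y" by simp
    ultimately have "\<bar>Im (fst z)\<bar> < R'" "\<bar>Im (snd z + of_real c * cos ?w)\<bar> < R'"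
      unfolding R'_def plus_complex.sel by linarith+
    then show ?thesis by (simp add: strip_def phi_lift_def)
  qed
  moreover have "norm (phi_lift c q z - phi_lift c q w) \<le> C * norm (z - w)"
    if "z \<in> strip R" "w \<in> strip R" for z w
  proof -
    let ?t = "\<lambda>z :: complex \<times> complex. of_real (2 * pi) * of_int q * fst z"
    have "norm (cos (?t z) - cos (?t w)) \<le> exp Y * norm (?t z - ?t w)"
      by (intro cos_Lipschitz_band Im that)
    also have "?t z - ?t w = of_real (2 * pi) * of_int q * fst (z - w)" by (simp add: algebra_simps)
    also have "norm \<dots> = 2 * pi * \<bar>of_int q\<bar> * norm (fst (z - w))"
      by (simp add: norm_mult del: fst_diff)
    also have "exp Y * \<dots> \<le> exp Y * (2 * pi * \<bar>of_int q\<bar> * norm (z - w))"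
      by (intro mult_left_mono norm_fst_le_norm) auto
    finally have "\<bar>c\<bar> * norm (cos (?t z) - cos (?t w)) \<le> \<bar>c\<bar> * (exp Y * (2 * pi * \<bar>of_int q\<bar> * norm (z - w)))"
      by (intro mult_left_mono) auto
    then have 1: "norm (of_real c * (cos (?t z) - cos (?t w))) \<le> \<bar>c\<bar> * exp Y * (2 * pi * \<bar>of_int q\<bar>) * norm (z - w)"
      by (simp add: norm_mult mult.assoc)
    have "norm (phi_lift c q z - phi_lift c q w) \<le>
        norm (fst (z - w)) + norm (snd (z - w) + of_real c * (cos (?t z) - cos (?t w)))"
      using norm_prod_le[of "phi_lift c q z - phi_lift c q w"] by (simp add: phi_lift_def algebra_simps)
    also have "\<dots> \<le> norm (z - w) + (norm (z - w) + \<bar>c\<bar> * exp Y * (2 * pi * \<bar>of_int q\<bar>) * norm (z - w))"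
      by (intro add_mono norm_triangle_mono norm_fst_le_norm norm_snd_le_norm 1)
    finally show ?thesis by (simp add: C_def algebra_simps)
  qed
  moreover have "R' > 0" using R by (simp add: R'_def add_pos_nonneg)
  ultimately show "\<exists>R' C. R' > 0 \<and> C > 0 \<and> (\<forall>z\<in>strip R. phi_lift c q z \<in> strip R') \<and>
     (\<forall>z\<in>strip R. \<forall>w\<in>strip R. norm (phi_lift c q z - phi_lift c q w) \<le> C * norm (z - w))"
    using C by (intro tame_witness[of R' C])
qed

lemma tame_H_lift: "tame (H_lift \<sigma> q n)" "tame (H_inv \<sigma> q n)"
  by (induction n) (auto simp: h_lift_def h_inv_def intro!: tame_comp tame_id tame_shear_lift tame_phi_lift)

text \<open>The shear stretches imaginary parts by at most \<open>1 + \<bar>k\<bar>\<close>, which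
  enters the Lipschitz constant of the cosine through the exponential. With \<open>k\<close> about
  \<open>n * q powr \<sigma>\<close> this is growth of the order
  \<open>exp (C * n * q powr (1 + \<sigma>))\<close>.\<close>

lemma Delta_bound:
  assumes "z \<in> strip R" "q \<ge> 1"
  shows "norm (Delta k q s z) \<le> (of_int q)\<^sup>2 * (exp (2 * pi * of_int q * (1 + \<bar>of_int k\<bar>) * R) * (2 * pi * of_int q * \<bar>s\<bar>))"
proof -
  let ?u = "fst z - of_int k * snd z"
  have z: "\<bar>Im (fst z)\<bar> \<le> R" "\<bar>Im (snd z)\<bar> \<le> R" using assms by (auto simp: strip_def)
  have "\<bar>Im ?u\<bar> \<le> \<bar>Im (fst z)\<bar> + \<bar>of_int k * Im (snd z)\<bar>" by simp
  also have "\<dots> \<le> R + \<bar>of_int k\<bar> * R" using z by (simp add: abs_mult add_mono mult_left_mono)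
  finally have u: "\<bar>Im ?u\<bar> \<le> (1 + \<bar>of_int k\<bar>) * R" by (simp add: distrib_right)
  have Im: "\<bar>Im (of_real (2 * pi) * of_int q * (?u + of_real t))\<bar> \<le> 2 * pi * of_int q * (1 + \<bar>of_int k\<bar>) * R" for t
  proof -
    have "2 * pi * of_int q * \<bar>Im ?u\<bar> \<le> 2 * pi * of_int q * ((1 + \<bar>of_int k\<bar>) * R)"
      using u assms(2) by (intro mult_left_mono) auto
    then show ?thesis using assms(2) by (simp add: abs_mult mult.assoc)
  qed
  have "norm (cos (of_real (2 * pi) * of_int q * (?u + of_real s)) - cos (of_real (2 * pi) * of_int q * ?u))
    \<le> exp (2 * pi * of_int q * (1 + \<bar>of_int k\<bar>) * R) *
      norm (of_real (2 * pi) * of_int q * (?u + of_real s) - of_real (2 * pi) * of_int q * ?u)"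
    using Im[of s] Im[of 0] by (intro cos_Lipschitz_band) auto
  also have "of_real (2 * pi) * of_int q * (?u + of_real s) - of_real (2 * pi) * of_int q * ?u =
      of_real (2 * pi * of_int q * s)"
    by (simp add: algebra_simps)
  also have "norm (of_real (2 * pi * of_int q * s) :: complex) = 2 * pi * of_int q * \<bar>s\<bar>"
    using assms(2) unfolding norm_of_real by (simp add: abs_mult)
  finally show ?thesis
    unfolding Delta_def norm_mult norm_power by (intro mult_mono) (use assms(2) in auto)
qed

text \<open>The first factor collects all error terms of \<open>approximation_step\<close>. Its
  exponent grows like \<open>x powr (1 + \<sigma>)\<close> and is beaten by
  \<open>x powr (1 + \<delta>)\<close>: here \<open>\<sigma>\<close> is compared with
  \<open>\<delta>\<close>.\<close>

lemma superexponential_limit: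
  fixes c R \<sigma> \<delta> :: real
  assumes "0 < \<sigma>" "\<sigma> < \<delta>" "c > 0" "R > 0"
  shows "((\<lambda>x. (2 * x + (c * x powr \<sigma> + 1) * (4 * pi * x ^ 4 * exp (2 * pi * x * (1 + c * x powr \<sigma>) * R)))
     * exp (- (x powr (1 + \<delta>)))) \<longlongrightarrow> 0) at_top"
  using assms by real_asymp

lemma eventually_at_top_real_of_int:
  assumes "\<forall>\<^sub>F x :: real in at_top. P x"
  shows "\<forall>\<^sub>F q :: int in at_top. P (of_int q)"
proof -
  obtain X where X: "\<And>x. x \<ge> X \<Longrightarrow> P x"
    using assms unfolding eventually_at_top_linorder by blast
  have "P (of_int q)" if "q \<ge> \<lceil>X\<rceil>" for q
    using that by (intro X) linarith
  then show ?thesis unfolding eventually_at_top_linorder by blast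
qed

lemma shear_number_bounds:
  assumes "q \<ge> 1"
  shows "0 \<le> shear_number \<sigma> n q" "of_int (shear_number \<sigma> n q) \<le> real n * of_int q powr \<sigma>"
  by (auto simp: shear_number_def)

text \<open>The assumptions \<open>n \<ge> 1\<close> and \<open>\<sigma> > 0\<close> make the shear
  coefficient tend to infinity with \<open>q\<close>, so that it passes the threshold in
  \<open>asymp_mixing\<close>.\<close>

lemma shear_number_at_top:
  assumes "n \<ge> 1" "\<sigma> > 0"
  shows "\<forall>\<^sub>F q in at_top. K \<le> shear_number \<sigma> n q"
proof -
  have "filterlim (\<lambda>x :: real. x powr \<sigma>) at_top at_top"
    using assms(2) by real_asymp
  then have "\<forall>\<^sub>F x :: real in at_top. x powr \<sigma> \<ge> of_int K"
    unfolding filterlim_at_top by blast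
  from eventually_at_top_real_of_int[OF this] show ?thesis
  proof (rule eventually_mono)
    fix q :: int assume "of_int K \<le> of_int q powr \<sigma>"
    also have "\<dots> \<le> real n * of_int q powr \<sigma>"
      using assms(1) mult_right_mono[of 1 "real n" "of_int q powr \<sigma>"] by simp
    finally show "K \<le> shear_number \<sigma> n q"
      unfolding shear_number_def by linarith
  qed
qed

lemma rot_lift_strip: "rot_lift t z \<in> strip R \<longleftrightarrow> z \<in> strip R"
  by (simp add: rot_lift_def strip_eq band_def mem_Times_iff)

lemma strip_perturb:
  assumes "z \<in> strip R" "norm (w - z) \<le> 1"
  shows "w \<in> strip (R + 1)"
proof -
  have "\<bar>Im (fst (w - z))\<bar> \<le> 1" "\<bar>Im (snd (w - z))\<bar> \<le> 1"
    using assms(2) norm_fst_le_norm[of "w - z"] norm_snd_le_norm[of "w - z"]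
      abs_Im_le_cmod[of "fst (w - z)"] abs_Im_le_cmod[of "snd (w - z)"] by linarith+
  then have "\<bar>Im (fst w) - Im (fst z)\<bar> \<le> 1" "\<bar>Im (snd w) - Im (snd z)\<bar> \<le> 1" by simp_all
  moreover have "\<bar>Im (fst z)\<bar> < R" "\<bar>Im (snd z)\<bar> < R"
    using assms(1) by (auto simp: strip_eq band_def)
  ultimately have "\<bar>Im (fst w)\<bar> < R + 1" "\<bar>Im (snd w)\<bar> < R + 1" by linarith+
  then show ?thesis by (simp add: strip_eq band_def mem_Times_iff)
qed

text \<open>\<open>L\<close> and \<open>L'\<close> will be the conjugacy of the preceding stage and
  its inverse, both fixed before \<open>q\<close>. The quantifiers over \<open>m\<close>,
  \<open>p\<close> and \<open>a\<close> stand inside the eventuality because \<open>a\<close> will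
  be the next rational, not yet known. The factor 2 arises since both \<open>a\<close> and
  \<open>p / q\<close> approximate the same number.\<close>

lemma approximation_step:
  assumes L: "tame L" "tame L'" and \<sigma>: "0 < \<sigma>" "\<sigma> < \<delta>" and \<rho>: "\<rho> > 0" and e: "e > 0"
  shows "\<forall>\<^sub>F q in at_top. \<forall>(m :: int) (p :: int) a. \<bar>m\<bar> \<le> q \<longrightarrow>
    \<bar>a - of_int p / of_int q\<bar> \<le> 2 * exp (- (of_int q powr (1 + \<delta>))) \<longrightarrow>
    (\<forall>z\<in>strip \<rho>. norm (L (Phi (shear_number \<sigma> n q) q (of_int m * a) (L' z)) -
       L (rot_lift (of_int m * (of_int p / of_int q)) (L' z))) \<le> e)"
proof -
  obtain R C' where R: "R > 0" "\<forall>z\<in>strip \<rho>. L' z \<in> strip R"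
    using tameD[OF L(2) \<rho>] by blast
  \<comment> \<open>A margin of 1, because a perturbation of size \<open>\<eta> \<le> 1\<close> may
    leave the strip of width \<open>R\<close>.\<close>
  have "R + 1 > 0" using R by simp
  obtain C R' where C: "C > 0" "\<forall>z\<in>strip (R + 1). \<forall>w\<in>strip (R + 1). norm (L z - L w) \<le> C * norm (z - w)"
    using tameD[OF L(1) \<open>R + 1 > 0\<close>] by blast
  define \<eta> where "\<eta> = min 1 (e / C)"
  have \<eta>: "\<eta> > 0" "\<eta> \<le> 1" "C * \<eta> \<le> e"
    using e C(1) by (auto simp: \<eta>_def min_def field_simps)
  \<comment> \<open>Positive even for \<open>n = 0\<close>, as \<open>superexponential_limit\<close>
    requires.\<close>
  define c where "c = real n + 1"
  define \<tau> where "\<tau> = (\<lambda>x. (2 * x + (c * x powr \<sigma> + 1) * (4 * pi * x ^ 4 * exp (2 * pi * x * (1 + c * x powr \<sigma>) * R)))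
     * exp (- (x powr (1 + \<delta>))))"
  have "(\<tau> \<longlongrightarrow> 0) at_top"
    unfolding \<tau>_def using \<sigma> R(1) by (intro superexponential_limit) (auto simp: c_def)
  then have "\<forall>\<^sub>F x in at_top. \<tau> x < \<eta>"
    using \<eta>(1) by (rule order_tendstoD)
  then have ev: "\<forall>\<^sub>F q :: int in at_top. \<tau> (of_int q) < \<eta>"
    by (rule eventually_at_top_real_of_int)
  show ?thesis
    using eventually_conj[OF ev eventually_ge_at_top[of "1 :: int"]]
  proof (rule eventually_mono, intro allI impI ballI)
    fix q m p :: int and a z
    assume q: "\<tau> (of_int q) < \<eta> \<and> 1 \<le> q" and m: "\<bar>m\<bar> \<le> q"
      and a: "\<bar>a - of_int p / of_int q\<bar> \<le> 2 * exp (- (of_int q powr (1 + \<delta>)))" and z: "z \<in> strip \<rho>"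
    define k where "k = shear_number \<sigma> n q"
    define x where "x = (of_int q :: real)"
    define E where "E = exp (- (x powr (1 + \<delta>)))"
    \<comment> \<open>The time \<open>m * a\<close> splits into a multiple \<open>r\<close> of
      \<open>1 / q\<close>, which passes through \<open>Phi\<close> as a rotation, and a tiny rest
      \<open>s\<close>. The bound \<open>\<bar>m\<bar> \<le> q\<close> costs just a factor
      \<open>q\<close> in \<open>s\<close>.\<close>
    define r where "r = of_int m * (of_int p / x)"
    define s where "s = of_int m * (a - of_int p / x)"
    define w where "w = L' z"
    have x: "x \<ge> 1" using q by (simp add: x_def)
    have w: "w \<in> strip R" using R z by (simp add: w_def)
    have k: "\<bar>of_int k\<bar> \<le> c * x powr \<sigma>"
    proof -
      have "of_int k \<le> real n * x powr \<sigma>" "0 \<le> k"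
        using shear_number_bounds[of q \<sigma> n] q by (auto simp: k_def x_def)
      moreover have "real n * x powr \<sigma> \<le> c * x powr \<sigma>" by (intro mult_right_mono) (auto simp: c_def)
      ultimately show ?thesis by simp
    qed
    have s: "\<bar>s\<bar> \<le> x * (2 * E)"
      unfolding s_def abs_mult E_def x_def
    proof (intro mult_mono a)
      show "\<bar>real_of_int m\<bar> \<le> real_of_int q" using m by linarith
    qed (use q in auto)
    have "norm (Delta k q s w) \<le> x\<^sup>2 * (exp (2 * pi * x * (1 + \<bar>of_int k\<bar>) * R) * (2 * pi * x * \<bar>s\<bar>))"
      using Delta_bound[OF w, of q k s] q by (simp add: x_def)
    also have "\<dots> \<le> x\<^sup>2 * (exp (2 * pi * x * (1 + c * x powr \<sigma>) * R) * (2 * pi * x * (x * (2 * E))))"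
      using x k s R(1) by (intro mult_left_mono mult_mono) auto
    also have "\<dots> = (4 * pi * x ^ 4 * exp (2 * pi * x * (1 + c * x powr \<sigma>) * R)) * E"
      by (simp add: power2_eq_square power4_eq_xxxx)
    finally have D: "norm (Delta k q s w) \<le> (4 * pi * x ^ 4 * exp (2 * pi * x * (1 + c * x powr \<sigma>) * R)) * E" .
    have Phi: "Phi k q (of_int m * a) w = rot_lift r (Phi k q s w)"
    proof -
      have "of_int m * a = r + s" by (simp add: r_def s_def algebra_simps)
      moreover have "of_int q * r = of_int (m * p)" using q by (simp add: r_def x_def)
      ultimately show ?thesis using Phi_rational[of q r "m * p" k s w] by simp
    qed
    have "Phi k q s w - w = (of_real s + of_int k * Delta k q s w, Delta k q s w)"
      by (simp add: Phi_def prod_eq_iff)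
    then have "norm (Phi k q s w - w) \<le> norm (of_real s + of_int k * Delta k q s w) + norm (Delta k q s w)"
      by (simp add: norm_Pair_le)
    also have "norm (of_real s + of_int k * Delta k q s w) \<le> \<bar>s\<bar> + \<bar>of_int k\<bar> * norm (Delta k q s w)"
      by (intro norm_triangle_mono) (auto simp: norm_mult)
    also have "\<bar>s\<bar> + \<bar>of_int k\<bar> * norm (Delta k q s w) + norm (Delta k q s w) =
        \<bar>s\<bar> + (\<bar>of_int k\<bar> + 1) * norm (Delta k q s w)"
      by (simp add: algebra_simps)
    also have "\<dots> \<le> x * (2 * E) + (c * x powr \<sigma> + 1) *
        ((4 * pi * x ^ 4 * exp (2 * pi * x * (1 + c * x powr \<sigma>) * R)) * E)"
      using k by (intro add_mono mult_mono s D) (auto simp: c_def)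
    also have "\<dots> = \<tau> x" by (simp add: \<tau>_def E_def algebra_simps)
    finally have "norm (Phi k q s w - w) \<le> \<eta>" using q by (simp add: x_def)
    moreover have "rot_lift r (Phi k q s w) - rot_lift r w = Phi k q s w - w"
      by (simp add: rot_lift_def prod_eq_iff)
    ultimately have d: "norm (rot_lift r (Phi k q s w) - rot_lift r w) \<le> \<eta>" by simp
    have "rot_lift r w \<in> strip R" using w by (simp add: rot_lift_strip)
    moreover from this have "rot_lift r w \<in> strip (R + 1)" by (auto simp: strip_def)
    moreover have "rot_lift r (Phi k q s w) \<in> strip (R + 1)"
      using \<open>rot_lift r w \<in> strip R\<close> d \<eta>(2) by (intro strip_perturb) auto
    ultimately have "norm (L (rot_lift r (Phi k q s w)) - L (rot_lift r w)) \<le> C * norm (rot_lift r (Phi k q s w) - rot_lift r w)"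
      using C(2) by blast
    also have "\<dots> \<le> C * \<eta>" using d C(1) by (intro mult_left_mono) auto
    also have "\<dots> \<le> e" by (rule \<eta>)
    finally show "norm (L (Phi (shear_number \<sigma> n q) q (of_int m * a) (L' z)) -
       L (rot_lift (of_int m * (of_int p / of_int q)) (L' z))) \<le> e"
      unfolding k_def[symmetric] w_def[symmetric] x_def[symmetric] r_def[symmetric] Phi .
  qed
qed

text \<open>\<open>A\<close> is the induced action on the lattice: the identity for
  \<open>phi_lift\<close>, but a unipotent linear map for the shears, so that \<open>H_map\<close>
  is in general not homotopic to the identity. The conjugated rotations are.\<close>

definition lattice_equivariant :: "(real \<times> real \<Rightarrow> real \<times> real) \<Rightarrow> (real \<times> real \<Rightarrow> real \<times> real) \<Rightarrow> bool" where
  "lattice_equivariant L A \<longleftrightarrow> (\<forall>x. \<forall>z\<in>\<int> \<times> \<int>. L (x + z) = L x + A z \<and> A z \<in> \<int> \<times> \<int>)"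

lemma lattice_equivariantD:
  assumes "lattice_equivariant L A" "z \<in> \<int> \<times> \<int>"
  shows "L (x + z) = L x + A z" "A z \<in> \<int> \<times> \<int>"
  using assms unfolding lattice_equivariant_def by blast+

lemma lattice_equivariant_comp:
  assumes "lattice_equivariant L A" "lattice_equivariant K B"
  shows "lattice_equivariant (L \<circ> K) (A \<circ> B)"
  unfolding lattice_equivariant_def o_def
  using lattice_equivariantD[OF assms(1)] lattice_equivariantD[OF assms(2)] by metis

lemma lattice_equivariant_lattice_rel:
  assumes "lattice_equivariant L A" "lattice_rel x y"
  shows "lattice_rel (L x) (L y)"
proof -
  obtain m n where "x = y + (of_int m, of_int n)" using lattice_relE[OF assms(2)] .
  then have "L x - L y = A (of_int m, of_int n)" "A (of_int m, of_int n) \<in> \<int> \<times> \<int>"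
    using lattice_equivariantD(1)[OF assms(1), where z = "(of_int m, of_int n)" and x = y]
      lattice_equivariantD(2)[OF assms(1), where z = "(of_int m, of_int n)"] by auto
  then show ?thesis unfolding lattice_rel_def by (metis fst_diff mem_Times_iff snd_diff)
qed

lemma lattice_equivariant_phi_lift: "lattice_equivariant (phi_lift c q) id"
  unfolding lattice_equivariant_def
proof (intro allI ballI conjI)
  fix x z :: "real \<times> real" assume z: "z \<in> \<int> \<times> \<int>"
  then obtain n where "fst z = of_int n" by (auto elim: Ints_cases)
  then have "cos (2 * pi * of_int q * fst (x + z)) = cos (2 * pi * of_int q * fst x)"
    using cos_2pi_int_shift[of q "fst x" n] by simp
  then show "phi_lift c q (x + z) = phi_lift c q x + id z"
    by (simp add: phi_lift_def prod_eq_iff)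
qed simp

lemma lattice_equivariant_shear_lift: "lattice_equivariant (shear_lift k) (shear_lift k)"
  by (auto simp: lattice_equivariant_def shear_lift_def algebra_simps intro: Ints_add Ints_mult)

lemma lattice_equivariant_H_lift: "\<exists>A. lattice_equivariant (H_lift \<sigma> q n) A" "\<exists>A. lattice_equivariant (H_inv \<sigma> q n) A"
proof (induction n)
  case 0
  show "\<exists>A. lattice_equivariant (H_lift \<sigma> q 0) A" "\<exists>A. lattice_equivariant (H_inv \<sigma> q 0) A"
    by (auto simp: lattice_equivariant_def intro: exI[of _ id])
next
  case (Suc n)
  then show "\<exists>A. lattice_equivariant (H_lift \<sigma> q (Suc n)) A" "\<exists>A. lattice_equivariant (H_inv \<sigma> q (Suc n)) A"
    unfolding H_lift.simps H_inv.simps h_lift_def h_inv_def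
    using lattice_equivariant_comp lattice_equivariant_phi_lift lattice_equivariant_shear_lift by metis+
qed

text \<open>The action on the lattice is the same at every time \<open>t\<close>, and at time 0 the
  map is the identity; so the action is trivial.\<close>

lemma F_lift_shift: "F_lift \<sigma> q n t (x + (of_int m, of_int k)) = F_lift \<sigma> q n t (x :: real \<times> real) + (of_int m, of_int k)"
proof -
  obtain A B where A: "lattice_equivariant (H_lift \<sigma> q n) A" and B: "lattice_equivariant (H_inv \<sigma> q n) B"
    using lattice_equivariant_H_lift by blast
  let ?z = "(of_int m, of_int k) :: real \<times> real"
  have z: "?z \<in> \<int> \<times> \<int>" by simp
  have *: "F_lift \<sigma> q n s (x + ?z) = F_lift \<sigma> q n s x + A (B ?z)" for s
  proof -
    have "H_inv \<sigma> q n (x + ?z) = H_inv \<sigma> q n x + B ?z" "B ?z \<in> \<int> \<times> \<int>"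
      using lattice_equivariantD[OF B z] by blast+
    moreover have "rot_lift s (y + w) = rot_lift s y + w" for y w :: "real \<times> real"
      by (simp add: rot_lift_def prod_eq_iff)
    ultimately show ?thesis
      using lattice_equivariantD(1)[OF A] by (simp only: F_lift_def)
  qed
  from *[of 0] have "A (B ?z) = ?z" by (simp add: F_lift_0)
  then show ?thesis using * by simp
qed

lemma continuous_on_H_lift:
  "continuous_on UNIV (H_lift \<sigma> q n :: real \<times> real \<Rightarrow> _)" "continuous_on UNIV (H_inv \<sigma> q n :: real \<times> real \<Rightarrow> _)"
proof -
  have c: "continuous_on UNIV (shear_lift k :: real \<times> real \<Rightarrow> _)" "continuous_on UNIV (phi_lift c q :: real \<times> real \<Rightarrow> _)" for k c q
    unfolding shear_lift_def[abs_def] phi_lift_def[abs_def] by (intro continuous_intros)+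
  show "continuous_on UNIV (H_lift \<sigma> q n :: real \<times> real \<Rightarrow> _)" "continuous_on UNIV (H_inv \<sigma> q n :: real \<times> real \<Rightarrow> _)"
  proof (induction n)
    case 0
    show "continuous_on UNIV (H_lift \<sigma> q 0 :: real \<times> real \<Rightarrow> _)" "continuous_on UNIV (H_inv \<sigma> q 0 :: real \<times> real \<Rightarrow> _)"
      by simp_all
  next
    case (Suc n)
    show "continuous_on UNIV (H_lift \<sigma> q (Suc n) :: real \<times> real \<Rightarrow> _)"
      unfolding H_lift.simps h_lift_def o_def
      by (intro continuous_on_compose2[OF Suc(1)] continuous_on_compose2[OF c(1)] c subset_UNIV)
    show "continuous_on UNIV (H_inv \<sigma> q (Suc n) :: real \<times> real \<Rightarrow> _)"
      unfolding H_inv.simps h_inv_def o_def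
      by (intro continuous_on_compose2[OF c(2)] continuous_on_compose2[OF c(1)] Suc subset_UNIV)
  qed
qed

lemma H_lift_lattice_rel:
  assumes "lattice_rel x y"
  shows "lattice_rel (H_lift \<sigma> q n x) (H_lift \<sigma> q n y)" "lattice_rel (H_inv \<sigma> q n x) (H_inv \<sigma> q n y)"
  using lattice_equivariant_H_lift[of \<sigma> q n] assms by (blast intro: lattice_equivariant_lattice_rel)+

lemma torus_periodic_H_lift: "torus_periodic u \<Longrightarrow> torus_periodic (\<lambda>x. u (H_lift \<sigma> q n x))"
  by (rule torus_periodic_comp) (auto intro: H_lift_lattice_rel)

lemma continuous_on_comp_H_lift:
  "continuous_on UNIV u \<Longrightarrow> continuous_on UNIV (\<lambda>x. u (H_lift \<sigma> q n (x :: real \<times> real)))"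
  by (rule continuous_on_compose2) (auto intro: continuous_on_H_lift)

lemma continuous_on_F_lift: "continuous_on UNIV (F_lift \<sigma> q n t :: real \<times> real \<Rightarrow> _)"
proof -
  have r: "continuous_on UNIV (rot_lift t :: real \<times> real \<Rightarrow> _)"
    unfolding rot_lift_def[abs_def] by (intro continuous_intros)
  show ?thesis
    unfolding F_lift_def[abs_def]
    by (intro continuous_on_compose2[OF continuous_on_H_lift(1)] continuous_on_compose2[OF r] continuous_on_H_lift subset_UNIV)
qed

text \<open>Each factor of \<open>H_lift\<close> is a skew translation. The lemma is used both for
  the invariance of area under \<open>f_n\<close> and as a change of variables in
  correlations.\<close>

lemma square_integral_H_lift:
  assumes "continuous_on UNIV u" "torus_periodic u"
  shows "square_integral (\<lambda>x. u (H_lift \<sigma> q n x)) = square_integral u"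
  using assms
proof (induction n arbitrary: u)
  case (Suc n)
  define k where "k = shear_number \<sigma> (Suc n) (q (Suc n))"
  define c where "c = (of_int (q (Suc n)) :: real)\<^sup>2"
  have phi: "square_integral (\<lambda>x. v (phi_lift c (q (Suc n)) x)) = square_integral v"
    if "continuous_on UNIV v" "torus_periodic v" for v
    using square_integral_skew(1)[OF that, of "\<lambda>x. c * cos (2 * pi * of_int (q (Suc n)) * x)"]
    by (simp add: phi_lift_def split_def continuous_intros)
  have shear: "square_integral (\<lambda>x. v (shear_lift k x)) = square_integral v"
    if "continuous_on UNIV v" "torus_periodic v" for v
    using square_integral_skew(2)[OF that, of "\<lambda>y. of_int k * y"]
    by (simp add: shear_lift_def split_def continuous_intros)
  let ?v = "\<lambda>x. u (H_lift \<sigma> q n x)"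
  have v: "continuous_on UNIV ?v" "torus_periodic ?v"
    using Suc.prems by (auto intro: continuous_on_comp_H_lift torus_periodic_H_lift)
  have "continuous_on UNIV (shear_lift k :: real \<times> real \<Rightarrow> _)"
    unfolding shear_lift_def[abs_def] by (intro continuous_intros)
  then have v': "continuous_on UNIV (\<lambda>x. ?v (shear_lift k x))" "torus_periodic (\<lambda>x. ?v (shear_lift k x))"
    using continuous_on_compose2[OF v(1)] torus_periodic_comp[OF v(2), of "shear_lift k"]
      lattice_equivariant_lattice_rel[OF lattice_equivariant_shear_lift] by auto
  show ?case
    using phi[OF v'] shear[OF v] Suc.IH[OF Suc.prems] by (simp add: h_lift_def k_def c_def)
qed simp

abbreviation char_defect ::
    "real \<Rightarrow> (nat \<Rightarrow> int) \<Rightarrow> nat \<Rightarrow> nat \<Rightarrow> int \<Rightarrow> real \<Rightarrow> int \<Rightarrow> int \<Rightarrow> int \<Rightarrow> int \<Rightarrow> real" where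
  "char_defect \<sigma> q m n k t a b c d \<equiv>
     norm (square_integral (\<lambda>x. torus_char a b (H_lift \<sigma> q m (Phi (shear_number \<sigma> n k) k t x)) *
       torus_char c d (H_lift \<sigma> q m x)) - square_integral (torus_char a b) * square_integral (torus_char c d))"

text \<open>Composed with the fixed \<open>H_lift\<close>, a character becomes some continuous
  periodic function with the same mean, to which \<open>asymp_mixing_continuous\<close> applies.
  Only finitely many characters are treated at once, so their thresholds have a common
  bound.\<close>

lemma mixing_step:
  assumes "n \<ge> 1" "\<sigma> > 0" "e > 0"
  shows "\<forall>\<^sub>F k in at_top. \<forall>a\<in>{-j..j}. \<forall>b\<in>{-j..j}. \<forall>c\<in>{-j..j}. \<forall>d\<in>{-j..j}. \<forall>t. \<bar>sin (pi * of_int k * t)\<bar> \<ge> 1/2 \<longrightarrow>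
    char_defect \<sigma> q m n k t a b c d \<le> e"
proof (intro eventually_ball_finite ballI)
  fix a b c d :: int
  define u where "u = (\<lambda>a b x. torus_char a b (H_lift \<sigma> q m x))"
  have u: "continuous_on UNIV (u a b)" "torus_periodic (u a b)" "square_integral (u a b) = square_integral (torus_char a b)" for a b
    unfolding u_def
    by (intro continuous_on_comp_H_lift torus_periodic_H_lift square_integral_H_lift continuous_torus_char
        torus_periodic_torus_char)+
  have "asymp_mixing (u a b) (u c d)" by (intro asymp_mixing_continuous u)
  then obtain K where K: "\<forall>k s t. K \<le> k \<longrightarrow> K \<le> s \<longrightarrow> \<bar>sin (pi * of_int k * t)\<bar> \<ge> 1/2 \<longrightarrow>
    correlation_defect (u a b) (u c d) s k t \<le> e"
    using assms(3) unfolding asymp_mixing_def by blast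
  show "\<forall>\<^sub>F k in at_top. \<forall>t. \<bar>sin (pi * of_int k * t)\<bar> \<ge> 1/2 \<longrightarrow>
    char_defect \<sigma> q m n k t a b c d \<le> e"
    using eventually_conj[OF eventually_ge_at_top[of K] shear_number_at_top[OF assms(1,2), of K]]
    by (rule eventually_mono) (use K[unfolded u(3), unfolded u_def] in blast)
qed auto

section \<open>Lifts of the torus maps, complexification and holomorphy\<close>

lemma is_lift_comp: "is_lift F f \<Longrightarrow> is_lift G g \<Longrightarrow> is_lift (F \<circ> G) (f \<circ> g)"
  by (simp only: is_lift_def o_apply simp_thms)

lemma is_lift_funpow: "is_lift F f \<Longrightarrow> is_lift (F ^^ n) (f ^^ n)"
  by (induction n) (simp_all add: is_lift_comp is_lift_def[of id])

definition torus_map :: "(real \<times> real \<Rightarrow> real \<times> real) \<Rightarrow> torus \<Rightarrow> torus" where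
  "torus_map F t = torus_proj (F (torus_rep t))"

lemma is_lift_torus_map:
  assumes "\<And>x y. lattice_rel x y \<Longrightarrow> lattice_rel (F x) (F y)"
  shows "is_lift F (torus_map F)"
proof -
  have "lattice_rel (torus_rep (torus_proj x)) x" for x
    by (simp flip: torus.abs_eq_iff)
  then show ?thesis
    using assms by (simp add: is_lift_def torus_map_def torus.abs_eq_iff)
qed

lemma is_lift_rotation: "is_lift (rot_lift t) (torus_rotation t)"
  by (simp add: is_lift_def torus_rotation.abs_eq rot_lift_def split_beta)

lemma is_lift_h_map: "is_lift (h_lift (shear_number \<sigma> n (q n)) (q n)) (h_map \<sigma> q n)"
  unfolding h_lift_def h_map_def shear_number_def
  by (intro is_lift_comp) (simp_all add: is_lift_def torus_phi.abs_eq torus_shear.abs_eq phi_lift_def shear_lift_def split_beta)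

lemma is_lift_H_map: "is_lift (H_lift \<sigma> q n) (H_map \<sigma> q n)"
proof (induction n)
  case 0
  show ?case by (simp add: is_lift_def)
next
  case (Suc n)
  then show ?case
    unfolding H_lift.simps H_map.simps by (intro is_lift_comp is_lift_h_map)
qed

lemma is_lift_inv_H_map: "is_lift (H_inv \<sigma> q n) (inv (H_map \<sigma> q n))"
proof -
  have T: "is_lift (H_inv \<sigma> q n) (torus_map (H_inv \<sigma> q n))"
    by (intro is_lift_torus_map H_lift_lattice_rel)
  have "torus_map (H_inv \<sigma> q n) (H_map \<sigma> q n t) = t" "H_map \<sigma> q n (torus_map (H_inv \<sigma> q n) t) = t" for t
    by (rule torus_inverse_if_lifts[OF T is_lift_H_map] torus_inverse_if_lifts[OF is_lift_H_map T],
        simp add: H_lift_inverse)+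
  then have "inv (H_map \<sigma> q n) = torus_map (H_inv \<sigma> q n)"
    by (intro inv_equality) auto
  then show ?thesis using T by simp
qed

lemma F_lift_comp: "F_lift \<sigma> q n t = H_lift \<sigma> q n \<circ> rot_lift t \<circ> H_inv \<sigma> q n"
  by (simp add: F_lift_def fun_eq_iff)

lemma is_lift_f_map: "is_lift (F_lift \<sigma> q n (of_int (p (Suc n)) / of_int (q (Suc n)))) (f_map \<sigma> p q n)"
  unfolding f_map_def F_lift_comp by (intro is_lift_comp is_lift_H_map is_lift_rotation is_lift_inv_H_map)

lemma norm_complexify [simp]: "norm (complexify x) = norm x"
  by (simp add: complexify_def norm_prod_def)

lemma complexify_diff: "complexify (x - y) = complexify x - complexify y"
  by (simp add: complexify_def)

lemma rot_lift_complexify: "rot_lift t (complexify x) = complexify (rot_lift t x)"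
  by (simp add: rot_lift_def complexify_def)

lemma h_lift_complexify: "h_lift k q (complexify x) = complexify (h_lift k q x)"
  "h_inv k q (complexify x) = complexify (h_inv k q x)"
proof -
  have "phi_lift c q (complexify x) = complexify (phi_lift c q x)" for c x
    by (simp add: phi_lift_def complexify_def flip: cos_of_real)
  moreover have "shear_lift k (complexify x) = complexify (shear_lift k x)" for k x
    by (simp add: shear_lift_def complexify_def)
  ultimately show "h_lift k q (complexify x) = complexify (h_lift k q x)"
    "h_inv k q (complexify x) = complexify (h_inv k q x)"
    by (simp_all add: h_lift_def h_inv_def)
qed

lemma H_lift_complexify: "H_lift \<sigma> q n (complexify x) = complexify (H_lift \<sigma> q n x)"
  "H_inv \<sigma> q n (complexify x) = complexify (H_inv \<sigma> q n x)"
  by (induction n arbitrary: x) (simp_all add: h_lift_complexify)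

lemma F_lift_complexify: "F_lift \<sigma> q n t (complexify x) = complexify (F_lift \<sigma> q n t x)"
  by (simp add: F_lift_def H_lift_complexify rot_lift_complexify)

text \<open>A total complex derivative composes by the chain rule, unlike
  \<open>sep_holomorphic\<close>; the conversion is made once, for the whole conjugated
  rotation.\<close>

definition holomorphic_map :: "(complex \<times> complex \<Rightarrow> complex \<times> complex) \<Rightarrow> bool" where
  "holomorphic_map L \<longleftrightarrow> (\<forall>z. \<exists>a b c d. (L has_derivative (\<lambda>(u, v). (a * u + b * v, c * u + d * v))) (at z))"

lemma holomorphic_map_comp:
  assumes "holomorphic_map L" "holomorphic_map K"
  shows "holomorphic_map (L \<circ> K)"
  unfolding holomorphic_map_def
proof
  fix z
  obtain a b c d where K: "(K has_derivative (\<lambda>(u, v). (a * u + b * v, c * u + d * v))) (at z)"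
    using assms(2) unfolding holomorphic_map_def by blast
  obtain a' b' c' d' where L: "(L has_derivative (\<lambda>(u, v). (a' * u + b' * v, c' * u + d' * v))) (at (K z))"
    using assms(1) unfolding holomorphic_map_def by blast
  have "(\<lambda>(u, v). (a' * u + b' * v, c' * u + d' * v)) \<circ> (\<lambda>(u, v). (a * u + b * v, c * u + d * v)) =
    (\<lambda>(u, v). ((a' * a + b' * c) * u + (a' * b + b' * d) * v, (c' * a + d' * c) * u + (c' * b + d' * d) * v))"
    by (auto simp: fun_eq_iff algebra_simps)
  with diff_chain_at[OF K L] have "((L \<circ> K) has_derivative
    (\<lambda>(u, v). ((a' * a + b' * c) * u + (a' * b + b' * d) * v, (c' * a + d' * c) * u + (c' * b + d' * d) * v))) (at z)"
    by (simp only:)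
  then show "\<exists>a b c d. ((L \<circ> K) has_derivative (\<lambda>(u, v). (a * u + b * v, c * u + d * v))) (at z)"
    by blast
qed

lemma holomorphic_mapI:
  assumes "\<And>z. (L has_derivative (\<lambda>(u, v). (a z * u + b z * v, c z * u + d z * v))) (at z)"
  shows "holomorphic_map L"
  using assms unfolding holomorphic_map_def by blast

lemma holomorphic_map_lifts: "holomorphic_map (shear_lift k)" "holomorphic_map (rot_lift t)" "holomorphic_map (phi_lift s q)"
proof -
  have "(shear_lift k has_derivative (\<lambda>(u, v). (1 * u + of_int k * v, 0 * u + 1 * v))) (at z)" for z :: "complex \<times> complex"
    unfolding shear_lift_def[abs_def] by (auto intro!: derivative_eq_intros simp: split_beta)
  then show "holomorphic_map (shear_lift k)" by (rule holomorphic_mapI)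
  have "(rot_lift t has_derivative (\<lambda>(u, v). (1 * u + 0 * v, 0 * u + 1 * v))) (at z)" for z :: "complex \<times> complex"
    unfolding rot_lift_def[abs_def] by (auto intro!: derivative_eq_intros simp: split_beta)
  then show "holomorphic_map (rot_lift t)" by (rule holomorphic_mapI)
  have "(phi_lift s q has_derivative (\<lambda>(u, v). (1 * u + 0 * v,
      (of_real s * (- sin (of_real (2 * pi) * of_int q * fst z) * (of_real (2 * pi) * of_int q))) * u + 1 * v))) (at z)"
    for z :: "complex \<times> complex"
  proof -
    have "((\<lambda>z :: complex \<times> complex. of_real (2 * pi) * of_int q * fst z) has_derivative
      (\<lambda>w. of_real (2 * pi) * of_int q * fst w)) (at z)"
      by (intro has_derivative_mult_right has_derivative_fst has_derivative_ident)
    from has_derivative_compose[OF this DERIV_cos[unfolded has_field_derivative_def]]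
    have "((\<lambda>z :: complex \<times> complex. cos (of_real (2 * pi) * of_int q * fst z)) has_derivative
      (\<lambda>w. (of_real (2 * pi) * of_int q * fst w) * - sin (of_real (2 * pi) * of_int q * fst z))) (at z)"
      by (simp add: mult_ac)
    from has_derivative_Pair[OF has_derivative_fst[OF has_derivative_ident]
        has_derivative_add[OF has_derivative_snd[OF has_derivative_ident] has_derivative_mult_right[OF this, of "of_real s"]]]
    show ?thesis
      unfolding phi_lift_def[abs_def] by (rule has_derivative_eq_rhs) (auto simp: algebra_simps)
  qed
  then show "holomorphic_map (phi_lift s q)" by (rule holomorphic_mapI)
qed

lemma holomorphic_map_id: "holomorphic_map id"
proof (rule holomorphic_mapI)
  show "(id has_derivative (\<lambda>(u, v). (1 * u + 0 * v, 0 * u + 1 * v))) (at z)" for z :: "complex \<times> complex"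
    by (simp add: id_def case_prod_beta)
qed

lemma holomorphic_map_F_lift: "holomorphic_map (F_lift \<sigma> q n t)"
proof -
  have H: "holomorphic_map (H_lift \<sigma> q n)" "holomorphic_map (H_inv \<sigma> q n)"
    by (induction n) (auto simp: h_lift_def h_inv_def intro!: holomorphic_map_comp holomorphic_map_id holomorphic_map_lifts)
  show ?thesis
    unfolding F_lift_comp by (intro holomorphic_map_comp H holomorphic_map_lifts)
qed

lemma sep_holomorphic_holomorphic_map:
  assumes "holomorphic_map L"
  shows "sep_holomorphic A B (\<lambda>z. fst (L z))" "sep_holomorphic A B (\<lambda>z. snd (L z))"
proof -
  have D: "\<exists>a b. ((\<lambda>z. fst (L z)) has_derivative (\<lambda>(u, v). a * u + b * v)) (at z within S)"
    "\<exists>a b. ((\<lambda>z. snd (L z)) has_derivative (\<lambda>(u, v). a * u + b * v)) (at z within S)" for z S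
  proof -
    obtain a b c d where "(L has_derivative (\<lambda>(u, v). (a * u + b * v, c * u + d * v))) (at z)"
      using assms unfolding holomorphic_map_def by blast
    then have D: "(L has_derivative (\<lambda>(u, v). (a * u + b * v, c * u + d * v))) (at z within S)"
      by (rule has_derivative_at_withinI)
    have "((\<lambda>z. fst (L z)) has_derivative (\<lambda>(u, v). a * u + b * v)) (at z within S)"
      using has_derivative_fst[OF D] by (simp add: split_def)
    then show "\<exists>a b. ((\<lambda>z. fst (L z)) has_derivative (\<lambda>(u, v). a * u + b * v)) (at z within S)" by blast
    have "((\<lambda>z. snd (L z)) has_derivative (\<lambda>(u, v). c * u + d * v)) (at z within S)"
      using has_derivative_snd[OF D] by (simp add: split_def)
    then show "\<exists>a b. ((\<lambda>z. snd (L z)) has_derivative (\<lambda>(u, v). a * u + b * v)) (at z within S)" by blast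
  qed
  show "sep_holomorphic A B (\<lambda>z. fst (L z))" "sep_holomorphic A B (\<lambda>z. snd (L z))"
    by (rule sep_holomorphic_if_has_derivative, rule D)+
qed

lemma analytic_lift_F_lift:
  assumes "\<And>z. z \<in> strip \<rho> \<Longrightarrow> norm (F_lift \<sigma> q n t z - z) \<le> M"
  shows "analytic_lift \<rho> (F_lift \<sigma> q n t) (F_lift \<sigma> q n t)"
  unfolding analytic_lift_def
  by (intro conjI allI exI[of _ M] ballI sep_holomorphic_holomorphic_map holomorphic_map_F_lift F_lift_complexify
      F_lift_shift assms)

lemma norm_cis_diff_le: "norm (cis s - cis t) \<le> \<bar>s - t\<bar>"
proof -
  have "cis s - cis t = cis t * (exp (\<i> * of_real (s - t)) - 1)"
    by (simp add: cis_conv_exp algebra_simps flip: exp_add)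
  then have "norm (cis s - cis t) = 2 * \<bar>sin ((s - t) / 2)\<bar>"
    by (simp only: norm_mult norm_cis dist_exp_i_1)
  also have "\<dots> \<le> 2 * \<bar>(s - t) / 2\<bar>" by (intro mult_left_mono abs_sin_x_le_abs_x) auto
  finally show ?thesis by simp
qed

lemma torus_char_Lipschitz:
  "norm (torus_char a b x - torus_char a b y) \<le> 2 * pi * (\<bar>of_int a\<bar> + \<bar>of_int b\<bar>) * norm (x - y)"
proof -
  have "norm (torus_char a b x - torus_char a b y) \<le>
      \<bar>2 * pi * (of_int a * fst x + of_int b * snd x) - 2 * pi * (of_int a * fst y + of_int b * snd y)\<bar>"
    unfolding torus_char_def by (rule norm_cis_diff_le)
  also have "2 * pi * (of_int a * fst x + of_int b * snd x) - 2 * pi * (of_int a * fst y + of_int b * snd y) =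
      2 * pi * (of_int a * fst (x - y) + of_int b * snd (x - y))"
    by (simp add: algebra_simps)
  also have "\<bar>\<dots>\<bar> = 2 * pi * \<bar>of_int a * fst (x - y) + of_int b * snd (x - y)\<bar>"
    by (simp add: abs_mult)
  also have "\<dots> \<le> 2 * pi * (\<bar>of_int a\<bar> * norm (x - y) + \<bar>of_int b\<bar> * norm (x - y))"
  proof (intro mult_left_mono order_trans[OF abs_triangle_ineq add_mono])
    show "\<bar>of_int a * fst (x - y)\<bar> \<le> \<bar>of_int a\<bar> * norm (x - y)" "\<bar>of_int b * snd (x - y)\<bar> \<le> \<bar>of_int b\<bar> * norm (x - y)"
      using norm_fst_le_norm[of "x - y"] norm_snd_le_norm[of "x - y"]
      unfolding abs_mult by (auto intro!: mult_left_mono simp del: fst_diff snd_diff)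
  qed auto
  finally show ?thesis by (simp add: algebra_simps)
qed

text \<open>
  Since \<open>P\<close> is invertible modulo \<open>Q\<close>, some multiple of \<open>P / Q\<close> is modulo 1 close to \<open>1 / (2 * q)\<close>.
\<close>

lemma half_period_multiple:
  fixes P Q q :: int
  assumes cop: "coprime P Q" and q: "q \<ge> 1" and Q: "Q \<ge> 4 * q"
  shows "\<exists>m. 0 \<le> m \<and> m < Q \<and> \<bar>sin (pi * of_int q * (of_int m * (of_int P / of_int Q)))\<bar> \<ge> 1/2"
proof -
  \<comment> \<open>\<open>j / Q\<close> is the largest multiple of \<open>1 / Q\<close> not above
    \<open>1 / (2 * q)\<close>, so \<open>q * j / Q\<close> is close to \<open>1/2\<close> from
    below.\<close>
  define j where "j = Q div (2 * q)"
  have Q0: "Q > 0" using q Q by simp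
  \<comment> \<open>As \<open>x\<close> inverts \<open>P\<close> modulo \<open>Q\<close>, the
    multiple of \<open>P / Q\<close> by \<open>x * j\<close> equals \<open>j / Q\<close> up to an
    integer.\<close>
  obtain x where x: "[P * x = 1] (mod Q)"
    using cop by (metis cong_solve_coprime_int)
  define m where "m = (x * j) mod Q"
  have "[P * m = P * (x * j)] (mod Q)"
    unfolding m_def by (simp add: cong_def mod_mult_right_eq)
  moreover have "[P * x * j = 1 * j] (mod Q)"
    using x by (rule cong_scalar_right)
  ultimately have "[P * m = j] (mod Q)"
    by (metis cong_trans mult.assoc mult_1)
  then obtain l where l: "P * m = j + Q * l"
    by (metis cong_iff_lin cong_sym)
  have jq: "2 * q * j \<le> Q" "Q < 2 * q * j + 2 * q"
  proof -
    have "Q = 2 * q * j + Q mod (2 * q)" by (simp add: j_def)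
    moreover have "0 \<le> Q mod (2 * q)" "Q mod (2 * q) < 2 * q" using q by auto
    ultimately show "2 * q * j \<le> Q" "Q < 2 * q * j + 2 * q" by linarith+
  qed
  define y where "y = of_int (q * j) / (of_int Q :: real)"
  \<comment> \<open>Rounding loses less than \<open>2 * q\<close>, which is at most half of
    \<open>Q\<close> because \<open>Q \<ge> 4 * q\<close>. This is the origin of the factor 4 in the
    growth of the denominators.\<close>
  have "4 * (q * j) \<ge> Q" using jq Q by (simp add: mult.assoc)
  then have "4 * real_of_int (q * j) \<ge> of_int Q" by linarith
  moreover have "2 * real_of_int (q * j) \<le> of_int Q" using jq(1) by (simp only: mult.assoc)
  ultimately have y: "1/4 \<le> y" "y \<le> 1/2"
    using Q0 by (auto simp: y_def field_simps)
  have E: "pi * of_int q * (of_int m * (of_int P / of_int Q)) = pi * y + pi * of_int (q * l)"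
  proof -
    have "real_of_int P * of_int m = of_int j + of_int Q * of_int l"
      using l by (simp flip: of_int_mult of_int_add)
    then have "real_of_int m * (of_int P / of_int Q) = of_int j / of_int Q + of_int l"
      using Q0 by (simp add: field_simps)
    then show ?thesis by (simp add: y_def algebra_simps)
  qed
  have S: "\<bar>sin (z + pi * of_int i)\<bar> = \<bar>sin z\<bar>" for z :: real and i :: int
  proof -
    have "\<bar>cos (pi * of_int i)\<bar> = 1" "sin (pi * of_int i) = 0" for i :: int
      by (simp_all add: mult.commute)
    then show ?thesis by (simp add: sin_add abs_mult)
  qed
  have "sin (pi * y) \<ge> 1/2"
  proof -
    have "pi / 6 \<le> pi * y" "pi * y \<le> pi / 2" using y pi_gt_zero by (auto simp: field_simps)
    then have "sin (pi / 6) \<le> sin (pi * y)" by (intro sin_monotone_2pi_le) auto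
    then show ?thesis by (simp add: sin_30)
  qed
  then have "\<bar>sin (pi * of_int q * (of_int m * (of_int P / of_int Q)))\<bar> \<ge> 1/2"
    unfolding E S by linarith
  moreover have "0 \<le> m" "m < Q" using Q0 by (auto simp: m_def)
  ultimately show ?thesis by blast
qed

section \<open>The limit diffeomorphism\<close>

text \<open>Allows the passage to the limit in a composition where the inner point moves as well; it
  serves both the inverse of the limit and its iterates.\<close>

lemma tendsto_uniform_compose:
  fixes f :: "nat \<Rightarrow> real \<times> real \<Rightarrow> real \<times> real"
  assumes "\<And>n y. norm (f n y - g y) \<le> (1/2) ^ n" and cont: "continuous_on UNIV g" and x: "x \<longlonglongrightarrow> l"
  shows "(\<lambda>n. f n (x n)) \<longlonglongrightarrow> g l"
proof -
  have "(\<lambda>n. f n (x n) - g (x n)) \<longlonglongrightarrow> 0"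
  proof (rule Lim_null_comparison)
    show "\<forall>\<^sub>F n in sequentially. norm (f n (x n) - g (x n)) \<le> (1/2 :: real) ^ n"
      using assms(1) by simp
    show "(\<lambda>n. (1/2 :: real) ^ n) \<longlonglongrightarrow> 0" by (rule LIMSEQ_power_zero) simp
  qed
  moreover have "(\<lambda>n. g (x n)) \<longlonglongrightarrow> g l"
    using continuous_on_tendsto_compose[OF cont x] by simp
  ultimately have "(\<lambda>n. (f n (x n) - g (x n)) + g (x n)) \<longlonglongrightarrow> 0 + g l"
    by (rule tendsto_add)
  then show ?thesis by simp
qed

lemma torus_char_shift: "torus_char a b (x + (of_int m, of_int n)) = torus_char a b x"
  using torus_periodic_shift[OF torus_periodic_torus_char, of a b "fst x" m "snd x" n]
  by (simp add: plus_prod_def)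

text \<open>What the sequence has to satisfy, detached from how it is chosen. Stage \<open>n\<close>
  combines \<open>H_lift \<sigma> q n\<close> with the rational of index \<open>Suc n\<close>, as
  \<open>f_n\<close> does; hence the successors. In \<open>approx\<close>, negative \<open>m\<close>
  serves the inverse and large \<open>m\<close> the long iterates; \<open>mix\<close> covers more
  characters at each stage, with an error tending to 0.\<close>

locale conjugation_scheme =
  fixes \<sigma> \<rho> :: real and p q :: "nat \<Rightarrow> int"
  assumes \<rho>: "\<rho> > 0"
    and q_pos: "q (Suc n) \<ge> 1"
    and q_growth: "q (Suc (Suc n)) \<ge> 4 * q (Suc n)"
    and cop: "coprime (p (Suc n)) (q (Suc n))"
    and approx: "\<bar>m\<bar> \<le> q (Suc n) \<Longrightarrow> z \<in> strip \<rho> \<Longrightarrow>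
      norm (F_lift \<sigma> q (Suc n) (of_int m * (of_int (p (Suc (Suc n))) / of_int (q (Suc (Suc n))))) z -
            F_lift \<sigma> q n (of_int m * (of_int (p (Suc n)) / of_int (q (Suc n)))) z) \<le> (1/2) ^ Suc n"
    and mix: "a \<in> {- int n..int n} \<Longrightarrow> b \<in> {- int n..int n} \<Longrightarrow> c \<in> {- int n..int n} \<Longrightarrow> d \<in> {- int n..int n} \<Longrightarrow>
      \<bar>sin (pi * of_int (q (Suc n)) * t)\<bar> \<ge> 1/2 \<Longrightarrow>
      char_defect \<sigma> q n (Suc n) (q (Suc n)) t a b c d \<le> 1 / (real n + 1)"
begin

definition \<alpha> :: "nat \<Rightarrow> real" where
  "\<alpha> n = of_int (p (Suc n)) / of_int (q (Suc n))"

text \<open>The complexified lift of the \<open>j\<close>-th iterate of \<open>f_n\<close>, for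
  \<open>j\<close> of either sign; \<open>g\<close> is its restriction to the real plane.\<close>

abbreviation G :: "int \<Rightarrow> nat \<Rightarrow> complex \<times> complex \<Rightarrow> complex \<times> complex" where
  "G j n \<equiv> F_lift \<sigma> q n (of_int j * \<alpha> n)"

abbreviation g :: "int \<Rightarrow> nat \<Rightarrow> real \<times> real \<Rightarrow> real \<times> real" where
  "g j n \<equiv> F_lift \<sigma> q n (of_int j * \<alpha> n)"

section \<open>Convergence on the strip\<close>

lemma q_mono: "m \<le> n \<Longrightarrow> q (Suc m) \<le> q (Suc n)"
proof (induction n rule: dec_induct)
  case (step n)
  then show ?case using q_growth[of n] q_pos[of n] by linarith
qed simp

text \<open>The bound on \<open>j\<close> persists at later stages because \<open>q\<close>
  increases. A difference of powers makes the induction close: it grows by exactly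
  \<open>(1/2) ^ Suc k\<close> from \<open>k\<close> to \<open>Suc k\<close>.\<close>

lemma G_telescope:
  assumes "\<bar>j\<bar> \<le> q (Suc n)" "n \<le> k" "z \<in> strip \<rho>"
  shows "norm (G j k z - G j n z) \<le> (1/2) ^ n - (1/2) ^ k"
  using assms(2)
proof (induction k rule: dec_induct)
  case (step k)
  have "norm (G j (Suc k) z - G j k z) \<le> (1/2) ^ Suc k"
    unfolding \<alpha>_def using assms(1,3) q_mono[OF step(1)] by (intro approx) auto
  then have "norm ((G j (Suc k) z - G j k z) + (G j k z - G j n z)) \<le> (1/2) ^ Suc k + ((1/2) ^ n - (1/2) ^ k)"
    by (intro norm_triangle_mono step.IH)
  then show ?case by simp
qed simp

lemma G_close:
  assumes "\<bar>j\<bar> \<le> q (Suc n)" "n \<le> k" "z \<in> strip \<rho>"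
  shows "norm (G j k z - G j n z) \<le> (1/2) ^ n"
  using G_telescope[OF assms] by (rule order_trans) simp

lemma G_convergent:
  assumes j: "\<bar>j\<bar> \<le> 1" and z: "z \<in> strip \<rho>"
  shows "convergent (\<lambda>n. G j n z)"
proof -
  have jn: "\<bar>j\<bar> \<le> q (Suc n)" for n using j q_pos[of n] by linarith
  have "Cauchy (\<lambda>n. G j n z)"
  proof (rule metric_CauchyI)
    fix e :: real assume e: "e > 0"
    then obtain N where N: "(1/2 :: real) ^ N < e / 2"
      using real_arch_pow_inv[of "e / 2" "1/2"] by auto
    have "dist (G j m z) (G j n z) < e" if "m \<ge> N" "n \<ge> N" for m n
    proof -
      have "dist (G j m z) (G j n z) \<le> dist (G j m z) (G j N z) + dist (G j n z) (G j N z)"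
        by (rule dist_triangle2)
      also have "\<dots> \<le> (1/2) ^ N + (1/2) ^ N"
        unfolding dist_norm using that by (intro add_mono G_close jn z) auto
      finally show ?thesis using N by simp
    qed
    then show "\<exists>M. \<forall>m\<ge>M. \<forall>n\<ge>M. dist (G j m z) (G j n z) < e" by blast
  qed
  then show ?thesis by (rule Cauchy_convergent)
qed

text \<open>Meant for \<open>j = 1\<close> and \<open>j = - 1\<close>, the limit map and its
  inverse. Since \<open>q (Suc n) \<ge> 1\<close> for every \<open>n\<close>, the closeness
  condition covers these \<open>j\<close> at all stages.\<close>

definition G_lim :: "int \<Rightarrow> complex \<times> complex \<Rightarrow> complex \<times> complex" where
  "G_lim j z = lim (\<lambda>n. G j n z)"

definition g_lim :: "int \<Rightarrow> real \<times> real \<Rightarrow> real \<times> real" where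
  "g_lim j x = (Re (fst (G_lim j (complexify x))), Re (snd (G_lim j (complexify x))))"

lemma G_tendsto: "\<bar>j\<bar> \<le> 1 \<Longrightarrow> z \<in> strip \<rho> \<Longrightarrow> (\<lambda>n. G j n z) \<longlonglongrightarrow> G_lim j z"
  unfolding G_lim_def using G_convergent by (simp add: convergent_LIMSEQ_iff)

lemma G_lim_close:
  assumes "\<bar>j\<bar> \<le> 1" "z \<in> strip \<rho>"
  shows "norm (G_lim j z - G j n z) \<le> (1/2) ^ n"
proof (rule LIMSEQ_le_const2)
  show "(\<lambda>k. norm (G j k z - G j n z)) \<longlonglongrightarrow> norm (G_lim j z - G j n z)"
    by (intro tendsto_intros G_tendsto assms)
  have "\<bar>j\<bar> \<le> q (Suc n)" using assms(1) q_pos[of n] by linarith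
  then show "\<exists>N. \<forall>k\<ge>N. norm (G j k z - G j n z) \<le> (1/2) ^ n"
    using G_close assms(2) by blast
qed

lemma g_tendsto: "\<bar>j\<bar> \<le> 1 \<Longrightarrow> (\<lambda>n. g j n x) \<longlonglongrightarrow> g_lim j x"
proof -
  assume j: "\<bar>j\<bar> \<le> 1"
  have lim: "(\<lambda>n. G j n (complexify x)) \<longlonglongrightarrow> G_lim j (complexify x)"
    using j \<rho> by (intro G_tendsto) auto
  have "(\<lambda>n. (Re (fst (G j n (complexify x))), Re (snd (G j n (complexify x))))) \<longlonglongrightarrow> g_lim j x"
    unfolding g_lim_def by (intro tendsto_Pair tendsto_Re tendsto_fst tendsto_snd lim)
  then show ?thesis by (simp add: F_lift_complexify) (simp add: complexify_def)
qed

lemma G_lim_complexify: "\<bar>j\<bar> \<le> 1 \<Longrightarrow> G_lim j (complexify x) = complexify (g_lim j x)"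
proof -
  assume j: "\<bar>j\<bar> \<le> 1"
  have "(\<lambda>n. complexify (g j n x)) \<longlonglongrightarrow> complexify (g_lim j x)"
    unfolding complexify_def by (intro tendsto_intros g_tendsto j)
  moreover have "(\<lambda>n. complexify (g j n x)) \<longlonglongrightarrow> G_lim j (complexify x)"
    using G_tendsto[OF j, of "complexify x"] \<rho> by (simp add: F_lift_complexify)
  ultimately show ?thesis by (rule LIMSEQ_unique[symmetric])
qed

lemma g_close:
  assumes "\<bar>j\<bar> \<le> q (Suc n)" "n \<le> k"
  shows "norm (g j k x - g j n x) \<le> (1/2) ^ n"
  using G_close[OF assms, of "complexify x"] \<rho> by (simp add: F_lift_complexify flip: complexify_diff)

lemma g_lim_close: "\<bar>j\<bar> \<le> 1 \<Longrightarrow> norm (g j n x - g_lim j x) \<le> (1/2) ^ n"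
  using G_lim_close[of j "complexify x" n] \<rho>
  by (simp add: F_lift_complexify G_lim_complexify norm_minus_commute flip: complexify_diff)

text \<open>Stage 0 is the bare rotation by \<open>j * \<alpha> 0\<close>, and all later stages stay
  within 1 of it. The bound is uniform in \<open>n\<close> and therefore survives in the
  limit.\<close>

lemma G_displacement:
  assumes "\<bar>j\<bar> \<le> 1" "z \<in> strip \<rho>"
  shows "norm (G j n z - z) \<le> 1 + \<bar>\<alpha> 0\<bar>"
proof -
  have "norm (G j n z - G j 0 z) \<le> (1/2) ^ 0"
    using assms q_pos[of 0] by (intro G_close) auto
  moreover have "G j 0 z - z = (of_real (of_int j * \<alpha> 0), 0)"
    by (simp add: F_lift_def rot_lift_def prod_eq_iff)
  then have "norm (G j 0 z - z) = \<bar>of_int j\<bar> * \<bar>\<alpha> 0\<bar>"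
    by (simp only: norm_Pair norm_of_real abs_mult) simp
  moreover have "\<bar>of_int j\<bar> * \<bar>\<alpha> 0\<bar> \<le> 1 * \<bar>\<alpha> 0\<bar>"
    using assms(1) by (intro mult_right_mono) linarith+
  ultimately show ?thesis
    using norm_triangle_ineq[of "G j n z - G j 0 z" "G j 0 z - z"] by simp
qed

lemma analytic_lift_g: "\<bar>j\<bar> \<le> 1 \<Longrightarrow> analytic_lift \<rho> (g j n) (G j n)"
  using G_displacement by (rule analytic_lift_F_lift)

lemma analytic_lift_g_lim:
  assumes j: "\<bar>j\<bar> \<le> 1"
  shows "analytic_lift \<rho> (g_lim j) (G_lim j)"
  unfolding analytic_lift_def
proof (intro conjI allI)
  have pow: "(\<lambda>n. (1/2 :: real) ^ n) \<longlonglongrightarrow> 0" by (rule LIMSEQ_power_zero) simp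
  have "uniform_limit (band \<rho> \<times> band \<rho>) (\<lambda>n. G j n) (G_lim j) sequentially"
  proof (rule uniform_limitI)
    fix e :: real assume "e > 0"
    then have "\<forall>\<^sub>F n in sequentially. (1/2 :: real) ^ n < e"
      using order_tendstoD(2)[OF pow] by blast
    then show "\<forall>\<^sub>F n in sequentially. \<forall>z\<in>band \<rho> \<times> band \<rho>. dist (G j n z) (G_lim j z) < e"
      by (rule eventually_mono)
        (auto simp: dist_norm strip_eq norm_minus_commute intro: le_less_trans[OF G_lim_close[OF j, unfolded strip_eq]])
  qed
  then have u: "uniform_limit (band \<rho> \<times> band \<rho>) (\<lambda>n z. fst (G j n z)) (\<lambda>z. fst (G_lim j z)) sequentially"
    "uniform_limit (band \<rho> \<times> band \<rho>) (\<lambda>n z. snd (G j n z)) (\<lambda>z. snd (G_lim j z)) sequentially"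
    by (auto intro: bounded_linear_uniform_limit_intros)
  have s: "sep_holomorphic (band \<rho>) (band \<rho>) (\<lambda>z. fst (G j n z))" "sep_holomorphic (band \<rho>) (band \<rho>) (\<lambda>z. snd (G j n z))" for n
    by (intro sep_holomorphic_holomorphic_map holomorphic_map_F_lift)+
  show "sep_holomorphic (band \<rho>) (band \<rho>) (\<lambda>z. fst (G_lim j z))"
    by (rule sep_holomorphic_uniform_limit[OF open_band open_band s(1) u(1)])
  show "sep_holomorphic (band \<rho>) (band \<rho>) (\<lambda>z. snd (G_lim j z))"
    by (rule sep_holomorphic_uniform_limit[OF open_band open_band s(2) u(2)])
  have "norm (G_lim j z - z) \<le> 1 + \<bar>\<alpha> 0\<bar>" if z: "z \<in> strip \<rho>" for z
  proof (rule LIMSEQ_le_const2)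
    show "(\<lambda>n. norm (G j n z - z)) \<longlonglongrightarrow> norm (G_lim j z - z)"
      by (intro tendsto_intros G_tendsto j z)
    show "\<exists>N. \<forall>n\<ge>N. norm (G j n z - z) \<le> 1 + \<bar>\<alpha> 0\<bar>"
      using G_displacement[OF j z] by blast
  qed
  then show "\<exists>M. \<forall>z\<in>strip \<rho>. norm (G_lim j z - z) \<le> M" by blast
  show "G_lim j (complexify x) = complexify (g_lim j x)" for x
    using j by (rule G_lim_complexify)
  show "g_lim j (x + (of_int m, of_int n)) = g_lim j x + (of_int m, of_int n)" for x m n
  proof (rule LIMSEQ_unique)
    show "(\<lambda>k. g j k (x + (of_int m, of_int n))) \<longlonglongrightarrow> g_lim j (x + (of_int m, of_int n))"
      using j by (rule g_tendsto)
    show "(\<lambda>k. g j k (x + (of_int m, of_int n))) \<longlonglongrightarrow> g_lim j x + (of_int m, of_int n)"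
      unfolding F_lift_shift by (intro tendsto_intros g_tendsto j)
  qed
qed

lemma continuous_g_lim: "\<bar>j\<bar> \<le> 1 \<Longrightarrow> continuous_on UNIV (g_lim j)"
  using continuous_analytic_lift[OF \<rho> analytic_lift_g_lim] .

text \<open>At every stage the maps for \<open>j\<close> and \<open>- j\<close> are inverse to each
  other, and uniform convergence carries this relation to the limit. Bijectivity of \<open>f\<close>
  comes from here.\<close>

lemma g_lim_inverse:
  assumes "\<bar>j\<bar> \<le> 1"
  shows "g_lim j (g_lim (- j) x) = x"
proof (rule LIMSEQ_unique)
  show "(\<lambda>n. g j n (g (- j) n x)) \<longlonglongrightarrow> g_lim j (g_lim (- j) x)"
    using assms
    by (intro tendsto_uniform_compose[where f = "g j" and g = "g_lim j" and x = "\<lambda>n. g (- j) n x"]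
        g_lim_close continuous_g_lim g_tendsto) simp_all
  have "g j n (g (- j) n x) = x" for n
    by (simp add: F_lift_add F_lift_0)
  then show "(\<lambda>n. g j n (g (- j) n x)) \<longlonglongrightarrow> x" by simp
qed

lemma g_lim_lattice_rel:
  assumes "\<bar>j\<bar> \<le> 1" "lattice_rel x y"
  shows "lattice_rel (g_lim j x) (g_lim j y)"
proof -
  obtain m n where "x = y + (of_int m, of_int n)" using lattice_relE[OF assms(2)] .
  moreover have "g_lim j (y + (of_int m, of_int n)) = g_lim j y + (of_int m, of_int n)"
    using analytic_lift_g_lim[OF assms(1)] unfolding analytic_lift_def by blast
  ultimately show ?thesis by (simp add: lattice_rel_def)
qed

section \<open>The limit map on the torus\<close>

definition f :: "torus \<Rightarrow> torus" where
  "f = torus_map (g_lim 1)"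

lemma is_lift_f: "is_lift (g_lim 1) f" "is_lift (g_lim (- 1)) (torus_map (g_lim (- 1)))"
  unfolding f_def by (intro is_lift_torus_map g_lim_lattice_rel; simp)+

lemma f_in_Diff_omega: "f \<in> Diff_omega \<rho>"
  using \<rho> analytic_lift_g_lim analytic_lift_g_lim is_lift_f
  by (rule Diff_omega_if_lifts) (use g_lim_inverse[of 1] g_lim_inverse[of "- 1"] in auto)

lemma is_lift_g: "is_lift (g 1 n) (f_map \<sigma> p q n)"
  using is_lift_f_map[of \<sigma> q n p] by (simp add: \<alpha>_def)

lemma f_map_in_Diff_omega: "f_map \<sigma> p q n \<in> Diff_omega \<rho>"
proof (rule Diff_omega_if_lifts[OF \<rho> _ _ is_lift_g])
  show "analytic_lift \<rho> (g 1 n) (G 1 n)" "analytic_lift \<rho> (g (- 1) n) (G (- 1) n)"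
    by (intro analytic_lift_g; simp)+
  have "lattice_rel x y \<Longrightarrow> lattice_rel (g (- 1) n x) (g (- 1) n y)" for x y
    by (erule lattice_relE) (simp add: F_lift_shift lattice_rel_def)
  then show "is_lift (g (- 1) n) (torus_map (g (- 1) n))" by (rule is_lift_torus_map)
  show "g 1 n (g (- 1) n x) = x" "g (- 1) n (g 1 n x) = x" for x
    by (simp_all add: F_lift_add F_lift_0)
qed

lemma d_rho_tendsto: "(\<lambda>n. d_rho \<rho> (f_map \<sigma> p q n) f) \<longlonglongrightarrow> 0"
proof (rule Lim_null_comparison)
  have "norm (G 1 n z - G_lim 1 z) \<le> (1/2) ^ n" if "z \<in> strip \<rho>" for n z
    using G_lim_close[of 1 z n] that by (simp add: norm_minus_commute)
  note close = this
  have a: "analytic_lift \<rho> (g 1 n) (G 1 n)" "analytic_lift \<rho> (g_lim 1) (G_lim 1)" for n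
    by (intro analytic_lift_g analytic_lift_g_lim; simp)+
  note d_rho_analytic_lift[OF \<rho> a(1) is_lift_g a(2) is_lift_f(1) close]
  then show "\<forall>\<^sub>F n in sequentially. norm (d_rho \<rho> (f_map \<sigma> p q n) f) \<le> (1/2) ^ n" by simp
  show "(\<lambda>n. (1/2 :: real) ^ n) \<longlonglongrightarrow> 0" by (rule LIMSEQ_power_zero) simp
qed

lemma square_integral_rot_lift:
  assumes "continuous_on UNIV u" "torus_periodic u"
  shows "square_integral (\<lambda>x. u (rot_lift t x)) = square_integral u"
  using square_integral_skew(2)[OF assms, of "\<lambda>_. t"] by (simp add: rot_lift_def split_def)

lemma square_integral_F_lift:
  assumes u: "continuous_on UNIV u" "torus_periodic u"
  shows "square_integral (\<lambda>x. u (F_lift \<sigma> q n t x)) = square_integral u"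
proof -
  let ?v = "\<lambda>x. u (F_lift \<sigma> q n t x)"
  have "continuous_on UNIV ?v"
    by (rule continuous_on_compose2[OF u(1) continuous_on_F_lift]) simp
  moreover have "torus_periodic ?v"
    using u(2) by (intro torus_periodicI) (simp add: F_lift_shift torus_periodic_def lattice_rel_def del: split_paired_All)
  ultimately have "square_integral ?v = square_integral (\<lambda>x. ?v (H_lift \<sigma> q n x))"
    by (rule square_integral_H_lift[symmetric])
  also have "\<dots> = square_integral (\<lambda>x. (\<lambda>y. u (H_lift \<sigma> q n y)) (rot_lift t x))"
    by (simp add: F_lift_def H_lift_inverse)
  also have "\<dots> = square_integral (\<lambda>x. u (H_lift \<sigma> q n x))"
    by (intro square_integral_rot_lift continuous_on_comp_H_lift torus_periodic_H_lift u)
  also have "\<dots> = square_integral u"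
    using u by (rule square_integral_H_lift)
  finally show ?thesis .
qed

lemma square_integral_g_lim:
  assumes u: "continuous_on UNIV u" "torus_periodic u"
  shows "square_integral (\<lambda>x. u (g_lim 1 x)) = square_integral u"
proof (rule LIMSEQ_unique)
  obtain B where B: "\<And>x. norm (u x) \<le> B" using bounded_torus_periodic[OF u] by blast
  show "(\<lambda>n. square_integral (\<lambda>x. u (g 1 n x))) \<longlonglongrightarrow> square_integral (\<lambda>x. u (g_lim 1 x))"
    unfolding square_integral_def
  proof (rule dominated_convergence(2)[where h = "\<lambda>_. B"])
    show "(\<lambda>x. u (g 1 n x)) integrable_on cbox (0, 0) (1, 1)" for n
      by (intro square_integral_integrable continuous_on_compose2[OF u(1) continuous_on_F_lift]) simp
    show "(\<lambda>n. u (g 1 n x)) \<longlonglongrightarrow> u (g_lim 1 x)" for x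
      using continuous_on_tendsto_compose[OF u(1) g_tendsto[of 1 x]] by simp
  qed (auto simp: B)
  show "(\<lambda>n. square_integral (\<lambda>x. u (g 1 n x))) \<longlonglongrightarrow> square_integral u"
    using square_integral_F_lift[OF u] by simp
qed

lemma measure_preserving_f: "measure_preserving torus_measure f"
proof (rule measure_preserving_torus[OF is_lift_f(1)])
  show "continuous_on UNIV (g_lim 1)" by (rule continuous_g_lim) simp
  fix S :: "(real \<times> real) set" assume S: "S \<in> sets lebesgue"
  \<comment> \<open>Preimages under the limit are images under its inverse, and differentiable maps
    of the plane take Lebesgue sets to Lebesgue sets.\<close>
  have "g_lim (- 1) differentiable_on S"
    by (rule differentiable_analytic_lift[OF \<rho> analytic_lift_g_lim]) simp
  then have "g_lim (- 1) ` S \<in> sets lebesgue"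
    using S by (intro differentiable_image_in_sets_lebesgue) auto
  moreover have "g_lim 1 -` S = g_lim (- 1) ` S"
  proof (intro equalityI subsetI)
    have inv: "g_lim 1 (g_lim (- 1) x) = x" "g_lim (- 1) (g_lim 1 x) = x" for x
      using g_lim_inverse[of 1 x] g_lim_inverse[of "- 1" x] by simp_all
    show "x \<in> g_lim (- 1) ` S" if "x \<in> g_lim 1 -` S" for x
      using that inv by (intro image_eqI[of _ _ "g_lim 1 x"]) simp_all
    show "x \<in> g_lim 1 -` S" if "x \<in> g_lim (- 1) ` S" for x
      using that inv by auto
  qed
  ultimately show "g_lim 1 -` S \<in> sets lebesgue" by simp
qed (rule square_integral_g_lim)

text \<open>The \<open>k\<close>-th iterate of the limit is the limit of the \<open>k\<close>-th
  iterates, and from stage \<open>n\<close> on these stay within \<open>(1/2) ^ n\<close> as long as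
  \<open>k \<le> q (Suc n)\<close>.\<close>

lemma funpow_close:
  assumes "int k \<le> q (Suc n)"
  shows "norm ((g_lim 1 ^^ k) x - g (int k) n x) \<le> (1/2) ^ n"
proof (rule LIMSEQ_le_const2)
  have "(\<lambda>i. g (int k) i x) \<longlonglongrightarrow> (g_lim 1 ^^ k) x"
  proof (induction k)
    case 0
    show ?case by (simp add: F_lift_0)
  next
    case (Suc k)
    have "(\<lambda>i. g 1 i (g (int k) i x)) \<longlonglongrightarrow> g_lim 1 ((g_lim 1 ^^ k) x)"
      by (intro tendsto_uniform_compose[where f = "g 1" and g = "g_lim 1" and x = "\<lambda>i. g (int k) i x"]
          g_lim_close continuous_g_lim Suc) simp_all
    then show ?case by (simp add: F_lift_add distrib_right)
  qed
  then show "(\<lambda>i. norm (g (int k) i x - g (int k) n x)) \<longlonglongrightarrow> norm ((g_lim 1 ^^ k) x - g (int k) n x)"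
    by (intro tendsto_intros)
  show "\<exists>N. \<forall>i\<ge>N. norm (g (int k) i x - g (int k) n x) \<le> (1/2) ^ n"
    using g_close[of "int k" n _ x] assms by (intro exI[of _ n] allI impI) simp
qed

text \<open>A time for stage \<open>Suc n\<close>. It lies below \<open>q (Suc (Suc n))\<close>, the
  range in which the iterates of \<open>f\<close> and of \<open>f_{n+1}\<close> are close, and it
  makes the phase of frequency \<open>q (Suc n)\<close> oscillate with large amplitude.\<close>

definition mixing_time :: "nat \<Rightarrow> nat" where
  "mixing_time n = (SOME m. int m < q (Suc (Suc n)) \<and> \<bar>sin (pi * of_int (q (Suc n)) * (of_int (int m) * \<alpha> (Suc n)))\<bar> \<ge> 1/2)"

lemma mixing_time:
  "int (mixing_time n) < q (Suc (Suc n)) \<and>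
    \<bar>sin (pi * of_int (q (Suc n)) * (of_int (int (mixing_time n)) * \<alpha> (Suc n)))\<bar> \<ge> 1/2"
proof -
  obtain m where "0 \<le> m" "m < q (Suc (Suc n))"
    "\<bar>sin (pi * of_int (q (Suc n)) * (of_int m * \<alpha> (Suc n)))\<bar> \<ge> 1/2"
    using half_period_multiple[OF cop[of "Suc n"] q_pos[of n] q_growth] unfolding \<alpha>_def by blast
  then have "int (nat m) < q (Suc (Suc n)) \<and>
    \<bar>sin (pi * of_int (q (Suc n)) * (of_int (int (nat m)) * \<alpha> (Suc n)))\<bar> \<ge> 1/2" by simp
  then show ?thesis unfolding mixing_time_def by (rule someI)
qed

lemma continuous_g_lim_funpow: "continuous_on UNIV (g_lim 1 ^^ k)"
proof (induction k)
  case (Suc k)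
  have "continuous_on UNIV (\<lambda>x. g_lim 1 ((g_lim 1 ^^ k) x))"
    by (rule continuous_on_compose2[OF continuous_g_lim Suc]) auto
  then show ?case by (simp add: o_def)
qed (simp add: continuous_on_id)

text \<open>The first error comes from replacing the iterate of \<open>f\<close> by that of
  \<open>f_{n+1}\<close> inside a Lipschitz character, the second from \<open>mix\<close> at stage
  \<open>n\<close>.\<close>

lemma mixing_estimate:
  assumes "a \<in> {- int n..int n}" "b \<in> {- int n..int n}" "c \<in> {- int n..int n}" "d \<in> {- int n..int n}"
  shows "norm (square_integral (\<lambda>x. torus_char a b ((g_lim 1 ^^ mixing_time n) x) * torus_char c d x) -
      square_integral (torus_char a b) * square_integral (torus_char c d))
    \<le> 2 * pi * (\<bar>of_int a\<bar> + \<bar>of_int b\<bar>) * (1/2) ^ Suc n + 1 / (real n + 1)"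
proof -
  define m where "m = mixing_time n"
  define t where "t = of_int (int m) * \<alpha> (Suc n)"
  let ?e = "torus_char a b" and ?e' = "torus_char c d"
  let ?F = "F_lift \<sigma> q (Suc n) t :: real \<times> real \<Rightarrow> real \<times> real"
  have c1: "continuous_on UNIV (\<lambda>x. ?e ((g_lim 1 ^^ m) x) * ?e' x)"
    by (intro continuous_intros continuous_on_compose2[OF continuous_torus_char[of UNIV] continuous_g_lim_funpow]) simp
  have c2: "continuous_on UNIV (\<lambda>x. ?e (?F x) * ?e' x)"
    by (intro continuous_intros continuous_on_compose2[OF continuous_torus_char[of UNIV] continuous_on_F_lift]) simp
  have "norm (?e ((g_lim 1 ^^ m) x) * ?e' x - ?e (?F x) * ?e' x) \<le> 2 * pi * (\<bar>of_int a\<bar> + \<bar>of_int b\<bar>) * (1/2) ^ Suc n" for x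
  proof -
    have "norm (?e ((g_lim 1 ^^ m) x) * ?e' x - ?e (?F x) * ?e' x) = norm (?e ((g_lim 1 ^^ m) x) - ?e (?F x))"
      by (simp add: norm_mult flip: left_diff_distrib)
    also have "\<dots> \<le> 2 * pi * (\<bar>of_int a\<bar> + \<bar>of_int b\<bar>) * norm ((g_lim 1 ^^ m) x - ?F x)"
      by (rule torus_char_Lipschitz)
    also have "\<dots> \<le> 2 * pi * (\<bar>of_int a\<bar> + \<bar>of_int b\<bar>) * (1/2) ^ Suc n"
      unfolding t_def m_def using mixing_time[of n] by (intro mult_left_mono funpow_close) auto
    finally show ?thesis .
  qed
  with c1 c2 have 1: "norm (square_integral (\<lambda>x. ?e ((g_lim 1 ^^ m) x) * ?e' x) - square_integral (\<lambda>x. ?e (?F x) * ?e' x))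
    \<le> 2 * pi * (\<bar>of_int a\<bar> + \<bar>of_int b\<bar>) * (1/2) ^ Suc n"
    by (rule square_integral_diff_le)
  have "torus_periodic (\<lambda>x. ?e (?F x) * ?e' x)"
    by (intro torus_periodicI) (simp only: F_lift_shift torus_char_shift)
  \<comment> \<open>The lift of \<open>f_{n+1}\<close> is \<open>H_lift\<close>, \<open>Phi\<close>
    and \<open>H_inv\<close> of stage \<open>n\<close> in composition. Substituting the
    area-preserving \<open>H_lift \<sigma> q n\<close> for the variable cancels \<open>H_inv\<close>
    and puts \<open>H_lift\<close> into the second character, the form that \<open>mix\<close>
    estimates.\<close>
  with c2 have "square_integral (\<lambda>x. ?e (?F x) * ?e' x) =
      square_integral (\<lambda>x. (\<lambda>y. ?e (?F y) * ?e' y) (H_lift \<sigma> q n x))"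
    by (rule square_integral_H_lift[symmetric])
  also have "\<dots> = square_integral (\<lambda>x. ?e (H_lift \<sigma> q n (Phi (shear_number \<sigma> (Suc n) (q (Suc n))) (q (Suc n)) t x)) *
      ?e' (H_lift \<sigma> q n x))"
    by (simp add: F_lift_Suc H_lift_inverse del: H_lift.simps H_inv.simps)
  finally have 2: "norm (square_integral (\<lambda>x. ?e (?F x) * ?e' x) - square_integral ?e * square_integral ?e') \<le> 1 / (real n + 1)"
    using mix[OF assms, of t] mixing_time[of n] by (simp add: t_def m_def)
  from norm_triangle_mono[OF 1 2] show ?thesis by (simp add: m_def)
qed

lemma weak_mixing_f: "weak_mixing torus_measure f"
proof (rule weak_mixing_torus[OF measure_preserving_f, where m = mixing_time])
  fix a b c d :: int
  let ?I = "\<lambda>n. square_integral (\<lambda>x. torus_char a b ((g_lim 1 ^^ mixing_time n) x) * torus_char c d x)"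
  let ?l = "square_integral (torus_char a b) * square_integral (torus_char c d)"
  have "(LINT t|torus_measure. torus_char a b (torus_rep ((f ^^ m) t)) * torus_char c d (torus_rep t)) =
      square_integral (\<lambda>x. torus_char a b ((g_lim 1 ^^ m) x) * torus_char c d x)" for m
  proof -
    have L: "is_lift (g_lim 1 ^^ m) (f ^^ m)" by (intro is_lift_funpow is_lift_f)
    have "(LINT t|torus_measure. torus_char a b (torus_rep ((f ^^ m) t)) * torus_char c d (torus_rep t)) =
      (LINT t|torus_measure. torus_char a b ((g_lim 1 ^^ m) (torus_rep t)) * torus_char c d (torus_rep t))"
      by (simp only: torus_rep_lift[OF L torus_periodic_torus_char])
    also have "\<dots> = square_integral (\<lambda>x. torus_char a b ((g_lim 1 ^^ m) x) * torus_char c d x)"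
    proof (rule integral_torus_rep)
      show "continuous_on UNIV (\<lambda>x. torus_char a b ((g_lim 1 ^^ m) x) * torus_char c d x)"
        by (intro continuous_intros continuous_on_compose2[OF continuous_torus_char[of UNIV] continuous_g_lim_funpow]) simp
      show "torus_periodic (\<lambda>x. torus_char a b ((g_lim 1 ^^ m) x) * torus_char c d x)"
        unfolding torus_periodic_def
      proof (intro allI impI)
        fix x y assume r: "lattice_rel x y"
        have "torus_char a b ((g_lim 1 ^^ m) x) = torus_char a b ((g_lim 1 ^^ m) y)"
          using torus_periodic_torus_char is_lift_lattice_rel[OF L r] unfolding torus_periodic_def by blast
        moreover have "torus_char c d x = torus_char c d y"
          using torus_periodic_torus_char r unfolding torus_periodic_def by blast
        ultimately show "torus_char a b ((g_lim 1 ^^ m) x) * torus_char c d x =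
            torus_char a b ((g_lim 1 ^^ m) y) * torus_char c d y"
          by (simp only:)
      qed
    qed
    finally show ?thesis .
  qed
  moreover have "?I \<longlonglongrightarrow> ?l"
  proof (rule LIM_zero_cancel, rule Lim_null_comparison)
    \<comment> \<open>From this \<open>n\<close> on, all four indices lie in the range covered by
      \<open>mix\<close>.\<close>
    have "norm (?I n - ?l) \<le> 2 * pi * (\<bar>of_int a\<bar> + \<bar>of_int b\<bar>) * (1/2) ^ Suc n + 1 / (real n + 1)"
      if "n \<ge> nat (\<bar>a\<bar> + \<bar>b\<bar> + \<bar>c\<bar> + \<bar>d\<bar>)" for n
      using that by (intro mixing_estimate) auto
    then show "\<forall>\<^sub>F n in sequentially. norm (?I n - ?l) \<le> 2 * pi * (\<bar>of_int a\<bar> + \<bar>of_int b\<bar>) * (1/2) ^ Suc n + 1 / (real n + 1)"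
      unfolding eventually_sequentially by blast
    have "(\<lambda>n. K * (1/2) ^ Suc n + 1 / (real n + 1)) \<longlonglongrightarrow> 0" for K :: real
      by real_asymp
    then show "(\<lambda>n. 2 * pi * (\<bar>of_int a\<bar> + \<bar>of_int b\<bar>) * (1/2) ^ Suc n + 1 / (real n + 1)) \<longlonglongrightarrow> 0" .
  qed
  ultimately show "(\<lambda>n. LINT t|torus_measure. torus_char a b (torus_rep ((f ^^ mixing_time n) t)) * torus_char c d (torus_rep t)) \<longlonglongrightarrow> ?l"
    by simp
qed

end

section \<open>Choice of the sequence\<close>

text \<open>If the denominators were bounded, so would be the numerators, because
  \<open>p / q\<close> lies within 1 of \<open>\<alpha>\<close>; only finitely many solutions would
  remain.\<close>

lemma liouville_solutions_unbounded:
  assumes "infinite {(p, q). liouville_solution \<alpha> \<delta> p q}"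
  shows "\<exists>p q. q \<ge> N \<and> liouville_solution \<alpha> \<delta> p q"
proof (rule ccontr)
  assume no: "\<not> ?thesis"
  define M where "M = \<lceil>(\<bar>\<alpha>\<bar> + 1) * \<bar>of_int N\<bar>\<rceil>"
  have "{(p, q). liouville_solution \<alpha> \<delta> p q} \<subseteq> {- M..M} \<times> {1..N}"
  proof clarify
    fix p q assume sol: "liouville_solution \<alpha> \<delta> p q"
    have q: "1 \<le> q" "q < N" using sol no by (force simp: liouville_solution_def)+
    have "\<bar>\<alpha> - of_int p / of_int q\<bar> \<le> 1"
      using sol by (auto simp: liouville_solution_def intro: order_trans[OF less_imp_le])
    then have "\<bar>of_int p / of_int q\<bar> \<le> \<bar>\<alpha>\<bar> + 1" by linarith
    then have "\<bar>real_of_int p\<bar> \<le> (\<bar>\<alpha>\<bar> + 1) * of_int q"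
      using q by (simp add: abs_divide pos_divide_le_eq)
    also have "\<dots> \<le> (\<bar>\<alpha>\<bar> + 1) * \<bar>of_int N\<bar>" using q by (intro mult_left_mono) auto
    finally have "\<bar>p\<bar> \<le> M" unfolding M_def by linarith
    then show "p \<in> {- M..M} \<and> q \<in> {1..N}" using q by auto
  qed
  then show False using assms finite_subset by blast
qed

abbreviation steps_close ::
    "real \<Rightarrow> real \<Rightarrow> real \<Rightarrow> (nat \<Rightarrow> int) \<Rightarrow> nat \<Rightarrow> int \<Rightarrow> int \<Rightarrow> bool" where
  "steps_close \<delta> \<sigma> \<rho> q n p k \<equiv>
     (\<forall>(m :: int) a. \<bar>m\<bar> \<le> k \<longrightarrow> \<bar>a - of_int p / of_int k\<bar> \<le> 2 * exp (- (of_int k powr (1 + \<delta>))) \<longrightarrow>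
        (\<forall>z\<in>strip \<rho>. norm (H_lift \<sigma> q n (Phi (shear_number \<sigma> (Suc n) k) k (of_int m * a) (H_inv \<sigma> q n z)) -
           H_lift \<sigma> q n (rot_lift (of_int m * (of_int p / of_int k)) (H_inv \<sigma> q n z))) \<le> (1/2) ^ Suc n))"

abbreviation steps_mixing :: "real \<Rightarrow> (nat \<Rightarrow> int) \<Rightarrow> nat \<Rightarrow> int \<Rightarrow> bool" where
  "steps_mixing \<sigma> q n k \<equiv>
     (\<forall>a\<in>{- int n..int n}. \<forall>b\<in>{- int n..int n}. \<forall>c\<in>{- int n..int n}. \<forall>d\<in>{- int n..int n}. \<forall>t.
        \<bar>sin (pi * of_int k * t)\<bar> \<ge> 1/2 \<longrightarrow>
        char_defect \<sigma> q n (Suc n) k t a b c d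
          \<le> 1 / (real n + 1))"

text \<open>A condition on the next pair \<open>p, k\<close> that reads the sequence
  \<open>q\<close> only up to index \<open>n\<close>, as the recursion requires. The absolute value
  allows for an arbitrary entry \<open>q 0\<close>.\<close>

definition admissible_step ::
    "real \<Rightarrow> real \<Rightarrow> real \<Rightarrow> real \<Rightarrow> (nat \<Rightarrow> int) \<Rightarrow> nat \<Rightarrow> int \<Rightarrow> int \<Rightarrow> bool" where
  "admissible_step \<alpha> \<delta> \<sigma> \<rho> q n p k \<longleftrightarrow>
     liouville_solution \<alpha> \<delta> p k \<and> k > 4 * \<bar>q n\<bar> \<and>
     steps_close \<delta> \<sigma> \<rho> q n p k \<and>
     steps_mixing \<sigma> q n k"

text \<open>Apart from being a solution, every requirement holds for all sufficiently large
  \<open>k\<close>, uniformly in \<open>p\<close>; and there are solutions with arbitrarily large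
  denominators.\<close>

lemma admissible_step_exists:
  assumes "infinite {(p, q). liouville_solution \<alpha> \<delta> p q}" "0 < \<sigma>" "\<sigma> < \<delta>" "\<rho> > 0"
  shows "\<exists>p k. admissible_step \<alpha> \<delta> \<sigma> \<rho> q n p k"
proof -
  note ev = eventually_conj[OF eventually_gt_at_top[of "4 * \<bar>q n\<bar>"] eventually_conj[OF
      approximation_step[OF tame_H_lift(1)[of \<sigma> q n] tame_H_lift(2)[of \<sigma> q n] assms(2-4), of "(1/2) ^ Suc n" "Suc n"]
      mixing_step[of "Suc n" \<sigma> "1 / (real n + 1)" "int n" q n]]]
  from ev assms(2) obtain N where N: "\<And>k. k \<ge> N \<Longrightarrow> 4 * \<bar>q n\<bar> < k \<and>
     (\<forall>p. steps_close \<delta> \<sigma> \<rho> q n p k) \<and>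
     steps_mixing \<sigma> q n k"
    unfolding eventually_at_top_linorder by fastforce
  obtain p k where "k \<ge> N" "liouville_solution \<alpha> \<delta> p k"
    using liouville_solutions_unbounded[OF assms(1)] by blast
  then have "admissible_step \<alpha> \<delta> \<sigma> \<rho> q n p k"
    unfolding admissible_step_def using N by blast
  then show ?thesis by blast
qed

lemma admissible_sequence_exists:
  assumes "infinite {(p, q). liouville_solution \<alpha> \<delta> p q}" "0 < \<sigma>" "\<sigma> < \<delta>" "\<rho> > 0"
  shows "\<exists>p q. \<forall>n. admissible_step \<alpha> \<delta> \<sigma> \<rho> q n (p (Suc n)) (q (Suc n))"
proof -
  \<comment> \<open>A choice by course of values: through \<open>H_lift\<close> the condition at
    \<open>Suc n\<close> involves all earlier denominators. Index 0 carries no condition.\<close>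
  define P where "P = (\<lambda>(f :: nat \<Rightarrow> int \<times> int) x r. case x of 0 \<Rightarrow> True
    | Suc n \<Rightarrow> admissible_step \<alpha> \<delta> \<sigma> \<rho> (\<lambda>i. snd (f i)) n (fst r) (snd r))"
  have "\<exists>f. \<forall>x. P f x (f x)"
  proof (rule dependent_wellorder_choice)
    fix r and f g :: "nat \<Rightarrow> int \<times> int" and x :: nat
    assume fg: "\<And>y. y < x \<Longrightarrow> f y = g y"
    show "P f x r = P g x r"
    proof (cases x)
      case (Suc n)
      \<comment> \<open>Both conditions read \<open>f\<close> only below \<open>x\<close>. The
        complex lifts occur in the closeness condition, the real one in the mixing
        condition.\<close>
      have "H_lift \<sigma> (\<lambda>i. snd (f i)) n = (H_lift \<sigma> (\<lambda>i. snd (g i)) n :: complex \<times> complex \<Rightarrow> _)"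
        "H_inv \<sigma> (\<lambda>i. snd (f i)) n = (H_inv \<sigma> (\<lambda>i. snd (g i)) n :: complex \<times> complex \<Rightarrow> _)"
        "H_lift \<sigma> (\<lambda>i. snd (f i)) n = (H_lift \<sigma> (\<lambda>i. snd (g i)) n :: real \<times> real \<Rightarrow> _)"
        using fg Suc by (intro H_lift_cong; simp)+
      then show ?thesis
        using fg[of n] Suc unfolding P_def admissible_step_def by simp
    qed (simp add: P_def)
  next
    fix x and f :: "nat \<Rightarrow> int \<times> int"
    show "\<exists>r. P f x r"
    proof (cases x)
      case (Suc n)
      then show ?thesis
        using admissible_step_exists[OF assms, of "\<lambda>i. snd (f i)" n] by (auto simp: P_def)
    qed (simp add: P_def)
  qed
  then obtain f where f: "\<And>x. P f x (f x)" by blast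
  have "admissible_step \<alpha> \<delta> \<sigma> \<rho> (\<lambda>i. snd (f i)) n (fst (f (Suc n))) (snd (f (Suc n)))" for n
    using f[of "Suc n"] by (simp add: P_def)
  then show ?thesis
    by (intro exI[of _ "\<lambda>i. fst (f i)"] exI[of _ "\<lambda>i. snd (f i)"]) simp
qed

lemma conjugation_scheme_admissible:
  assumes adm: "\<And>n. admissible_step \<alpha> \<delta> \<sigma> \<rho> q n (p (Suc n)) (q (Suc n))" and "\<delta> > 0" "\<rho> > 0"
  shows "conjugation_scheme \<sigma> \<rho> p q"
proof
  have sol: "liouville_solution \<alpha> \<delta> (p (Suc n)) (q (Suc n))" and grow: "q (Suc n) > 4 * \<bar>q n\<bar>" for n
    using adm[of n] by (auto simp: admissible_step_def)
  show pos: "q (Suc n) \<ge> 1" and "coprime (p (Suc n)) (q (Suc n))" for n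
    using sol[of n] by (auto simp: liouville_solution_def)
  show grow': "q (Suc (Suc n)) \<ge> 4 * q (Suc n)" for n
    using grow[of "Suc n"] pos[of n] by simp
  show "\<rho> > 0" by fact
  show "norm (F_lift \<sigma> q (Suc n) (of_int m * (of_int (p (Suc (Suc n))) / of_int (q (Suc (Suc n))))) z -
            F_lift \<sigma> q n (of_int m * (of_int (p (Suc n)) / of_int (q (Suc n)))) z) \<le> (1/2) ^ Suc n"
    if "\<bar>m\<bar> \<le> q (Suc n)" "z \<in> strip \<rho>" for m n z
  proof -
    let ?a = "of_int (p (Suc (Suc n))) / of_int (q (Suc (Suc n))) :: real"
    have "of_int (q (Suc n)) powr (1 + \<delta>) \<le> of_int (q (Suc (Suc n))) powr (1 + \<delta>)"
      using pos[of n] grow'[of n] assms(2) by (intro powr_mono2) auto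
    then have "exp (- (of_int (q (Suc (Suc n))) powr (1 + \<delta>))) \<le> exp (- (of_int (q (Suc n)) powr (1 + \<delta>)))"
      by simp
    \<comment> \<open>Both rationals approximate the same \<open>\<alpha>\<close>, and the error of
      the later one is no larger than the one allowed at \<open>q (Suc n)\<close>; this gives the
      factor 2 of \<open>approximation_step\<close>.\<close>
    then have "\<bar>?a - of_int (p (Suc n)) / of_int (q (Suc n))\<bar> \<le> 2 * exp (- (of_int (q (Suc n)) powr (1 + \<delta>)))"
      using sol[of n] sol[of "Suc n"] unfolding liouville_solution_def by linarith
    then have "norm (H_lift \<sigma> q n (Phi (shear_number \<sigma> (Suc n) (q (Suc n))) (q (Suc n)) (of_int m * ?a) (H_inv \<sigma> q n z)) -
           H_lift \<sigma> q n (rot_lift (of_int m * (of_int (p (Suc n)) / of_int (q (Suc n)))) (H_inv \<sigma> q n z))) \<le> (1/2) ^ Suc n"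
      using adm[of n] that unfolding admissible_step_def by blast
    then show ?thesis
      unfolding F_lift_Suc by (simp only: F_lift_def)
  qed
  show "char_defect \<sigma> q n (Suc n) (q (Suc n)) t a b c d \<le> 1 / (real n + 1)"
    if "a \<in> {- int n..int n}" "b \<in> {- int n..int n}" "c \<in> {- int n..int n}" "d \<in> {- int n..int n}"
      "\<bar>sin (pi * of_int (q (Suc n)) * t)\<bar> \<ge> 1/2" for a b c d n t
    using adm[of n] that unfolding admissible_step_def by blast
qed

theorem theorem1p5:
  fixes \<alpha> \<delta> \<sigma> \<rho> :: real
  assumes "\<delta> > 0"
    and "infinite {(p, q). liouville_solution \<alpha> \<delta> p q}"
    and "0 < \<sigma>" and "\<sigma> < min (\<delta> / 3) 1"
    and "\<rho> > 0"
  shows "\<exists>p q :: nat \<Rightarrow> int.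
    (\<forall>n\<ge>1. liouville_solution \<alpha> \<delta> (p n) (q n)) \<and> strict_mono_on {1..} q \<and>
    (\<forall>n\<ge>1. f_map \<sigma> p q n \<in> Diff_omega \<rho>) \<and>
    (\<exists>f\<in>Diff_omega \<rho>.
       (\<lambda>n. d_rho \<rho> (f_map \<sigma> p q n) f) \<longlonglongrightarrow> 0 \<and> weak_mixing torus_measure f)"
proof -
  have "\<sigma> < \<delta>" using assms(1,4) by simp
  obtain p q where adm: "\<And>n. admissible_step \<alpha> \<delta> \<sigma> \<rho> q n (p (Suc n)) (q (Suc n))"
    using admissible_sequence_exists[OF assms(2,3) \<open>\<sigma> < \<delta>\<close> assms(5)] by blast
  interpret conjugation_scheme \<sigma> \<rho> p q
    using adm assms(1,5) by (rule conjugation_scheme_admissible)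
  have sol: "liouville_solution \<alpha> \<delta> (p n) (q n)" if "n \<ge> 1" for n
    using adm[of "n - 1"] that by (simp add: admissible_step_def)
  \<comment> \<open>Strictly increasing denominators make the chosen pairs a subsequence of the
    solutions.\<close>
  have "strict_mono_on {1..} q"
  proof (rule strict_mono_onI)
    fix m n :: nat assume mn: "m \<in> {1..}" "n \<in> {1..}" "m < n"
    have "q (Suc i) < q (Suc (Suc i))" for i
      using q_growth[of i] q_pos[of i] by linarith
    then have "strict_mono (\<lambda>i. q (Suc i))" by (simp add: strict_mono_Suc_iff)
    then have "q (Suc (m - 1)) < q (Suc (n - 1))" using mn by (intro strict_monoD[of "\<lambda>i. q (Suc i)"]) auto
    then show "q m < q n" using mn by simp
  qed
  then show ?thesis
    using sol f_map_in_Diff_omega f_in_Diff_omega d_rho_tendsto weak_mixing_f by blast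
qed

end
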